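(* Let $(V,c)$ be a braided vector space over a field $K$. The following assertions are equivalent for a braided bialgebra $B$. (1) There is a map $\gamma$ such that $(B,\gamma)$ is a $(V,c)$-bialgebra. (2) There is a surjective braided bialgebra map $\varphi:T(V,c)\to B$.
   Context: Fix a field $K$; all vector spaces, tensor products and maps are over $K$ ($K$-linear). An object also denotes its identity map. Braided vector space $(V,c)$: $c:V\otimes V\to V\otimes V$ linear with $(c\otimes V)(V\otimes c)(c\otimes V)=(V\otimes c)(c\otimes V)(V\otimes c)$; a morphism $f:(V,c_V)\to(W,c_W)$ is linear with $c_W(f\otimes f)=(f\otimes f)c_V$. Braided algebra $(A,m,u,c)$: an associative unital algebra and braided vector space with $c(m\otimes A)=(A\otimes m)(c\otimes A)(A\otimes c)$, $c(A\otimes m)=(m\otimes A)(A\otimes c)(c\otimes A)$, $c(u\otimes A)=A\otimes u$, $c(A\otimes u)=u\otimes A$. Braided coalgebra $(C,\Delta,\varepsilon,c)$: a coassociative counital coalgebra and braided vector space with $(\Delta\otimes C)c=(C\otimes c)(c\otimes C)(C\otimes\Delta)$, $(C\otimes\Delta)c=(c\otimes C)(C\otimes c)(\Delta\otimes C)$, $(\varepsilon\otimes C)c=C\otimes\varepsilon$, $(C\otimes\varepsilon)c=\varepsilon\otimes C$. Braided bialgebra $(B,m,u,\Delta,\varepsilon,c)$: a braided algebra and braided coalgebra with $\Delta m=(m\otimes m)(B\otimes c\otimes B)(\Delta\otimes\Delta)$, $\Delta(1)=1\otimes 1$, and $\varepsilon$ an algebra map. Morphisms of braided (bi)algebras are (bi)algebra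 maps that are morphisms of braided vector spaces. $P(B)=\{x\in B\mid \Delta(x)=x\otimes1+1\otimes x\}$. The braiding of $B$ restricts to a braiding $c_P$ on $P=P(B)$; $(P,c_P)$ is the infinitesimal part of $B$. Braided tensor algebra $T(V,c)$: the tensor algebra $T(V)$ with the unique braiding $c_T$ extending $c$ and making it a braided algebra, and with $\Delta_T$, $\varepsilon_T$ the algebra maps $\Delta_T:T(V)\to T(V)\otimes_c T(V)$, $\varepsilon_T:T(V)\to K$ such that $\Delta_T(v)=v\otimes1+1\otimes v$, $\varepsilon_T(v)=0$ for $v\in V$, where $T\otimes_cT$ has multiplication $(m_T\otimes m_T)(T\otimes c_T\otimes T)$. A $(V,c)$-bialgebra is a pair $(B,\gamma)$ where $B$ is a braided bialgebra with infinitesimal part $(P,c_P)$, $\gamma:(V,c)\to(P,c_P)$ is a morphism of braided vector spaces, and $\gamma(V)$ generates $B$ as a $K$-algebra. *)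

theory Defs
  imports Complex_Main "HOL-Library.Function_Algebras"
begin

section \<open>Vector spaces and tensor powers\<close>

text \<open>A vector space over the field \<open>'k\<close> is a linear subspace \<open>carrier V\<close> of an ambient
  vector space \<open>'v\<close>, whose addition is that of the type class and whose scalar
  multiplication is \<open>vscale V\<close>. Subspaces of \<open>V\<close> share the scalar multiplication.\<close>

record ('k, 'v) vspace =
  carrier :: "'v set"
  vscale :: "'k \<Rightarrow> 'v \<Rightarrow> 'v"

definition is_vspace :: "('k::field, 'v::ab_group_add, 'z) vspace_scheme \<Rightarrow> bool" where
  "is_vspace V \<longleftrightarrow> vector_space (vscale V) \<and> module.subspace (vscale V) (carrier V)"

definition linear_on ::
  "'v set \<Rightarrow> ('k \<Rightarrow> 'v \<Rightarrow> 'v) \<Rightarrow> ('k \<Rightarrow> 'w \<Rightarrow> 'w) \<Rightarrow> ('v::plus \<Rightarrow> 'w::plus) \<Rightarrow> bool" where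
  "linear_on S s t f \<longleftrightarrow>
     (\<forall>x\<in>S. \<forall>y\<in>S. f (x + y) = f x + f y) \<and> (\<forall>a. \<forall>x\<in>S. f (s a x) = t a (f x))"

text \<open>A multilinear form is a family of \<open>n\<close>-linear forms on the ambient space, one for every
  \<open>n\<close>. The tensor \<open>v1 \<otimes> \<dots> \<otimes> vn\<close> is evaluation of multilinear forms at \<open>[v1, \<dots>, vn]\<close>, and the
  \<open>n\<close>-th tensor power of \<open>V\<close> is the span of these evaluations for \<open>v1, \<dots>, vn\<close> in \<open>V\<close>. Since
  forms on a subspace extend to the ambient space, this has the universal property of the
  tensor power (see \<open>tensor_power_universal\<close>), and for a subspace \<open>P\<close> of \<open>B\<close> the space
  \<open>P \<otimes> P\<close> is literally contained in \<open>B \<otimes> B\<close>. The tensor powers of \<open>V\<close> are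
  independent and their sum is the tensor algebra.\<close>

type_synonym ('k, 'v) tensor = "('v list \<Rightarrow> 'k) \<Rightarrow> 'k"

definition multilinear_form ::
  "('k::field, 'v::ab_group_add, 'z) vspace_scheme \<Rightarrow> ('v list \<Rightarrow> 'k) \<Rightarrow> bool" where
  "multilinear_form V b \<longleftrightarrow>
     (\<forall>xs v w ys. b (xs @ (v + w) # ys) = b (xs @ v # ys) + b (xs @ w # ys)) \<and>
     (\<forall>xs a v ys. b (xs @ vscale V a v # ys) = a * b (xs @ v # ys))"

definition pure :: "('k::field, 'v::ab_group_add, 'z) vspace_scheme \<Rightarrow> 'v list \<Rightarrow> ('k, 'v) tensor" where
  "pure V vs = (\<lambda>b. if multilinear_form V b then b vs else 0)"

definition tscale :: "'k::field \<Rightarrow> ('k, 'v) tensor \<Rightarrow> ('k, 'v) tensor" where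
  "tscale a x = (\<lambda>b. a * x b)"

definition tensor_power ::
  "('k::field, 'v::ab_group_add, 'z) vspace_scheme \<Rightarrow> nat \<Rightarrow> ('k, 'v) tensor set" where
  "tensor_power V n =
     module.span tscale {pure V vs |vs. set vs \<subseteq> carrier V \<and> length vs = n}"

definition tensor_algebra ::
  "('k::field, 'v::ab_group_add, 'z) vspace_scheme \<Rightarrow> ('k, 'v) tensor set" where
  "tensor_algebra V = module.span tscale {pure V vs |vs. set vs \<subseteq> carrier V}"

text \<open>The tensor multiplication, i.e. the bilinear map with
  \<open>(v1 \<otimes> \<dots> \<otimes> vm) \<cdot> (w1 \<otimes> \<dots> \<otimes> wn) = v1 \<otimes> \<dots> \<otimes> vm \<otimes> w1 \<otimes> \<dots> \<otimes> wn\<close>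
  (see \<open>tconcat_pure\<close>). It is strictly associative, and \<open>pure V []\<close> is its unit.\<close>

definition tconcat ::
  "('k::field, 'v::ab_group_add, 'z) vspace_scheme \<Rightarrow> ('k, 'v) tensor \<Rightarrow> ('k, 'v) tensor \<Rightarrow> ('k, 'v) tensor" where
  "tconcat V x y =
     (\<lambda>b. if multilinear_form V b then x (\<lambda>xs. y (\<lambda>ys. b (xs @ ys))) else 0)"

text \<open>The linear map on the \<open>n\<close>-th tensor power of \<open>V\<close> induced by a multilinear map \<open>g\<close>. On the
  tensor power it is unique; its values elsewhere are irrelevant. Equations between such
  maps are therefore stated with \<open>eq_on\<close>.\<close>

definition lin_ext ::
  "('k::field, 'v::ab_group_add, 'z) vspace_scheme \<Rightarrow> nat \<Rightarrow> ('v list \<Rightarrow> ('k, 'w) tensor)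
     \<Rightarrow> ('k, 'v) tensor \<Rightarrow> ('k, 'w) tensor" where
  "lin_ext V n g =
     (SOME h. linear_on (tensor_power V n) tscale tscale h \<and>
        (\<forall>vs. set vs \<subseteq> carrier V \<longrightarrow> length vs = n \<longrightarrow> h (pure V vs) = g vs))"

definition eq_on :: "'v set \<Rightarrow> ('v \<Rightarrow> 'w) \<Rightarrow> ('v \<Rightarrow> 'w) \<Rightarrow> bool" where
  "eq_on S f g \<longleftrightarrow> (\<forall>x\<in>S. f x = g x)"

text \<open>\<open>f \<otimes>\<^bsub>V,p,q\<^esub> g\<close> is the tensor product of a map \<open>f\<close> defined on the \<open>p\<close>-th tensor power of \<open>V\<close>
  and a map \<open>g\<close> defined on the \<open>q\<close>-th one, both with values in tensor powers of \<open>V\<close>. The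
  ground field is identified with the \<open>0\<close>-th tensor power and \<open>V\<close>, through
  \<open>v \<mapsto> pure V [v]\<close>, with the first one; with these conventions associativity and unit
  constraints are identities.\<close>

definition tensor_map ::
  "(('k, 'v) tensor \<Rightarrow> ('k, 'v) tensor) \<Rightarrow> ('k::field, 'v::ab_group_add, 'z) vspace_scheme \<Rightarrow> nat \<Rightarrow> nat
     \<Rightarrow> (('k, 'v) tensor \<Rightarrow> ('k, 'v) tensor) \<Rightarrow> ('k, 'v) tensor \<Rightarrow> ('k, 'v) tensor"
  ("(_ \<otimes>\<^bsub>_,_,_\<^esub> _)" [71, 0, 0, 0, 70] 70) where
  "f \<otimes>\<^bsub>V,p,q\<^esub> g =
     lin_ext V (p + q) (\<lambda>vs. tconcat V (f (pure V (take p vs))) (g (pure V (drop p vs))))"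

definition tensor_square ::
  "('k::field, 'v::ab_group_add, 'y) vspace_scheme \<Rightarrow> ('k, 'w::ab_group_add, 'z) vspace_scheme \<Rightarrow> ('v \<Rightarrow> 'w)
     \<Rightarrow> ('k, 'v) tensor \<Rightarrow> ('k, 'w) tensor" where
  "tensor_square V W f = lin_ext V 2 (\<lambda>vs. pure W (map f vs))"

definition linear_map ::
  "('k::field, 'v::ab_group_add, 'y) vspace_scheme \<Rightarrow> ('k, 'w::ab_group_add, 'z) vspace_scheme \<Rightarrow> ('v \<Rightarrow> 'w) \<Rightarrow> bool" where
  "linear_map V W f \<longleftrightarrow>
     f ` carrier V \<subseteq> carrier W \<and> linear_on (carrier V) (vscale V) (vscale W) f"


section \<open>Braided vector spaces, algebras, coalgebras and bialgebras\<close>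

record ('k, 'v) braided_space = "('k, 'v) vspace" +
  braiding :: "('k, 'v) tensor \<Rightarrow> ('k, 'v) tensor"

record ('k, 'v) braided_alg = "('k, 'v) braided_space" +
  mult :: "'v \<Rightarrow> 'v \<Rightarrow> 'v"
  unit :: "'v"

record ('k, 'v) braided_bialg = "('k, 'v) braided_alg" +
  comult :: "'v \<Rightarrow> ('k, 'v) tensor"
  counit :: "'v \<Rightarrow> 'k"

definition braided_vector_space ::
  "('k::field, 'v::ab_group_add, 'z) braided_space_scheme \<Rightarrow> bool" where
  "braided_vector_space V \<longleftrightarrow> is_vspace V \<and>
     (let c = braiding V in
      c ` tensor_power V 2 \<subseteq> tensor_power V 2 \<and>
      linear_on (tensor_power V 2) tscale tscale c \<and>
      eq_on (tensor_power V 3)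
        ((c \<otimes>\<^bsub>V,2,1\<^esub> id) \<circ> (id \<otimes>\<^bsub>V,1,2\<^esub> c) \<circ> (c \<otimes>\<^bsub>V,2,1\<^esub> id))
        ((id \<otimes>\<^bsub>V,1,2\<^esub> c) \<circ> (c \<otimes>\<^bsub>V,2,1\<^esub> id) \<circ> (id \<otimes>\<^bsub>V,1,2\<^esub> c)))"

definition braided_map ::
  "('k::field, 'v::ab_group_add, 'y) braided_space_scheme \<Rightarrow> ('k, 'w::ab_group_add, 'z) braided_space_scheme
     \<Rightarrow> ('v \<Rightarrow> 'w) \<Rightarrow> bool" where
  "braided_map V W f \<longleftrightarrow> linear_map V W f \<and>
     eq_on (tensor_power V 2)
       (braiding W \<circ> tensor_square V W f) (tensor_square V W f \<circ> braiding V)"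

text \<open>The structure maps as linear maps between tensor powers.\<close>

definition mult_map ::
  "('k::field, 'v::ab_group_add, 'z) braided_alg_scheme \<Rightarrow> ('k, 'v) tensor \<Rightarrow> ('k, 'v) tensor" where
  "mult_map A = lin_ext A 2 (\<lambda>vs. pure A [mult A (vs ! 0) (vs ! 1)])"

definition unit_map ::
  "('k::field, 'v::ab_group_add, 'z) braided_alg_scheme \<Rightarrow> ('k, 'v) tensor \<Rightarrow> ('k, 'v) tensor" where
  "unit_map A = lin_ext A 0 (\<lambda>vs. pure A [unit A])"

definition comult_map ::
  "('k::field, 'v::ab_group_add, 'z) braided_bialg_scheme \<Rightarrow> ('k, 'v) tensor \<Rightarrow> ('k, 'v) tensor" where
  "comult_map C = lin_ext C 1 (\<lambda>vs. comult C (vs ! 0))"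

definition counit_map ::
  "('k::field, 'v::ab_group_add, 'z) braided_bialg_scheme \<Rightarrow> ('k, 'v) tensor \<Rightarrow> ('k, 'v) tensor" where
  "counit_map C = lin_ext C 1 (\<lambda>vs. tscale (counit C (vs ! 0)) (pure C []))"

definition unital_algebra ::
  "('k::field, 'v::ab_group_add, 'z) braided_alg_scheme \<Rightarrow> bool" where
  "unital_algebra A \<longleftrightarrow> is_vspace A \<and>
     unit A \<in> carrier A \<and>
     (\<forall>x\<in>carrier A. linear_map A A (mult A x)) \<and>
     (\<forall>y\<in>carrier A. linear_map A A (\<lambda>x. mult A x y)) \<and>
     (\<forall>x\<in>carrier A. \<forall>y\<in>carrier A. \<forall>z\<in>carrier A.
        mult A (mult A x y) z = mult A x (mult A y z)) \<and>
     (\<forall>x\<in>carrier A. mult A (unit A) x = x \<and> mult A x (unit A) = x)"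

definition braided_algebra ::
  "('k::field, 'v::ab_group_add, 'z) braided_alg_scheme \<Rightarrow> bool" where
  "braided_algebra A \<longleftrightarrow> unital_algebra A \<and> braided_vector_space A \<and>
     (let c = braiding A; m = mult_map A; u = unit_map A in
      eq_on (tensor_power A 3)
        (c \<circ> (m \<otimes>\<^bsub>A,2,1\<^esub> id)) ((id \<otimes>\<^bsub>A,1,2\<^esub> m) \<circ> (c \<otimes>\<^bsub>A,2,1\<^esub> id) \<circ> (id \<otimes>\<^bsub>A,1,2\<^esub> c)) \<and>
      eq_on (tensor_power A 3)
        (c \<circ> (id \<otimes>\<^bsub>A,1,2\<^esub> m)) ((m \<otimes>\<^bsub>A,2,1\<^esub> id) \<circ> (id \<otimes>\<^bsub>A,1,2\<^esub> c) \<circ> (c \<otimes>\<^bsub>A,2,1\<^esub> id)) \<and>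
      eq_on (tensor_power A 1) (c \<circ> (u \<otimes>\<^bsub>A,0,1\<^esub> id)) (id \<otimes>\<^bsub>A,1,0\<^esub> u) \<and>
      eq_on (tensor_power A 1) (c \<circ> (id \<otimes>\<^bsub>A,1,0\<^esub> u)) (u \<otimes>\<^bsub>A,0,1\<^esub> id))"

definition coalgebra ::
  "('k::field, 'v::ab_group_add, 'z) braided_bialg_scheme \<Rightarrow> bool" where
  "coalgebra C \<longleftrightarrow> is_vspace C \<and>
     comult C ` carrier C \<subseteq> tensor_power C 2 \<and>
     linear_on (carrier C) (vscale C) tscale (comult C) \<and>
     linear_on (carrier C) (vscale C) (*) (counit C) \<and>
     (let D = comult_map C; e = counit_map C in
      eq_on (tensor_power C 1) ((D \<otimes>\<^bsub>C,1,1\<^esub> id) \<circ> D) ((id \<otimes>\<^bsub>C,1,1\<^esub> D) \<circ> D) \<and>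
      eq_on (tensor_power C 1) ((e \<otimes>\<^bsub>C,1,1\<^esub> id) \<circ> D) id \<and>
      eq_on (tensor_power C 1) ((id \<otimes>\<^bsub>C,1,1\<^esub> e) \<circ> D) id)"

definition braided_coalgebra ::
  "('k::field, 'v::ab_group_add, 'z) braided_bialg_scheme \<Rightarrow> bool" where
  "braided_coalgebra C \<longleftrightarrow> coalgebra C \<and> braided_vector_space C \<and>
     (let c = braiding C; D = comult_map C; e = counit_map C in
      eq_on (tensor_power C 2)
        ((D \<otimes>\<^bsub>C,1,1\<^esub> id) \<circ> c) ((id \<otimes>\<^bsub>C,1,2\<^esub> c) \<circ> (c \<otimes>\<^bsub>C,2,1\<^esub> id) \<circ> (id \<otimes>\<^bsub>C,1,1\<^esub> D)) \<and>
      eq_on (tensor_power C 2)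
        ((id \<otimes>\<^bsub>C,1,1\<^esub> D) \<circ> c) ((c \<otimes>\<^bsub>C,2,1\<^esub> id) \<circ> (id \<otimes>\<^bsub>C,1,2\<^esub> c) \<circ> (D \<otimes>\<^bsub>C,1,1\<^esub> id)) \<and>
      eq_on (tensor_power C 2) ((e \<otimes>\<^bsub>C,1,1\<^esub> id) \<circ> c) (id \<otimes>\<^bsub>C,1,1\<^esub> e) \<and>
      eq_on (tensor_power C 2) ((id \<otimes>\<^bsub>C,1,1\<^esub> e) \<circ> c) (e \<otimes>\<^bsub>C,1,1\<^esub> id))"

definition braided_bialgebra ::
  "('k::field, 'v::ab_group_add, 'z) braided_bialg_scheme \<Rightarrow> bool" where
  "braided_bialgebra B \<longleftrightarrow> braided_algebra B \<and> braided_coalgebra B \<and>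
     (let c = braiding B; m = mult_map B; D = comult_map B in
      eq_on (tensor_power B 2)
        (D \<circ> m) ((m \<otimes>\<^bsub>B,2,2\<^esub> m) \<circ> (id \<otimes>\<^bsub>B,1,3\<^esub> (c \<otimes>\<^bsub>B,2,1\<^esub> id)) \<circ> (D \<otimes>\<^bsub>B,1,1\<^esub> D))) \<and>
     comult B (unit B) = pure B [unit B, unit B] \<and>
     (\<forall>x\<in>carrier B. \<forall>y\<in>carrier B. counit B (mult B x y) = counit B x * counit B y) \<and>
     counit B (unit B) = 1"

definition algebra_map ::
  "('k::field, 'v::ab_group_add, 'y) braided_alg_scheme \<Rightarrow> ('k, 'w::ab_group_add, 'z) braided_alg_scheme
     \<Rightarrow> ('v \<Rightarrow> 'w) \<Rightarrow> bool" where
  "algebra_map A B f \<longleftrightarrow> linear_map A B f \<and>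
     (\<forall>x\<in>carrier A. \<forall>y\<in>carrier A. f (mult A x y) = mult B (f x) (f y)) \<and> f (unit A) = unit B"

definition coalgebra_map ::
  "('k::field, 'v::ab_group_add, 'y) braided_bialg_scheme \<Rightarrow> ('k, 'w::ab_group_add, 'z) braided_bialg_scheme
     \<Rightarrow> ('v \<Rightarrow> 'w) \<Rightarrow> bool" where
  "coalgebra_map C D f \<longleftrightarrow> linear_map C D f \<and>
     (\<forall>x\<in>carrier C. comult D (f x) = tensor_square C D f (comult C x)) \<and>
     (\<forall>x\<in>carrier C. counit D (f x) = counit C x)"

definition braided_bialgebra_map ::
  "('k::field, 'v::ab_group_add, 'y) braided_bialg_scheme \<Rightarrow> ('k, 'w::ab_group_add, 'z) braided_bialg_scheme
     \<Rightarrow> ('v \<Rightarrow> 'w) \<Rightarrow> bool" where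
  "braided_bialgebra_map A B f \<longleftrightarrow> algebra_map A B f \<and> coalgebra_map A B f \<and> braided_map A B f"


section \<open>The infinitesimal part and \<open>(V,c)\<close>-bialgebras\<close>

definition primitives :: "('k::field, 'v::ab_group_add, 'z) braided_bialg_scheme \<Rightarrow> 'v set" where
  "primitives B = {x \<in> carrier B. comult B x = pure B [x, unit B] + pure B [unit B, x]}"

text \<open>Since the tensor square of the primitives is contained in that of \<open>B\<close>, the restricted
  braiding is given by the same function.\<close>

definition infinitesimal_part ::
  "('k::field, 'v::ab_group_add, 'z) braided_bialg_scheme \<Rightarrow> ('k, 'v) braided_space" where
  "infinitesimal_part B = \<lparr>carrier = primitives B, vscale = vscale B, braiding = braiding B\<rparr>"

definition subalgebra ::
  "'v set \<Rightarrow> ('k::field, 'v::ab_group_add, 'z) braided_alg_scheme \<Rightarrow> bool" where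
  "subalgebra S A \<longleftrightarrow> S \<subseteq> carrier A \<and> module.subspace (vscale A) S \<and> unit A \<in> S \<and>
     (\<forall>x\<in>S. \<forall>y\<in>S. mult A x y \<in> S)"

definition generates ::
  "'v set \<Rightarrow> ('k::field, 'v::ab_group_add, 'z) braided_alg_scheme \<Rightarrow> bool" where
  "generates X A \<longleftrightarrow> X \<subseteq> carrier A \<and> (\<forall>S. subalgebra S A \<and> X \<subseteq> S \<longrightarrow> S = carrier A)"

definition is_Vc_bialgebra ::
  "('k::field, 'v::ab_group_add, 'y) braided_space_scheme \<Rightarrow> ('k, 'b::ab_group_add, 'z) braided_bialg_scheme
     \<Rightarrow> ('v \<Rightarrow> 'b) \<Rightarrow> bool" where
  "is_Vc_bialgebra V B \<gamma> \<longleftrightarrow> braided_bialgebra B \<and>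
     braided_map V (infinitesimal_part B) \<gamma> \<and> generates (\<gamma> ` carrier V) B"


section \<open>The braided tensor algebra\<close>

text \<open>The braiding, comultiplication and counit are determined by the stated properties on
  the relevant carriers only, hence the use of \<open>SOME\<close>.\<close>

definition tensor_alg_with ::
  "('k::field, 'v::ab_group_add, 'z) braided_space_scheme \<Rightarrow> (('k, ('k, 'v) tensor) tensor \<Rightarrow> ('k, ('k, 'v) tensor) tensor)
     \<Rightarrow> ('k, ('k, 'v) tensor) braided_alg" where
  "tensor_alg_with V c =
     \<lparr>carrier = tensor_algebra V, vscale = tscale, braiding = c,
      mult = tconcat V, unit = pure V []\<rparr>"

definition braided_tensor_alg ::
  "('k::field, 'v::ab_group_add, 'z) braided_space_scheme \<Rightarrow> ('k, ('k, 'v) tensor) braided_alg" where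
  "braided_tensor_alg V =
     tensor_alg_with V (SOME c. braided_algebra (tensor_alg_with V c) \<and>
       braided_map V (tensor_alg_with V c) (\<lambda>v. pure V [v]))"

text \<open>The multiplication \<open>(m \<otimes> m)(A \<otimes> c \<otimes> A)\<close> of \<open>A \<otimes>\<^sub>c A\<close>, whose unit is \<open>1 \<otimes> 1\<close>.\<close>

definition braided_square_mult ::
  "('k::field, 'v::ab_group_add, 'z) braided_alg_scheme \<Rightarrow> ('k, 'v) tensor \<Rightarrow> ('k, 'v) tensor \<Rightarrow> ('k, 'v) tensor" where
  "braided_square_mult A x y =
     ((mult_map A \<otimes>\<^bsub>A,2,2\<^esub> mult_map A) \<circ> (id \<otimes>\<^bsub>A,1,3\<^esub> (braiding A \<otimes>\<^bsub>A,2,1\<^esub> id))) (tconcat A x y)"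

definition tensor_comult ::
  "('k::field, 'v::ab_group_add, 'z) braided_space_scheme \<Rightarrow> ('k, 'v) tensor \<Rightarrow> ('k, ('k, 'v) tensor) tensor" where
  "tensor_comult V =
     (let T = braided_tensor_alg V in
      SOME D. D ` carrier T \<subseteq> tensor_power T 2 \<and>
        linear_on (carrier T) tscale tscale D \<and>
        (\<forall>x\<in>carrier T. \<forall>y\<in>carrier T. D (mult T x y) = braided_square_mult T (D x) (D y)) \<and>
        D (unit T) = pure T [unit T, unit T] \<and>
        (\<forall>v\<in>carrier V. D (pure V [v]) = pure T [pure V [v], unit T] + pure T [unit T, pure V [v]]))"

definition tensor_counit ::
  "('k::field, 'v::ab_group_add, 'z) braided_space_scheme \<Rightarrow> ('k, 'v) tensor \<Rightarrow> 'k" where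
  "tensor_counit V =
     (let T = braided_tensor_alg V in
      SOME e. linear_on (carrier T) tscale (*) e \<and>
        (\<forall>x\<in>carrier T. \<forall>y\<in>carrier T. e (mult T x y) = e x * e y) \<and>
        e (unit T) = 1 \<and>
        (\<forall>v\<in>carrier V. e (pure V [v]) = 0))"

definition braided_tensor_algebra ::
  "('k::field, 'v::ab_group_add, 'z) braided_space_scheme \<Rightarrow> ('k, ('k, 'v) tensor) braided_bialg" where
  "braided_tensor_algebra V =
     braided_alg.extend (braided_tensor_alg V)
       \<lparr>comult = tensor_comult V, counit = tensor_counit V\<rparr>"


section \<open>Basic properties of tensor powers\<close>

lemma module_tscale: "module tscale"
  by standard (auto simp: tscale_def fun_eq_iff algebra_simps)

lemma vector_space_tscale: "vector_space tscale"
  by standard (auto simp: tscale_def fun_eq_iff algebra_simps)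

lemma multilinear_form_append1: "multilinear_form V b \<Longrightarrow> multilinear_form V (\<lambda>ys. b (xs @ ys))"
  unfolding multilinear_form_def append_assoc[symmetric] by blast

lemma multilinear_form_append2: "multilinear_form V b \<Longrightarrow> multilinear_form V (\<lambda>xs. b (xs @ ys))"
  unfolding multilinear_form_def by simp

lemma tconcat_pure: "tconcat V (pure V xs) (pure V ys) = pure V (xs @ ys)"
  by (auto simp: tconcat_def pure_def fun_eq_iff multilinear_form_append1 multilinear_form_append2)

lemma pure_add: "pure V (xs @ (v + w) # ys) = pure V (xs @ v # ys) + pure V (xs @ w # ys)"
  by (auto simp: pure_def fun_eq_iff multilinear_form_def)

lemma pure_scale: "pure V (xs @ vscale V a v # ys) = tscale a (pure V (xs @ v # ys))"
  by (auto simp: pure_def fun_eq_iff multilinear_form_def tscale_def)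

lemma projection_exists:
  assumes "is_vspace V"
  obtains p where "\<And>x y. p (x + y) = p x + p y" "\<And>a x. p (vscale V a x) = vscale V a (p x)"
    "\<And>x. p x \<in> carrier V" "\<And>x. x \<in> carrier V \<Longrightarrow> p x = x"
proof -
  interpret vector_space "vscale V" using assms by (simp add: is_vspace_def)
  interpret vector_space_pair "vscale V" "vscale V" ..
  have "\<exists>g. range g \<subseteq> carrier V \<and> Vector_Spaces.linear (vscale V) (vscale V) g \<and>
      (\<forall>v\<in>carrier V. g (id v) = v)"
    by (rule linear_exists_left_inverse_on)
      (use assms linear_id in \<open>simp_all add: is_vspace_def id_def\<close>)
  then obtain p where p: "range p \<subseteq> carrier V" "Vector_Spaces.linear (vscale V) (vscale V) p"
    "\<And>v. v \<in> carrier V \<Longrightarrow> p v = v" by auto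
  show thesis
  proof (rule that[of p])
    show "p (x + y) = p x + p y" "p (vscale V a x) = vscale V a (p x)" for a x y
      using p(2) by (simp_all add: Vector_Spaces.linear_iff)
  qed (use p in auto)
qed

text \<open>Universal property of the whole tensor algebra as the direct sum of the tensor powers.\<close>

lemma tensor_universal:
  fixes g :: "'v::ab_group_add list \<Rightarrow> ('k::field, 'w) tensor"
  assumes V: "is_vspace V"
    and add: "\<And>xs v w ys. set (xs @ v # w # ys) \<subseteq> carrier V \<Longrightarrow>
       g (xs @ (v + w) # ys) = g (xs @ v # ys) + g (xs @ w # ys)"
    and scale: "\<And>xs a v ys. set (xs @ v # ys) \<subseteq> carrier V \<Longrightarrow>
       g (xs @ vscale V a v # ys) = tscale a (g (xs @ v # ys))"
  shows "\<exists>h. (\<forall>x y. h (x + y) = h x + h y) \<and> (\<forall>a x. h (tscale a x) = tscale a (h x)) \<and>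
    (\<forall>vs. set vs \<subseteq> carrier V \<longrightarrow> h (pure V vs) = g vs)"
proof -
  obtain p where p: "\<And>x y. p (x + y) = p x + p y" "\<And>a x. p (vscale V a x) = vscale V a (p x)"
    "\<And>x. p x \<in> carrier V" "\<And>x. x \<in> carrier V \<Longrightarrow> p x = x"
    using projection_exists[OF V] by blast
  define h where "h z = (\<lambda>b. z (\<lambda>vs. g (map p vs) b))" for z :: "('k, 'v) tensor"
  have "multilinear_form V (\<lambda>vs. g (map p vs) b)" for b
    unfolding multilinear_form_def
  proof (intro conjI allI)
    fix xs ys v w a
    have "set (map p xs @ p v # p w # map p ys) \<subseteq> carrier V"
      "set (map p xs @ p v # map p ys) \<subseteq> carrier V"
      using p(3) by auto
    from add[OF this(1)] scale[OF this(2), of a]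
    show "g (map p (xs @ (v + w) # ys)) b = g (map p (xs @ v # ys)) b + g (map p (xs @ w # ys)) b"
      "g (map p (xs @ vscale V a v # ys)) b = a * g (map p (xs @ v # ys)) b"
      by (simp_all add: p(1,2) tscale_def)
  qed
  moreover have "map p vs = vs" if "set vs \<subseteq> carrier V" for vs
    using that p(4) by (simp add: map_idI subset_iff)
  ultimately show ?thesis
    by (intro exI[of _ h] conjI allI impI) (simp_all add: h_def fun_eq_iff tscale_def pure_def)
qed

lemma tensor_power_universal:
  fixes g :: "'v::ab_group_add list \<Rightarrow> ('k::field, 'w) tensor"
  assumes V: "is_vspace V"
    and add: "\<And>xs v w ys. set (xs @ v # w # ys) \<subseteq> carrier V \<Longrightarrow> length (xs @ v # ys) = n \<Longrightarrow>
       g (xs @ (v + w) # ys) = g (xs @ v # ys) + g (xs @ w # ys)"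
    and scale: "\<And>xs a v ys. set (xs @ v # ys) \<subseteq> carrier V \<Longrightarrow> length (xs @ v # ys) = n \<Longrightarrow>
       g (xs @ vscale V a v # ys) = tscale a (g (xs @ v # ys))"
  shows lin_ext_linear: "linear_on (tensor_power V n) tscale tscale (lin_ext V n g)"
    and lin_ext_pure: "set vs \<subseteq> carrier V \<Longrightarrow> length vs = n \<Longrightarrow> lin_ext V n g (pure V vs) = g vs"
proof -
  define g' where "g' vs = (if length vs = n then g vs else 0)" for vs
  have "\<exists>h. (\<forall>x y. h (x + y) = h x + h y) \<and> (\<forall>a x. h (tscale a x) = tscale a (h x)) \<and>
    (\<forall>vs. set vs \<subseteq> carrier V \<longrightarrow> h (pure V vs) = g' vs)"
  proof (rule tensor_universal[OF V])
    show "g' (xs @ (v + w) # ys) = g' (xs @ v # ys) + g' (xs @ w # ys)"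
      if "set (xs @ v # w # ys) \<subseteq> carrier V" for xs v w ys
      using add[OF that] by (simp add: g'_def)
    show "g' (xs @ vscale V a v # ys) = tscale a (g' (xs @ v # ys))"
      if "set (xs @ v # ys) \<subseteq> carrier V" for xs a v ys
      using scale[OF that] by (simp add: g'_def tscale_def fun_eq_iff)
  qed
  then obtain h where h: "\<forall>x y. h (x + y) = h x + h y" "\<forall>a x. h (tscale a x) = tscale a (h x)"
    "\<forall>vs. set vs \<subseteq> carrier V \<longrightarrow> h (pure V vs) = g' vs"
    by (elim exE conjE)
  have "linear_on (tensor_power V n) tscale tscale h"
    unfolding linear_on_def using h(1,2) by (intro conjI ballI allI) simp_all
  moreover have "\<forall>vs. set vs \<subseteq> carrier V \<longrightarrow> length vs = n \<longrightarrow> h (pure V vs) = g vs"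
    using h(3) by (simp add: g'_def)
  ultimately have ex: "\<exists>h. linear_on (tensor_power V n) tscale tscale h \<and>
      (\<forall>vs. set vs \<subseteq> carrier V \<longrightarrow> length vs = n \<longrightarrow> h (pure V vs) = g vs)"
    by (intro exI[of _ h] conjI)
  have lin: "linear_on (tensor_power V n) tscale tscale (lin_ext V n g) \<and>
      (\<forall>vs. set vs \<subseteq> carrier V \<longrightarrow> length vs = n \<longrightarrow> lin_ext V n g (pure V vs) = g vs)"
    unfolding lin_ext_def by (rule someI_ex[OF ex])
  show "linear_on (tensor_power V n) tscale tscale (lin_ext V n g)"
    using lin by (rule conjunct1)
  show "lin_ext V n g (pure V vs) = g vs" if "set vs \<subseteq> carrier V" "length vs = n"
    by (rule lin[THEN conjunct2, rule_format, OF that])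
qed

lemma linear_on_span_unique:
  fixes f g :: "('k::field, 'v) tensor \<Rightarrow> ('k, 'w) tensor"
  assumes S: "S = module.span tscale A"
    and f: "linear_on S tscale tscale f" and g: "linear_on S tscale tscale g"
    and eq: "\<And>x. x \<in> A \<Longrightarrow> f x = g x" and x: "x \<in> S"
  shows "f x = g x"
proof -
  interpret module tscale by (rule module_tscale)
  have sub: "subspace S" unfolding S by (rule subspace_span)
  have z: "h 0 = 0" if h: "linear_on S tscale tscale h"
    for h :: "('k, 'v) tensor \<Rightarrow> ('k, 'w) tensor"
  proof -
    have "h 0 + h 0 = h (0 + 0)"
      using h subspace_0[OF sub] by (simp only: linear_on_def)
    then show ?thesis by (simp only: add_0_left add_cancel_left_left)
  qed
  have "x \<in> S \<and> f x = g x"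
    using x unfolding S
  proof (induction rule: span_induct_alt)
    case base
    show ?case by (simp only: z[OF f] z[OF g] span_zero simp_thms)
  next
    case (step c a y)
    have mem: "a \<in> S" "y \<in> S" "tscale c a \<in> S" "tscale c a + y \<in> S"
      using step(1,2) by (simp_all only: S span_base span_scale span_add)
    have "f (tscale c a + y) = tscale c (f a) + f y"
      using f mem by (simp only: linear_on_def)
    moreover have "g (tscale c a + y) = tscale c (g a) + g y"
      using g mem by (simp only: linear_on_def)
    ultimately show ?case
      using mem(4) eq[OF step(1)] step(2) by (simp only: S simp_thms)
  qed
  then show ?thesis ..
qed

end

theory Submission
  imports Defs
begin

text \<open>The braiding of \<open>T(V)\<close> sends \<open>V\<^sup>m \<otimes> V\<^sup>n\<close> to \<open>V\<^sup>n \<otimes> V\<^sup>m\<close> by the braid that moves a block of \<open>m\<close> strands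
  past a block of \<open>n\<close> strands; its Yang-Baxter equation and its compatibility with the multiplication
  are identities in the braid group. For a braided algebra \<open>A\<close> the multiplication of \<open>A \<otimes>\<^sub>c A\<close> is
  associative, hence the comultiplication of \<open>T(V)\<close> exists as an algebra map. Given \<open>\<gamma>\<close>, the algebra
  map \<open>\<phi>\<close> on \<open>T(V)\<close> extending \<open>\<gamma>\<close> commutes with the braidings, because these are determined on words by
  their values on letters. Therefore \<open>\<phi> \<otimes> \<phi>\<close> is multiplicative for the braided tensor squares, and
  \<open>\<Delta> \<phi>\<close> and \<open>(\<phi> \<otimes> \<phi>) \<Delta>\<close> are algebra maps that agree on \<open>V\<close>, as do \<open>\<epsilon> \<phi>\<close> and \<open>\<epsilon>\<close>, since \<open>\<gamma>\<close> takes
  primitive values. Conversely a surjective \<open>\<phi>\<close> restricts to \<open>V\<close>, which consists of primitive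
  elements and generates \<open>T(V)\<close>.\<close>

text \<open>Tensors are functions on multilinear forms, but they are handled as abstract vectors
  whose sums are not evaluated pointwise unless a form is at hand. The main obstacle is that an
  entry of a tensor over T(V) mixes words of all lengths, so a crossing of two entries is no fixed
  braid. Identities are therefore tested on the images of \<open>split_tensor\<close>, where the
  lengths are prescribed and the braiding becomes a block permutation. Products of maps with
  identities are replaced by \<open>leg\<close>, which lives on all tensor powers at once; the
  axioms then become relations between operators indexed by a position, and only the bookkeeping of
  positions remains. Moreover the braiding of a pure tensor is in general not pure. Inductions on
  words thus have to admit an arbitrary tensor at the place where a crossing has just happened,
  which is why they contain an inner statement about all tensors of degree two. Finally, extensions
  of multilinear maps are available with values in tensors only. A map into \<open>B\<close> is
  obtained by working with \<open>pure B [b]\<close> in place of \<open>b\<close> and reading off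
  \<open>b\<close> by injectivity.\<close>

declare plus_fun_apply [simp del] zero_fun_apply [simp del] times_fun_apply [simp del] one_fun_apply [simp del]

section \<open>Linear maps on tensor powers\<close>

lemma subspace_tensor_power: "module.subspace tscale (tensor_power V n)"
  unfolding tensor_power_def by (rule module.subspace_span[OF module_tscale])

lemma subspace_tensor_algebra: "module.subspace tscale (tensor_algebra V)"
  unfolding tensor_algebra_def by (rule module.subspace_span[OF module_tscale])

lemmas tensor_power_0 [simp] = module.subspace_0[OF module_tscale subspace_tensor_power]
lemmas tensor_power_add [simp] = module.subspace_add[OF module_tscale subspace_tensor_power]
lemmas tensor_power_scale [simp] = module.subspace_scale[OF module_tscale subspace_tensor_power]
lemmas tensor_algebra_0 [simp] = module.subspace_0[OF module_tscale subspace_tensor_algebra]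
lemmas tensor_algebra_add [simp] = module.subspace_add[OF module_tscale subspace_tensor_algebra]
lemmas tensor_algebra_scale [simp] = module.subspace_scale[OF module_tscale subspace_tensor_algebra]

lemma pure_in_tp [simp]: "set vs \<subseteq> carrier V \<Longrightarrow> length vs = n \<Longrightarrow> pure V vs \<in> tensor_power V n"
  unfolding tensor_power_def by (rule module.span_base[OF module_tscale]) auto

lemma pure_in_ta [simp]: "set vs \<subseteq> carrier V \<Longrightarrow> pure V vs \<in> tensor_algebra V"
  unfolding tensor_algebra_def by (rule module.span_base[OF module_tscale]) auto

lemma tensor_power_subset_ta: "tensor_power V n \<subseteq> tensor_algebra V"
  unfolding tensor_power_def tensor_algebra_def by (rule module.span_mono[OF module_tscale]) auto

lemma tensor_power_in_algebra [simp]: "x \<in> tensor_power V n \<Longrightarrow> x \<in> tensor_algebra V"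
  using tensor_power_subset_ta by blast

lemma tscale_simps [simp]:
  "tscale a (x + y) = tscale a x + tscale a y" "tscale a 0 = 0" "tscale 0 x = 0" "tscale 1 x = x"
  "tscale a (tscale b x) = tscale (a * b) x"
  by (auto simp: tscale_def fun_eq_iff plus_fun_apply zero_fun_apply algebra_simps)

text \<open>Separate cases for sums and multiples, in contrast to the combined step of
  \<open>span_induct_alt\<close>, let linearity close everything except the case of words.\<close>

lemma tensor_power_induct [consumes 1, case_names zero pure add scale, induct set: tensor_power]:
  assumes x: "x \<in> tensor_power V n"
    and "P 0"
    and "\<And>vs. set vs \<subseteq> carrier V \<Longrightarrow> length vs = n \<Longrightarrow> P (pure V vs)"
    and "\<And>x y. x \<in> tensor_power V n \<Longrightarrow> y \<in> tensor_power V n \<Longrightarrow> P x \<Longrightarrow> P y \<Longrightarrow> P (x + y)"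
    and "\<And>a x. x \<in> tensor_power V n \<Longrightarrow> P x \<Longrightarrow> P (tscale a x)"
  shows "P x"
proof -
  let ?A = "{pure V vs |vs. set vs \<subseteq> carrier V \<and> length vs = n}"
  interpret module tscale by (rule module_tscale)
  have "x \<in> tensor_power V n \<and> P x"
    using x unfolding tensor_power_def
  proof (induction rule: span_induct_alt)
    case base
    show ?case using assms(2) span_zero by blast
  next
    case (step c z y)
    have z: "z \<in> tensor_power V n" "P z" using step(1) assms(3) by auto
    from step(2) have "y \<in> tensor_power V n" "P y" by (auto simp: tensor_power_def)
    with z have "tscale c z + y \<in> tensor_power V n" "P (tscale c z + y)" using assms(4,5) by auto
    then show ?case by (simp add: tensor_power_def)
  qed
  then show ?thesis ..
qed

lemma tensor_algebra_induct [consumes 1, case_names zero pure add scale, induct set: tensor_algebra]: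
  assumes x: "x \<in> tensor_algebra V"
    and "P 0"
    and "\<And>vs. set vs \<subseteq> carrier V \<Longrightarrow> P (pure V vs)"
    and "\<And>x y. x \<in> tensor_algebra V \<Longrightarrow> y \<in> tensor_algebra V \<Longrightarrow> P x \<Longrightarrow> P y \<Longrightarrow> P (x + y)"
    and "\<And>a x. x \<in> tensor_algebra V \<Longrightarrow> P x \<Longrightarrow> P (tscale a x)"
  shows "P x"
proof -
  interpret module tscale by (rule module_tscale)
  have "x \<in> tensor_algebra V \<and> P x"
    using x unfolding tensor_algebra_def
  proof (induction rule: span_induct_alt)
    case base
    show ?case using assms(2) span_zero by blast
  next
    case (step c z y)
    have z: "z \<in> tensor_algebra V" "P z" using step(1) assms(3) by auto
    from step(2) have "y \<in> tensor_algebra V" "P y" by (auto simp: tensor_algebra_def)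
    with z have "tscale c z + y \<in> tensor_algebra V" "P (tscale c z + y)" using assms(4,5) by auto
    then show ?case by (simp add: tensor_algebra_def)
  qed
  then show ?thesis ..
qed

section \<open>Concatenation of tensors: bilinearity, associativity and unit\<close>

lemma multilinear_form_add:
  "multilinear_form V b \<Longrightarrow> multilinear_form V b' \<Longrightarrow> multilinear_form V (\<lambda>vs. b vs + b' vs)"
  unfolding multilinear_form_def by (simp add: algebra_simps)

lemma multilinear_form_scale:
  "multilinear_form V b \<Longrightarrow> multilinear_form V (\<lambda>vs. a * b vs)"
  unfolding multilinear_form_def by (simp add: algebra_simps)

lemma multilinear_form_0: "multilinear_form V (\<lambda>vs. 0)"
  unfolding multilinear_form_def by simp

text \<open>A tensor is an arbitrary function of forms; linearity in the form is a property of the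
  span of evaluations. It makes \<open>tconcat\<close> additive in its right argument, while
  additivity on the left holds for all functions.\<close>

lemma tensor_form_add:
  assumes "x \<in> tensor_algebra V" "multilinear_form V b" "multilinear_form V b'"
  shows "x (\<lambda>vs. b vs + b' vs) = x b + x b'"
  using assms(1)
  by induction (use assms(2,3) in \<open>auto simp: plus_fun_apply zero_fun_apply pure_def multilinear_form_add tscale_def algebra_simps\<close>)

lemma tensor_form_scale:
  assumes "x \<in> tensor_algebra V" "multilinear_form V b"
  shows "x (\<lambda>vs. a * b vs) = a * x b"
  using assms(1)
  by induction (use assms(2) in \<open>auto simp: plus_fun_apply zero_fun_apply pure_def multilinear_form_scale tscale_def algebra_simps\<close>)

text \<open>Contracting the last arguments of a form with a tensor leaves a form. Since
  \<open>pure\<close> is 0 away from forms, a product can be evaluated only once the contracted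
  function is known to be one.\<close>

lemma tensor_form_multilinear:
  assumes "y \<in> tensor_algebra V" "multilinear_form V b"
  shows "multilinear_form V (\<lambda>xs. y (\<lambda>ys. b (xs @ ys)))"
  using assms(1)
proof induction
  case zero
  then show ?case by (simp add: multilinear_form_0 zero_fun_apply)
next
  case (pure vs)
  show ?case using multilinear_form_append2[OF assms(2), of vs]
    by (simp add: pure_def multilinear_form_append1[OF assms(2)])
next
  case (add x y)
  then show ?case using multilinear_form_add[OF add(3,4)] by (simp add: plus_fun_apply)
next
  case (scale a x)
  then show ?case using multilinear_form_scale[OF scale(2)] by (simp add: tscale_def)
qed

lemma tconcat_add_left [simp]: "tconcat V (x + x') y = tconcat V x y + tconcat V x' y"
  by (auto simp: tconcat_def fun_eq_iff plus_fun_apply zero_fun_apply)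

lemma tconcat_scale_left [simp]: "tconcat V (tscale a x) y = tscale a (tconcat V x y)"
  by (auto simp: tconcat_def fun_eq_iff plus_fun_apply zero_fun_apply tscale_def)

lemma tconcat_0_left [simp]: "tconcat V 0 y = 0"
  by (auto simp: tconcat_def fun_eq_iff plus_fun_apply zero_fun_apply)

lemma tconcat_add_right [simp]:
  assumes "x \<in> tensor_algebra V" "y \<in> tensor_algebra V" "y' \<in> tensor_algebra V"
  shows "tconcat V x (y + y') = tconcat V x y + tconcat V x y'"
  using tensor_form_add[OF assms(1) tensor_form_multilinear[OF assms(2)] tensor_form_multilinear[OF assms(3)]]
  by (simp add: tconcat_def fun_eq_iff plus_fun_apply)

lemma tconcat_scale_right [simp]:
  assumes "x \<in> tensor_algebra V" "y \<in> tensor_algebra V"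
  shows "tconcat V x (tscale a y) = tscale a (tconcat V x y)"
  using tensor_form_scale[OF assms(1) tensor_form_multilinear[OF assms(2)]]
  by (simp add: tconcat_def fun_eq_iff tscale_def)

lemma tconcat_0_right [simp]:
  assumes "x \<in> tensor_algebra V"
  shows "tconcat V x 0 = 0"
  using tconcat_scale_right[OF assms tensor_algebra_0, of 0] by simp

declare tconcat_pure [simp]

lemma tconcat_in_tp [simp]:
  assumes "x \<in> tensor_power V m" "y \<in> tensor_power V n"
  shows "tconcat V x y \<in> tensor_power V (m + n)"
  using assms(1)
proof induction
  case (pure xs)
  from assms(2) show ?case
    by induction (use pure in auto)
qed (use assms(2) in auto)

lemma tconcat_in_tp':
  assumes "x \<in> tensor_power V m" "y \<in> tensor_power V n" "k = m + n"
  shows "tconcat V x y \<in> tensor_power V k"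
  using assms by simp

lemma tconcat_in_ta [simp]:
  assumes "x \<in> tensor_algebra V" "y \<in> tensor_algebra V"
  shows "tconcat V x y \<in> tensor_algebra V"
  using assms(1)
proof induction
  case (pure xs)
  from assms(2) show ?case
    by induction (use pure in auto)
qed (use assms(2) in auto)

lemma tconcat_assoc:
  assumes "x \<in> tensor_algebra V" "y \<in> tensor_algebra V" "z \<in> tensor_algebra V"
  shows "tconcat V (tconcat V x y) z = tconcat V x (tconcat V y z)"
  using assms(1)
proof induction
  case (pure xs)
  from assms(2) show ?case
  proof induction
    case (pure ys)
    from assms(3) show ?case
      by induction (use pure \<open>set xs \<subseteq> carrier V\<close> in auto)
  qed (use pure assms(3) in auto)
qed (use assms(2,3) in auto)

lemma tconcat_unit_left [simp]:
  assumes "x \<in> tensor_algebra V"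
  shows "tconcat V (pure V []) x = x"
  using assms by induction auto

lemma tconcat_unit_right [simp]:
  assumes "x \<in> tensor_algebra V"
  shows "tconcat V x (pure V []) = x"
  using assms by induction auto

text \<open>Cutting every word after \<open>m\<close> letters shows that products span. Two nested
  uses expose a block in the middle of a tensor.\<close>

lemma tensor_power_split_induct [consumes 1, case_names zero tconcat add scale]:
  assumes "x \<in> tensor_power V (m + n)"
    and "P 0"
    and "\<And>y z. y \<in> tensor_power V m \<Longrightarrow> z \<in> tensor_power V n \<Longrightarrow> P (tconcat V y z)"
    and "\<And>x y. x \<in> tensor_power V (m + n) \<Longrightarrow> y \<in> tensor_power V (m + n) \<Longrightarrow> P x \<Longrightarrow> P y \<Longrightarrow> P (x + y)"
    and "\<And>a x. x \<in> tensor_power V (m + n) \<Longrightarrow> P x \<Longrightarrow> P (tscale a x)"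
  shows "P x"
  using assms(1)
proof induction
  case (pure vs)
  have "P (tconcat V (pure V (take m vs)) (pure V (drop m vs)))"
    using pure set_take_subset[of m vs] set_drop_subset[of m vs]
    by (intro assms(3) pure_in_tp) auto
  then show ?case by simp
qed (use assms in auto)

text \<open>The hypotheses of \<open>tensor_universal\<close>, for words of every length at once. A
  map meant for words of one length is continued by 0 to the other lengths, hence the conditionals
  in its uses.\<close>

definition multilinear_map ::
  "('k::field, 'v::ab_group_add, 'z) vspace_scheme \<Rightarrow> ('v list \<Rightarrow> ('k, 'w) tensor) \<Rightarrow> bool" where
  "multilinear_map V g \<longleftrightarrow>
     (\<forall>xs v w ys. set (xs @ v # w # ys) \<subseteq> carrier V \<longrightarrow>
        g (xs @ (v + w) # ys) = g (xs @ v # ys) + g (xs @ w # ys)) \<and>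
     (\<forall>xs a v ys. set (xs @ v # ys) \<subseteq> carrier V \<longrightarrow>
        g (xs @ vscale V a v # ys) = tscale a (g (xs @ v # ys)))"

text \<open>The extension is linear on the whole function type and not just on the tensor algebra,
  so its linearity rules carry no membership conditions.\<close>

definition tensor_ext ::
  "('k::field, 'v::ab_group_add, 'z) vspace_scheme \<Rightarrow> ('v list \<Rightarrow> ('k, 'w) tensor)
     \<Rightarrow> ('k, 'v) tensor \<Rightarrow> ('k, 'w) tensor" where
  "tensor_ext V g = (SOME h. (\<forall>x y. h (x + y) = h x + h y) \<and> (\<forall>a x. h (tscale a x) = tscale a (h x)) \<and>
    (\<forall>vs. set vs \<subseteq> carrier V \<longrightarrow> h (pure V vs) = g vs))"

lemma tensor_ext_universal:
  assumes "is_vspace V" "multilinear_map V g"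
  shows "(\<forall>x y. tensor_ext V g (x + y) = tensor_ext V g x + tensor_ext V g y) \<and>
    (\<forall>a x. tensor_ext V g (tscale a x) = tscale a (tensor_ext V g x)) \<and>
    (\<forall>vs. set vs \<subseteq> carrier V \<longrightarrow> tensor_ext V g (pure V vs) = g vs)"
proof -
  have "\<exists>h. (\<forall>x y. h (x + y) = h x + h y) \<and> (\<forall>a x. h (tscale a x) = tscale a (h x)) \<and>
    (\<forall>vs. set vs \<subseteq> carrier V \<longrightarrow> h (pure V vs) = g vs)"
    by (rule tensor_universal[OF assms(1)]) (use assms(2) in \<open>unfold multilinear_map_def, blast+\<close>)
  then show ?thesis unfolding tensor_ext_def by (rule someI_ex)
qed

lemma tensor_ext_add: "is_vspace V \<Longrightarrow> multilinear_map V g \<Longrightarrow> tensor_ext V g (x + y) = tensor_ext V g x + tensor_ext V g y"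
  and tensor_ext_scale: "is_vspace V \<Longrightarrow> multilinear_map V g \<Longrightarrow> tensor_ext V g (tscale a x) = tscale a (tensor_ext V g x)"
  and tensor_ext_pure: "is_vspace V \<Longrightarrow> multilinear_map V g \<Longrightarrow> set vs \<subseteq> carrier V \<Longrightarrow> tensor_ext V g (pure V vs) = g vs"
  using tensor_ext_universal by blast+

lemma tensor_ext_0: "is_vspace V \<Longrightarrow> multilinear_map V g \<Longrightarrow> tensor_ext V g 0 = 0"
  using tensor_ext_scale[of V g 0 0] by simp

lemma tensor_ext_in_subspace:
  assumes "is_vspace V" "multilinear_map V g" "module.subspace tscale S" "x \<in> tensor_algebra V"
    "\<And>vs. set vs \<subseteq> carrier V \<Longrightarrow> g vs \<in> S"
  shows "tensor_ext V g x \<in> S"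
proof -
  interpret module tscale by (rule module_tscale)
  from assms(4) show ?thesis
    by induction (simp_all add: assms tensor_ext_0 tensor_ext_add tensor_ext_scale tensor_ext_pure
        subspace_0 subspace_add subspace_scale)
qed

text \<open>Maps obtained from \<open>lin_ext\<close> are specified on a single tensor power, so
  linearity and range are recorded relative to that power.\<close>

definition hom ::
  "('k::field, 'v::ab_group_add, 'y) vspace_scheme \<Rightarrow> ('k, 'w::ab_group_add, 'z) vspace_scheme
     \<Rightarrow> nat \<Rightarrow> nat \<Rightarrow> (('k, 'v) tensor \<Rightarrow> ('k, 'w) tensor) \<Rightarrow> bool" where
  "hom V W m n f \<longleftrightarrow> linear_on (tensor_power V m) tscale tscale f \<and>
     f ` tensor_power V m \<subseteq> tensor_power W n"

lemma hom_add: "hom V W m n f \<Longrightarrow> x \<in> tensor_power V m \<Longrightarrow> y \<in> tensor_power V m \<Longrightarrow> f (x + y) = f x + f y"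
  and hom_scale: "hom V W m n f \<Longrightarrow> x \<in> tensor_power V m \<Longrightarrow> f (tscale a x) = tscale a (f x)"
  and hom_in: "hom V W m n f \<Longrightarrow> x \<in> tensor_power V m \<Longrightarrow> f x \<in> tensor_power W n"
  by (auto simp: hom_def linear_on_def)

lemma hom_0: "hom V W m n f \<Longrightarrow> f 0 = 0"
  using hom_scale[of V W m n f 0 0] by simp

lemma hom_id [simp]: "hom V V n n id"
  by (simp add: hom_def linear_on_def)

lemma hom_comp: "hom V W l m f \<Longrightarrow> hom W X m n g \<Longrightarrow> hom V X l n (g \<circ> f)"
  by (auto simp: hom_def linear_on_def image_subset_iff)

lemma homI:
  assumes "\<And>x y. x \<in> tensor_power V m \<Longrightarrow> y \<in> tensor_power V m \<Longrightarrow> f (x + y) = f x + f y"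
    and "\<And>a x. x \<in> tensor_power V m \<Longrightarrow> f (tscale a x) = tscale a (f x)"
    and "\<And>vs. set vs \<subseteq> carrier V \<Longrightarrow> length vs = m \<Longrightarrow> f (pure V vs) \<in> tensor_power W n"
  shows "hom V W m n f"
proof -
  have "f x \<in> tensor_power W n" if "x \<in> tensor_power V m" for x
    using that
  proof induction
    case zero
    have "f (tscale 0 0) = tscale 0 (f 0)" by (rule assms(2)) simp
    then show ?case by simp
  qed (use assms in auto)
  then show ?thesis using assms(1,2) by (auto simp: hom_def linear_on_def)
qed

lemma hom_eqI:
  assumes "hom V W m n f" "hom V W m n g"
    and "\<And>vs. set vs \<subseteq> carrier V \<Longrightarrow> length vs = m \<Longrightarrow> f (pure V vs) = g (pure V vs)"
  shows "eq_on (tensor_power V m) f g"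
  unfolding eq_on_def
proof
  fix x assume "x \<in> tensor_power V m"
  then show "f x = g x"
    by induction (use assms in \<open>auto simp: hom_add hom_scale hom_0\<close>)
qed

lemma lin_ext_hom:
  assumes "is_vspace V" "multilinear_map V (\<lambda>vs. if length vs = n then g vs else 0)"
    and "\<And>vs. set vs \<subseteq> carrier V \<Longrightarrow> length vs = n \<Longrightarrow> g vs \<in> tensor_power W m"
  shows "hom V W n m (lin_ext V n g)"
    and "set vs \<subseteq> carrier V \<Longrightarrow> length vs = n \<Longrightarrow> lin_ext V n g (pure V vs) = g vs"
proof -
  let ?g = "\<lambda>vs. if length vs = n then g vs else 0"
  have 1: "g (xs @ (v + w) # ys) = g (xs @ v # ys) + g (xs @ w # ys)"
    if "set (xs @ v # w # ys) \<subseteq> carrier V" "length (xs @ v # ys) = n" for xs v w ys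
  proof -
    have "?g (xs @ (v + w) # ys) = ?g (xs @ v # ys) + ?g (xs @ w # ys)"
      using assms(2) that(1) unfolding multilinear_map_def by blast
    then show ?thesis using that(2) by simp
  qed
  have 2: "g (xs @ vscale V a v # ys) = tscale a (g (xs @ v # ys))"
    if "set (xs @ v # ys) \<subseteq> carrier V" "length (xs @ v # ys) = n" for xs a v ys
  proof -
    have "?g (xs @ vscale V a v # ys) = tscale a (?g (xs @ v # ys))"
      using assms(2) that(1) unfolding multilinear_map_def by blast
    then show ?thesis using that(2) by simp
  qed
  show pure: "lin_ext V n g (pure V vs) = g vs" if "set vs \<subseteq> carrier V" "length vs = n" for vs
    using lin_ext_pure[OF assms(1) 1 2 that] by blast
  have "linear_on (tensor_power V n) tscale tscale (lin_ext V n g)"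
    using lin_ext_linear[OF assms(1) 1 2] by blast
  then show "hom V W n m (lin_ext V n g)"
    by (intro homI) (auto simp: linear_on_def pure assms(3))
qed

lemma is_vspace_closed:
  assumes "is_vspace V"
  shows "v \<in> carrier V \<Longrightarrow> w \<in> carrier V \<Longrightarrow> v + w \<in> carrier V"
    and "v \<in> carrier V \<Longrightarrow> vscale V a v \<in> carrier V" and "0 \<in> carrier V"
proof -
  interpret vector_space "vscale V" using assms by (simp add: is_vspace_def)
  have "subspace (carrier V)" using assms by (simp add: is_vspace_def)
  then show "v \<in> carrier V \<Longrightarrow> w \<in> carrier V \<Longrightarrow> v + w \<in> carrier V"
    "v \<in> carrier V \<Longrightarrow> vscale V a v \<in> carrier V" "0 \<in> carrier V"
    by (simp_all add: subspace_add subspace_scale subspace_0)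
qed

lemma multilinear_map_cong:
  assumes "is_vspace V" "multilinear_map V g" "\<And>vs. set vs \<subseteq> carrier V \<Longrightarrow> f vs = g vs"
  shows "multilinear_map V f"
  unfolding multilinear_map_def
proof (intro conjI allI impI)
  fix xs v w ys assume s: "set (xs @ v # w # ys) \<subseteq> carrier V"
  have "g (xs @ (v + w) # ys) = g (xs @ v # ys) + g (xs @ w # ys)"
    using assms(2) s unfolding multilinear_map_def by blast
  with s show "f (xs @ (v + w) # ys) = f (xs @ v # ys) + f (xs @ w # ys)"
    by (simp add: assms(3) is_vspace_closed(1)[OF assms(1)])
next
  fix xs a v ys assume s: "set (xs @ v # ys) \<subseteq> carrier V"
  have "g (xs @ vscale V a v # ys) = tscale a (g (xs @ v # ys))"
    using assms(2) s unfolding multilinear_map_def by blast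
  with s show "f (xs @ vscale V a v # ys) = tscale a (f (xs @ v # ys))"
    by (simp add: assms(3) is_vspace_closed(2)[OF assms(1)])
qed

lemma multilinear_map_pure: "vscale V = vscale W \<Longrightarrow> multilinear_map V (pure W)"
  using pure_scale[of W] by (simp add: multilinear_map_def pure_add)

text \<open>Changing one letter of a word affects exactly one of the two pieces cut at
  \<open>k\<close>; the other piece is the same for every choice of the letter. The two cases say
  which piece contains the letter.\<close>

lemma list_split_cases:
  assumes "k \<le> length (xs @ v # ys)"
  obtains us where "xs = take k xs @ us" "\<And>v. take k (xs @ v # ys) = take k xs"
      "\<And>v. drop k (xs @ v # ys) = us @ v # ys" "set us \<subseteq> set xs"
  | us ws where "ys = us @ ws" "\<And>v. take k (xs @ v # ys) = xs @ v # us"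
      "\<And>v. drop k (xs @ v # ys) = ws"
proof (cases "k \<le> length xs")
  case True
  show ?thesis
    by (rule that(1)[of "drop k xs"]) (use True in \<open>auto dest: in_set_dropD\<close>)
next
  case False
  then have "Suc (k - Suc (length xs)) = k - length xs" by simp
  then have "take (k - length xs) (v # ys) = v # take (k - Suc (length xs)) ys"
    "drop (k - length xs) (v # ys) = drop (k - Suc (length xs)) ys" for v
    by (metis take_Suc_Cons, metis drop_Suc_Cons)
  with False show ?thesis
    by (intro that(2)[of "take (k - Suc (length xs)) ys" "drop (k - Suc (length xs)) ys"]) auto
qed

text \<open>A changed letter lies in one of the two factors and the other factor is constant, so the
  claim follows from bilinearity of \<open>tconcat\<close>. Every construction that cuts words
  (\<open>tensor_map\<close>, \<open>leg\<close>, \<open>split_tensor\<close>) rests on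
  this.\<close>

lemma multilinear_map_split:
  assumes g: "multilinear_map V g" "\<And>vs. set vs \<subseteq> carrier V \<Longrightarrow> g vs \<in> tensor_algebra W"
    and h: "multilinear_map V h" "\<And>vs. set vs \<subseteq> carrier V \<Longrightarrow> h vs \<in> tensor_algebra W"
    and V: "is_vspace V"
  shows "multilinear_map V (\<lambda>vs. if k \<le> length vs then tconcat W (g (take k vs)) (h (drop k vs)) else 0)"
proof -
  note sub = is_vspace_closed[OF V]
  have 1: "tconcat W (g (take k (xs @ (v + w) # ys))) (h (drop k (xs @ (v + w) # ys))) =
      tconcat W (g (take k (xs @ v # ys))) (h (drop k (xs @ v # ys))) +
      tconcat W (g (take k (xs @ w # ys))) (h (drop k (xs @ w # ys)))"
    if k: "k \<le> length (xs @ v # ys)" and s: "set (xs @ v # w # ys) \<subseteq> carrier V" for xs v w ys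
  proof (rule list_split_cases[OF k])
    fix us assume *: "xs = take k xs @ us" "\<And>v. take k (xs @ v # ys) = take k xs"
      "\<And>v. drop k (xs @ v # ys) = us @ v # ys" "set us \<subseteq> set xs"
    have t: "set (take k xs) \<subseteq> carrier V" using s set_take_subset[of k xs] by auto
    have us: "set (us @ v # w # ys) \<subseteq> carrier V" using s *(4) by auto
    then have "h (us @ (v + w) # ys) = h (us @ v # ys) + h (us @ w # ys)"
      using h(1) unfolding multilinear_map_def by blast
    then show ?thesis using us t g(2) h(2) sub unfolding *(2,3) by simp
  next
    fix us ws assume *: "ys = us @ ws" "\<And>v. take k (xs @ v # ys) = xs @ v # us"
      "\<And>v. drop k (xs @ v # ys) = ws"
    have "set (xs @ v # w # us) \<subseteq> carrier V" using s *(1) by auto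
    then have "g (xs @ (v + w) # us) = g (xs @ v # us) + g (xs @ w # us)"
      using g(1) unfolding multilinear_map_def by blast
    then show ?thesis unfolding *(2,3) by simp
  qed
  have 2: "tconcat W (g (take k (xs @ (vscale V a v) # ys))) (h (drop k (xs @ (vscale V a v) # ys))) =
      tscale a (tconcat W (g (take k (xs @ v # ys))) (h (drop k (xs @ v # ys))))"
    if k: "k \<le> length (xs @ v # ys)" and s: "set (xs @ v # ys) \<subseteq> carrier V" for xs v a ys
  proof (rule list_split_cases[OF k])
    fix us assume *: "xs = take k xs @ us" "\<And>v. take k (xs @ v # ys) = take k xs"
      "\<And>v. drop k (xs @ v # ys) = us @ v # ys" "set us \<subseteq> set xs"
    have t: "set (take k xs) \<subseteq> carrier V" using s set_take_subset[of k xs] by auto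
    have us: "set (us @ v # ys) \<subseteq> carrier V" using s *(4) by auto
    then have "h (us @ vscale V a v # ys) = tscale a (h (us @ v # ys))"
      using h(1) unfolding multilinear_map_def by blast
    then show ?thesis using us t g(2) h(2) sub unfolding *(2,3) by simp
  next
    fix us ws assume *: "ys = us @ ws" "\<And>v. take k (xs @ v # ys) = xs @ v # us"
      "\<And>v. drop k (xs @ v # ys) = ws"
    have "set (xs @ v # us) \<subseteq> carrier V" using s *(1) by auto
    then have "g (xs @ vscale V a v # us) = tscale a (g (xs @ v # us))"
      using g(1) unfolding multilinear_map_def by blast
    then show ?thesis unfolding *(2,3) by simp
  qed
  show ?thesis
    unfolding multilinear_map_def using 1 2 by auto
qed

lemma multilinear_map_hom:
  assumes "hom V W p q f" "is_vspace V"
  shows "multilinear_map V (\<lambda>vs. if length vs = p then f (pure V vs) else 0)"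
  unfolding multilinear_map_def
  using assms by (auto simp: pure_add pure_scale hom_add hom_scale)

lemma
  assumes V: "is_vspace V" and f: "hom V V p q f" and g: "hom V V r s g"
  shows tensor_map_hom: "hom V V (p + r) (q + s) (f \<otimes>\<^bsub>V,p,r\<^esub> g)"
    and tensor_map_tconcat: "x \<in> tensor_power V p \<Longrightarrow> y \<in> tensor_power V r \<Longrightarrow>
      (f \<otimes>\<^bsub>V,p,r\<^esub> g) (tconcat V x y) = tconcat V (f x) (g y)"
proof -
  let ?f = "\<lambda>vs. if length vs = p then f (pure V vs) else 0"
  let ?g = "\<lambda>vs. if length vs = r then g (pure V vs) else 0"
  have in_ta: "?f vs \<in> tensor_algebra V" "?g vs \<in> tensor_algebra V" if "set vs \<subseteq> carrier V" for vs
    using that hom_in[OF f, of "pure V vs"] hom_in[OF g, of "pure V vs"] by auto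
  \<comment> \<open>The condition on the total length is traded for factors that vanish off their
    own lengths, which is the shape of \<open>multilinear_map_split\<close>.\<close>
  have eq: "(\<lambda>vs. if length vs = p + r then tconcat V (f (pure V (take p vs))) (g (pure V (drop p vs))) else 0) vs
     = (\<lambda>vs. if p \<le> length vs then tconcat V (?f (take p vs)) (?g (drop p vs)) else 0) vs"
    if "set vs \<subseteq> carrier V" for vs
  proof -
    have "set (take p vs) \<subseteq> carrier V" using that set_take_subset[of p vs] by blast
    then have "f (pure V (take p vs)) \<in> tensor_algebra V" if "p \<le> length vs"
      using that by (intro tensor_power_in_algebra[OF hom_in[OF f]] pure_in_tp) auto
    then show ?thesis by auto
  qed
  have ml: "multilinear_map V (\<lambda>vs. if length vs = p + r then tconcat V (f (pure V (take p vs))) (g (pure V (drop p vs))) else 0)"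
    by (rule multilinear_map_cong[OF V multilinear_map_split[OF multilinear_map_hom[OF f V] in_ta(1)
          multilinear_map_hom[OF g V] in_ta(2) V] eq])
  have tp: "tconcat V (f (pure V (take p vs))) (g (pure V (drop p vs))) \<in> tensor_power V (q + s)"
    if "set vs \<subseteq> carrier V" "length vs = p + r" for vs
    using that set_take_subset[of p vs] set_drop_subset[of p vs]
    by (intro tconcat_in_tp hom_in[OF f] hom_in[OF g] pure_in_tp) auto
  show "hom V V (p + r) (q + s) (f \<otimes>\<^bsub>V,p,r\<^esub> g)"
    unfolding tensor_map_def by (rule lin_ext_hom(1)[OF V ml tp])
  then have hom: "hom V V (p + r) (q + s) (f \<otimes>\<^bsub>V,p,r\<^esub> g)" .
  show "(f \<otimes>\<^bsub>V,p,r\<^esub> g) (tconcat V x y) = tconcat V (f x) (g y)"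
    if x: "x \<in> tensor_power V p" and y: "y \<in> tensor_power V r"
    using x
  proof induction
    case (pure xs)
    note fx = tensor_power_in_algebra[OF hom_in[OF f pure_in_tp[OF pure]]]
    from y show ?case
    proof induction
      case (pure ys)
      have "(f \<otimes>\<^bsub>V,p,r\<^esub> g) (pure V (xs @ ys)) = tconcat V (f (pure V xs)) (g (pure V ys))"
        unfolding tensor_map_def
        by (subst lin_ext_hom(2)[OF V ml tp]) (use pure \<open>set xs \<subseteq> carrier V\<close> \<open>length xs = p\<close> in auto)
      then show ?case by simp
    qed (use pure fx in \<open>simp_all add: hom_0[OF hom] hom_0[OF g] hom_add[OF g] hom_scale[OF g] hom_in[OF g, THEN tensor_power_in_algebra]
        hom_add[OF hom] hom_scale[OF hom]\<close>)
  qed (use y in \<open>simp_all add: hom_0[OF hom] hom_0[OF f] hom_add[OF f] hom_scale[OF f] hom_add[OF hom] hom_scale[OF hom]\<close>)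
qed

section \<open>Operators on consecutive tensor factors\<close>

text \<open>The map \<open>id\<^sub>i \<otimes> f \<otimes> id\<close> on all of \<open>T(V)\<close>, where \<open>f\<close> lives on the \<open>p\<close>-th tensor power; it is
  zero on tensors with fewer than \<open>i + p\<close> factors.\<close>

definition leg ::
  "('k::field, 'v::ab_group_add, 'z) vspace_scheme \<Rightarrow> nat \<Rightarrow> nat
     \<Rightarrow> (('k, 'v) tensor \<Rightarrow> ('k, 'v) tensor) \<Rightarrow> ('k, 'v) tensor \<Rightarrow> ('k, 'v) tensor" where
  "leg V i p f = tensor_ext V (\<lambda>vs. if i + p \<le> length vs then
     tconcat V (pure V (take i vs))
       (tconcat V (f (pure V (take p (drop i vs)))) (pure V (drop (i + p) vs))) else 0)"

lemma multilinear_map_leg: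
  assumes V: "is_vspace V" and f: "hom V V p q f"
  shows "multilinear_map V (\<lambda>vs. if i + p \<le> length vs then
     tconcat V (pure V (take i vs))
       (tconcat V (f (pure V (take p (drop i vs)))) (pure V (drop (i + p) vs))) else 0)"
proof -
  \<comment> \<open>The word is cut twice, after \<open>i\<close> letters and then after
    \<open>p\<close> more, so that each cut is an instance of
    \<open>multilinear_map_split\<close>.\<close>
  let ?f = "\<lambda>vs. if length vs = p then f (pure V vs) else 0"
  let ?g = "\<lambda>vs. if p \<le> length vs then tconcat V (?f (take p vs)) (pure V (drop p vs)) else 0"
  let ?h = "\<lambda>vs. if i \<le> length vs then tconcat V (pure V (take i vs)) (?g (drop i vs)) else 0"
  have f_ta: "?f vs \<in> tensor_algebra V" if "set vs \<subseteq> carrier V" for vs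
    using that hom_in[OF f, of "pure V vs"] by auto
  have g_ta: "?g vs \<in> tensor_algebra V" if "set vs \<subseteq> carrier V" for vs
  proof -
    have "set (take p vs) \<subseteq> carrier V" "set (drop p vs) \<subseteq> carrier V"
      using that set_take_subset[of p vs] set_drop_subset[of p vs] by blast+
    from f_ta[OF this(1)] this(2) show ?thesis by (auto simp: min_def split: if_splits)
  qed
  have g: "multilinear_map V ?g"
    by (rule multilinear_map_split[OF multilinear_map_hom[OF f V] f_ta multilinear_map_pure[OF refl] _ V]) auto
  have h: "multilinear_map V ?h"
    by (rule multilinear_map_split[OF multilinear_map_pure[OF refl] _ g g_ta V]) auto
  show ?thesis
  proof (rule multilinear_map_cong[OF V h], goal_cases)
    case (1 vs)
    then have "set (take i vs) \<subseteq> carrier V" using set_take_subset[of i vs] by blast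
    moreover have "p \<le> length vs - i \<longleftrightarrow> i + p \<le> length vs" if "i \<le> length vs" using that by auto
    ultimately show ?case by (auto simp: add.commute)
  qed
qed

context
  fixes V :: "('k::field, 'v::ab_group_add, 'z) vspace_scheme"
    and p q :: nat and f :: "('k, 'v) tensor \<Rightarrow> ('k, 'v) tensor"
  assumes V: "is_vspace V" and f: "hom V V p q f"
begin

lemma leg_add: "leg V i p f (x + y) = leg V i p f x + leg V i p f y"
  and leg_scale: "leg V i p f (tscale a x) = tscale a (leg V i p f x)"
  and leg_0: "leg V i p f 0 = 0"
  unfolding leg_def
  by (rule tensor_ext_add[OF V multilinear_map_leg[OF V f]] tensor_ext_scale[OF V multilinear_map_leg[OF V f]]
      tensor_ext_0[OF V multilinear_map_leg[OF V f]])+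

lemmas leg_linear = leg_add leg_scale leg_0
private lemmas f_linear = hom_add[OF f] hom_scale[OF f] hom_0[OF f] hom_in[OF f]

lemma leg_pure:
  assumes "set (xs @ ys @ zs) \<subseteq> carrier V" "length xs = i" "length ys = p"
  shows "leg V i p f (pure V (xs @ ys @ zs)) = tconcat V (pure V xs) (tconcat V (f (pure V ys)) (pure V zs))"
  unfolding leg_def by (subst tensor_ext_pure[OF V multilinear_map_leg[OF V f] assms(1)]) (use assms in simp)

lemma leg_tconcat:
  assumes "x \<in> tensor_power V i" and y: "y \<in> tensor_power V p" and z: "z \<in> tensor_algebra V"
  shows "leg V i p f (tconcat V x (tconcat V y z)) = tconcat V x (tconcat V (f y) z)"
  using assms(1)
proof induction
  case (pure xs)
  from y show ?case
  proof induction
    case (pure ys)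
    from z show ?case
      by induction (use pure \<open>set xs \<subseteq> carrier V\<close> \<open>length xs = i\<close> leg_pure[of xs]
          in \<open>simp_all add: leg_linear f_linear f_linear(4)[THEN tensor_power_in_algebra]\<close>)
  qed (use pure z in \<open>simp_all add: leg_linear f_linear f_linear(4)[THEN tensor_power_in_algebra]\<close>)
qed (use y z in \<open>simp_all add: leg_linear f_linear f_linear(4)[THEN tensor_power_in_algebra]\<close>)

lemma leg_short:
  assumes "x \<in> tensor_power V n" "n < i + p"
  shows "leg V i p f x = 0"
  using assms(1)
proof induction
  case (pure vs)
  show ?case
    unfolding leg_def by (subst tensor_ext_pure[OF V multilinear_map_leg[OF V f]]) (use pure assms(2) in auto)
qed (simp_all add: leg_linear)

lemma leg_in_tp:
  assumes "x \<in> tensor_power V (i + p + r)"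
  shows "leg V i p f x \<in> tensor_power V (i + q + r)"
proof -
  from assms have "x \<in> tensor_power V (i + (p + r))" by (simp add: add.assoc)
  then show ?thesis
  proof (induction rule: tensor_power_split_induct)
    case (tconcat y z)
    note y = tconcat(1)
    from tconcat(2) show ?case
    proof (induction rule: tensor_power_split_induct)
      case (tconcat z w)
      show ?case
        using y tconcat by (simp add: leg_tconcat f_linear tconcat_in_tp' add.assoc)
    qed (use tconcat in \<open>simp_all add: leg_linear\<close>)
  qed (simp_all add: leg_linear)
qed

lemma leg_in_tp':
  assumes "x \<in> tensor_power V n" "n = i + p + r" "m = i + q + r"
  shows "leg V i p f x \<in> tensor_power V m"
  using leg_in_tp assms by simp

lemma leg_in_ta:
  assumes "x \<in> tensor_algebra V"
  shows "leg V i p f x \<in> tensor_algebra V"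
  using assms
proof induction
  case (pure vs)
  show ?case
  proof (cases "i + p \<le> length vs")
    case True
    then have "pure V vs \<in> tensor_power V (i + p + (length vs - i - p))" using pure by simp
    from leg_in_tp[OF this] show ?thesis by (rule tensor_power_in_algebra)
  qed (use pure leg_short[of "pure V vs" "length vs"] in simp)
qed (simp_all add: leg_linear)

lemma leg_tconcat_right:
  assumes "x \<in> tensor_power V n" "i + p \<le> n" and y: "y \<in> tensor_algebra V"
  shows "leg V i p f (tconcat V x y) = tconcat V (leg V i p f x) y"
proof -
  from assms(1,2) have "x \<in> tensor_power V (i + (p + (n - i - p)))" by simp
  then show ?thesis
  proof (induction rule: tensor_power_split_induct)
    case (tconcat u w)
    note u = tconcat(1)
    from tconcat(2) show ?case
    proof (induction rule: tensor_power_split_induct)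
      case (tconcat v w)
      note [simp] = u[THEN tensor_power_in_algebra] tconcat(1,2)[THEN tensor_power_in_algebra] f_linear(4)[OF tconcat(1), THEN tensor_power_in_algebra]
      show ?case
        using u tconcat y by (simp add: leg_tconcat f_linear tconcat_assoc)
    qed (use tconcat y in \<open>simp_all add: leg_linear\<close>)
  qed (use y in \<open>simp_all add: leg_linear\<close>)
qed

lemma leg_tconcat_left:
  assumes x: "x \<in> tensor_power V i" and "y \<in> tensor_algebra V"
  shows "leg V (i + j) p f (tconcat V x y) = tconcat V x (leg V j p f y)"
  using assms(2)
proof induction
  case (pure vs)
  show ?case
  proof (cases "j + p \<le> length vs")
    case True
    then have "pure V vs \<in> tensor_power V (j + (p + (length vs - j - p)))" using pure by simp
    then show ?thesis
    proof (induction rule: tensor_power_split_induct)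
      case (tconcat u w)
      note u = tconcat(1)
      from tconcat(2) show ?case
      proof (induction rule: tensor_power_split_induct)
        case (tconcat v w)
        note [simp] = u[THEN tensor_power_in_algebra] tconcat(1,2)[THEN tensor_power_in_algebra] f_linear(4)[OF tconcat(1), THEN tensor_power_in_algebra] x[THEN tensor_power_in_algebra]
        have "leg V (i + j) p f (tconcat V (tconcat V x u) (tconcat V v w)) =
            tconcat V (tconcat V x u) (tconcat V (f v) w)"
          by (rule leg_tconcat) (use x u tconcat in auto)
        then show ?case
          using u tconcat x by (simp add: leg_tconcat tconcat_assoc)
      qed (use tconcat x in \<open>simp_all add: leg_linear leg_in_ta\<close>)
    qed (use x in \<open>simp_all add: leg_linear leg_in_ta\<close>)
  next
    \<comment> \<open>The word is too short for the operator, and both sides are 0 by the default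
      value of \<open>leg\<close>.\<close>
    case False
    then show ?thesis
      using pure x leg_short[of "pure V vs" "length vs" j]
        leg_short[of "tconcat V x (pure V vs)" "i + length vs" "i + j"] by simp
  qed
qed (use x in \<open>simp_all add: leg_linear leg_in_ta\<close>)

lemma leg_0_eq:
  assumes "x \<in> tensor_power V p"
  shows "leg V 0 p f x = f x"
proof -
  have "leg V 0 p f (tconcat V (pure V []) (tconcat V x (pure V []))) =
      tconcat V (pure V []) (tconcat V (f x) (pure V []))"
    by (rule leg_tconcat) (use assms in auto)
  then show ?thesis using assms f_linear(4)[OF assms] by simp
qed

text \<open>Legs are defined on the whole tensor algebra and compose without reference to arities.
  This lemma and the next one translate the axioms, which are stated with tensor products of maps,
  into identities between legs.\<close>

lemma tensor_map_id_left:
  assumes "x \<in> tensor_power V (i + p)"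
  shows "(id \<otimes>\<^bsub>V,i,p\<^esub> f) x = leg V i p f x"
proof -
  note h = tensor_map_hom[OF V hom_id[of V i] f]
  from assms show ?thesis
  proof (induction rule: tensor_power_split_induct)
    case (tconcat y z)
    have "leg V i p f (tconcat V y z) = tconcat V y (f z)"
      using leg_tconcat_left[of y i z 0] tconcat leg_0_eq[OF tconcat(2)] by simp
    moreover have t: "(id \<otimes>\<^bsub>V,i,p\<^esub> f) (tconcat V y z) = tconcat V (id y) (f z)"
      by (rule tensor_map_tconcat[OF V hom_id f tconcat])
    ultimately show ?case unfolding t by simp
  qed (simp_all add: leg_linear hom_0[OF h] hom_add[OF h] hom_scale[OF h] del: id_apply)
qed

lemma tensor_map_id_right:
  assumes "x \<in> tensor_power V (p + r)"
  shows "(f \<otimes>\<^bsub>V,p,r\<^esub> id) x = leg V 0 p f x"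
proof -
  note h = tensor_map_hom[OF V f hom_id[of V r]]
  from assms show ?thesis
  proof (induction rule: tensor_power_split_induct)
    case (tconcat y z)
    have "leg V 0 p f (tconcat V y z) = tconcat V (f y) z"
      using leg_tconcat_right[of y p 0 z] tconcat leg_0_eq[OF tconcat(1)] by simp
    moreover have t: "(f \<otimes>\<^bsub>V,p,r\<^esub> id) (tconcat V y z) = tconcat V (f y) (id z)"
      by (rule tensor_map_tconcat[OF V f hom_id tconcat])
    ultimately show ?case unfolding t by simp
  qed (simp_all add: leg_linear hom_0[OF h] hom_add[OF h] hom_scale[OF h] del: id_apply)
qed

end

text \<open>Apply \<open>f\<close> first; it turns \<open>p\<close> factors into \<open>q\<close>,
  so the factors for \<open>g\<close> then begin at position \<open>q\<close>.\<close>

lemma tensor_map_legs: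
  assumes V: "is_vspace V" and f: "hom V V p q f" and g: "hom V V r s g"
    and "x \<in> tensor_power V (p + r)"
  shows "(f \<otimes>\<^bsub>V,p,r\<^esub> g) x = leg V q r g (leg V 0 p f x)"
proof -
  note h = tensor_map_hom[OF V f g]
  from assms(4) show ?thesis
  proof (induction rule: tensor_power_split_induct)
    case (tconcat y z)
    have "leg V 0 p f (tconcat V y z) = tconcat V (f y) z"
      using leg_tconcat_right[OF V f, of y p 0 z] tconcat leg_0_eq[OF V f tconcat(1)] by simp
    moreover have "leg V q r g (tconcat V (f y) z) = tconcat V (f y) (g z)"
      using leg_tconcat_left[OF V g, of "f y" q z 0] tconcat hom_in[OF f tconcat(1)] leg_0_eq[OF V g tconcat(2)] by simp
    ultimately show ?case using tconcat by (simp add: tensor_map_tconcat[OF V f g])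
  qed (simp_all add: leg_linear[OF V f] leg_linear[OF V g] hom_0[OF h] hom_add[OF h] hom_scale[OF h])
qed

text \<open>The interchange law for operators on disjoint factors. The position of the right
  operator shifts from \<open>i + p + j\<close> to \<open>i + q + j\<close> because \<open>f\<close>
  may change the number of factors to its left.\<close>

lemma leg_commute:
  assumes V: "is_vspace V" and f: "hom V V p q f" and g: "hom V V r s g"
    and x: "x \<in> tensor_power V n" "i + p + j + r \<le> n"
  shows "leg V (i + q + j) r g (leg V i p f x) = leg V i p f (leg V (i + p + j) r g x)"
proof -
  note lin = leg_linear[OF V f] leg_linear[OF V g]
  have "x \<in> tensor_power V ((i + p) + (n - i - p))" using x by simp
  then show ?thesis
  proof (induction rule: tensor_power_split_induct)
    case (tconcat y z)
    have z: "z \<in> tensor_algebra V" using tconcat(2) by simp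
    have y': "leg V i p f y \<in> tensor_power V (i + q)"
      using leg_in_tp[OF V f, of y i 0] tconcat(1) by simp
    have "leg V i p f (tconcat V y z) = tconcat V (leg V i p f y) z"
      by (rule leg_tconcat_right[OF V f tconcat(1) _ z]) simp
    moreover have "leg V (i + p + j) r g (tconcat V y z) = tconcat V y (leg V j r g z)"
      by (rule leg_tconcat_left[OF V g tconcat(1) z])
    moreover have "leg V (i + q + j) r g (tconcat V (leg V i p f y) z) = tconcat V (leg V i p f y) (leg V j r g z)"
      by (rule leg_tconcat_left[OF V g y' z])
    moreover have "leg V i p f (tconcat V y (leg V j r g z)) = tconcat V (leg V i p f y) (leg V j r g z)"
      by (rule leg_tconcat_right[OF V f tconcat(1) _ leg_in_ta[OF V g z]]) simp
    ultimately show ?case by simp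
  qed (simp_all add: lin)
qed

section \<open>Block permutations in braid families\<close>

text \<open>With \<open>s i\<close> crossing the strands \<open>i\<close> and \<open>i + 1\<close>, \<open>row s p n\<close> moves strand \<open>p\<close> past the next
  \<open>n\<close> strands, and \<open>block s p m n\<close> moves the \<open>m\<close> strands starting at \<open>p\<close> past the next \<open>n\<close>.\<close>

fun row :: "(nat \<Rightarrow> 'a \<Rightarrow> 'a) \<Rightarrow> nat \<Rightarrow> nat \<Rightarrow> 'a \<Rightarrow> 'a" where
  "row s p 0 x = x"
| "row s p (Suc n) x = s (p + n) (row s p n x)"

fun block :: "(nat \<Rightarrow> 'a \<Rightarrow> 'a) \<Rightarrow> nat \<Rightarrow> nat \<Rightarrow> nat \<Rightarrow> 'a \<Rightarrow> 'a" where
  "block s p 0 n x = x"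
| "block s p (Suc m) n x = row s p n (block s (Suc p) m n x)"

text \<open>These are the relations of the positive braid monoid. The braiding is not assumed
  bijective, so no inverse crossing may occur in an argument.\<close>

locale braid_family =
  fixes s :: "nat \<Rightarrow> 'a \<Rightarrow> 'a"
  assumes far: "Suc i < j \<Longrightarrow> s j (s i x) = s i (s j x)"
    and braid: "s i (s (Suc i) (s i x)) = s (Suc i) (s i (s (Suc i) x))"
begin

lemma row_far_below: "Suc k < p \<Longrightarrow> s k (row s p n x) = row s p n (s k x)"
proof (induction n)
  case (Suc n)
  then show ?case using far[of k "p + n" "row s p n x"] by simp
qed simp

lemma row_add: "row s p (m + n) x = row s (p + m) n (row s p m x)"
  by (induction n) (auto simp: add.assoc)

lemma block_far_below: "Suc k < p \<Longrightarrow> s k (block s p m n x) = block s p m n (s k x)"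
  by (induction m arbitrary: p x) (auto simp: row_far_below)

lemma row_block_commute: "p + m < q \<Longrightarrow> row s p m (block s q l n x) = block s q l n (row s p m x)"
  by (induction m) (auto simp: block_far_below)

lemma block_0_right: "block s p m 0 x = x"
  by (induction m arbitrary: p) auto

lemma block_add_left: "block s p (l + m) n x = block s p l n (block s (p + l) m n x)"
  by (induction l arbitrary: p) auto

text \<open>While one strand passes the first \<open>m\<close> strands, the others may already pass
  the last \<open>n\<close>: the crossings involved are at distance at least two and commute
  (\<open>row_block_commute\<close>).\<close>

lemma block_add_right: "block s p l (m + n) x = block s (p + m) l n (block s p l m x)"
proof (induction l arbitrary: p)
  case (Suc l)
  show ?case
    by (simp add: Suc.IH row_add row_block_commute)
qed auto

text \<open>A crossing inside the block slides through the passing strand and comes out one place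
  higher. The braid relation is used once, for a crossing of the two leading strands of the block;
  other crossings are reached by induction and far commutation.\<close>

lemma block_1_shift_left: "Suc j < m \<Longrightarrow> block s p m 1 (s (p + j) x) = s (Suc (p + j)) (block s p m 1 x)"
proof (induction m arbitrary: p j)
  case (Suc m)
  show ?case
  proof (cases j)
    case 0
    with Suc.prems obtain m' where m: "m = Suc m'" by (cases m) auto
    show ?thesis
      using block_far_below[of p "Suc (Suc p)" m' 1 x, symmetric] braid[of p] by (simp add: 0 m)
  next
    case (Suc j')
    then show ?thesis
      using Suc.IH[of j' "Suc p"] Suc.prems far[of p "Suc (p + j)" "block s (Suc p) m 1 x"] by simp
  qed
qed auto

text \<open>Passing \<open>n\<close> strands means passing a single strand \<open>n\<close> times,
  and each passage raises the position of the crossing by one.\<close>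

lemma block_shift_left: "Suc j < m \<Longrightarrow> block s p m n (s (p + j) x) = s (p + n + j) (block s p m n x)"
proof (induction n)
  case 0
  then show ?case by (simp add: block_0_right)
next
  case (Suc n)
  have "block s p m (Suc n) x = block s (p + n) m 1 (block s p m n x)" for x
    using block_add_right[of p m n 1 x] by simp
  then show ?case
    using Suc block_1_shift_left[of j m "p + n"] by simp
qed

lemma block_row_left: "q + b < m \<Longrightarrow> block s p m n (row s (p + q) b x) = row s (p + n + q) b (block s p m n x)"
proof (induction b)
  case (Suc b)
  then show ?case using block_shift_left[of "q + b" m p n] by (simp add: add.assoc)
qed simp

lemma block_block_left:
  "q + a + b \<le> m \<Longrightarrow> block s p m n (block s (p + q) a b x) = block s (p + n + q) a b (block s p m n x)"
proof (induction a arbitrary: q)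
  case (Suc a)
  then show ?case using block_row_left[of q b m p n] Suc.IH[of "Suc q"] by simp
qed simp

text \<open>This is naturality of moving a whole block past \<open>n\<close> strands, applied to the
  exchange of its two parts: the left side exchanges the parts before the move, the right side after
  it.\<close>

lemma block_yang_baxter:
  "block s p m n (block s (p + m) l n (block s p l m x)) =
   block s (p + n) l m (block s p l n (block s (p + l) m n x))"
proof -
  have "block s p m n (block s (p + m) l n (block s p l m x)) = block s p (m + l) n (block s p l m x)"
    by (simp add: block_add_left)
  also have "\<dots> = block s (p + n) l m (block s p (m + l) n x)"
    using block_block_left[of 0 l m "m + l" p n] by simp
  also have "block s p (m + l) n x = block s p l n (block s (p + l) m n x)"
    by (subst add.commute) (rule block_add_left)
  finally show ?thesis .
qed

end

section \<open>The braiding of the tensor algebra\<close>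

lemma braided_vector_space_hom:
  assumes "braided_vector_space V"
  shows "is_vspace V" "hom V V 2 2 (braiding V)"
  using assms by (auto simp: braided_vector_space_def hom_def Let_def)

text \<open>In terms of legs the Yang-Baxter equation can be padded by further factors on both
  sides.\<close>

lemma braided_vector_space_braid:
  assumes V: "braided_vector_space V" and x: "x \<in> tensor_power V 3"
  shows "leg V 0 2 (braiding V) (leg V 1 2 (braiding V) (leg V 0 2 (braiding V) x)) =
    leg V 1 2 (braiding V) (leg V 0 2 (braiding V) (leg V 1 2 (braiding V) x))"
proof -
  let ?c = "braiding V"
  note h = braided_vector_space_hom[OF V]
  have l: "leg V 0 2 ?c y \<in> tensor_power V 3" "leg V 1 2 ?c y \<in> tensor_power V 3"
    if "y \<in> tensor_power V 3" for y
    by (rule leg_in_tp'[OF h that, of 0 1] leg_in_tp'[OF h that, of 1 0]; simp)+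
  have e: "(?c \<otimes>\<^bsub>V,2,1\<^esub> id) y = leg V 0 2 ?c y" "(id \<otimes>\<^bsub>V,1,2\<^esub> ?c) y = leg V 1 2 ?c y"
    if "y \<in> tensor_power V 3" for y
    using that tensor_map_id_right[OF h, of y 1] tensor_map_id_left[OF h, of y 1]
    by (simp_all add: numeral_3_eq_3)
  have "((?c \<otimes>\<^bsub>V,2,1\<^esub> id) \<circ> (id \<otimes>\<^bsub>V,1,2\<^esub> ?c) \<circ> (?c \<otimes>\<^bsub>V,2,1\<^esub> id)) x =
      ((id \<otimes>\<^bsub>V,1,2\<^esub> ?c) \<circ> (?c \<otimes>\<^bsub>V,2,1\<^esub> id) \<circ> (id \<otimes>\<^bsub>V,1,2\<^esub> ?c)) x"
    using V x unfolding braided_vector_space_def Let_def eq_on_def by blast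
  then show ?thesis using x unfolding o_apply by (simp only: e l)
qed

text \<open>Off \<open>T(V)\<close> the value is set to 0, so that the braid relations hold as equations between
  total functions.\<close>

definition strand ::
  "('k::field, 'v::ab_group_add, 'z) braided_space_scheme \<Rightarrow> nat \<Rightarrow> ('k, 'v) tensor \<Rightarrow> ('k, 'v) tensor" where
  "strand V i x = (if x \<in> tensor_algebra V then leg V i 2 (braiding V) x else 0)"

context
  fixes V :: "('k::field, 'v::ab_group_add, 'z) braided_space_scheme"
  assumes V: "braided_vector_space V"
begin

private lemmas vs = braided_vector_space_hom(1)[OF V]
private lemmas homc = braided_vector_space_hom[OF V]

lemma strand_0: "strand V i 0 = 0"
  by (simp add: strand_def leg_linear[OF homc])

lemma strand_add: "x \<in> tensor_algebra V \<Longrightarrow> y \<in> tensor_algebra V \<Longrightarrow> strand V i (x + y) = strand V i x + strand V i y"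
  and strand_scale: "x \<in> tensor_algebra V \<Longrightarrow> strand V i (tscale a x) = tscale a (strand V i x)"
  by (simp_all add: strand_def leg_linear[OF homc])

lemma strand_in_ta: "strand V i x \<in> tensor_algebra V"
  by (simp add: strand_def leg_in_ta[OF homc])

lemma strand_short: "x \<in> tensor_power V n \<Longrightarrow> n < i + 2 \<Longrightarrow> strand V i x = 0"
  by (simp add: strand_def leg_short[OF homc])

lemma strand_in_tp:
  assumes "x \<in> tensor_power V n"
  shows "strand V i x \<in> tensor_power V n"
proof (cases "n < i + 2")
  case False
  then have n: "n = i + 2 + (n - i - 2)" by simp
  have "leg V i 2 (braiding V) x \<in> tensor_power V n" by (rule leg_in_tp'[OF homc assms n n])
  then show ?thesis using assms by (simp add: strand_def)
qed (simp add: strand_short[OF assms])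

lemma strand_tconcat_right:
  assumes "x \<in> tensor_power V n" "i + 2 \<le> n" "y \<in> tensor_algebra V"
  shows "strand V i (tconcat V x y) = tconcat V (strand V i x) y"
  using assms leg_tconcat_right[OF homc assms(1,2,3)] by (simp add: strand_def)

lemma strand_tconcat_left:
  assumes "x \<in> tensor_power V i" "y \<in> tensor_algebra V"
  shows "strand V (i + j) (tconcat V x y) = tconcat V x (strand V j y)"
  using assms leg_tconcat_left[OF homc assms] by (simp add: strand_def)

text \<open>Far commutation is the interchange law \<open>leg_commute\<close>; the braid relation is
  the Yang-Baxter equation on three consecutive factors. Words too short for a crossing give 0 on
  both sides.\<close>

lemma strand_braid_family: "braid_family (strand V)"
proof
  fix i j :: nat and x :: "('k, 'v) tensor"
  assume ij: "Suc i < j"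
  show "strand V j (strand V i x) = strand V i (strand V j x)"
  proof (cases "x \<in> tensor_algebra V")
    case True
    then show ?thesis
    proof induction
      case (pure vs)
      then have p: "pure V vs \<in> tensor_power V (length vs)" by simp
      show ?case
      proof (cases "j + 2 \<le> length vs")
        case True
        moreover obtain k where "j = i + 2 + k" using ij by (auto dest: less_imp_Suc_add)
        ultimately show ?thesis
          using leg_commute[OF homc homc(2) p, of i k] pure
          by (simp add: strand_def leg_in_ta[OF homc])
      next
        case False
        then show ?thesis
          using strand_short[OF p] strand_short[OF strand_in_tp[OF p]] by (simp add: strand_0)
      qed
    qed (simp_all add: strand_0 strand_add strand_scale strand_in_ta)
  qed (simp add: strand_def leg_linear[OF homc])
next
  fix i :: nat and x :: "('k, 'v) tensor"
  show "strand V i (strand V (Suc i) (strand V i x)) = strand V (Suc i) (strand V i (strand V (Suc i) x))"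
  proof (cases "x \<in> tensor_algebra V")
    case True
    then show ?thesis
    proof induction
      case (pure vs)
      then have p: "pure V vs \<in> tensor_power V (length vs)" by simp
      show ?case
      proof (cases "i + 3 \<le> length vs")
        case True
        \<comment> \<open>Isolate the three factors on which both sides act; the factors before and
          after them are carried along unchanged.\<close>
        with p have "pure V vs \<in> tensor_power V (i + (3 + (length vs - i - 3)))" by simp
        then show ?thesis
        proof (induction rule: tensor_power_split_induct)
          case (tconcat x y)
          note x = tconcat(1)
          from tconcat(2) show ?case
          proof (induction rule: tensor_power_split_induct)
            case (tconcat y z)
            note y = tconcat(1) and z = tensor_power_in_algebra[OF tconcat(2)]
            have r: "strand V j (tconcat V w z) = tconcat V (strand V j w) z"
              if "w \<in> tensor_power V 3" "j + 2 \<le> 3" for j w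
              by (rule strand_tconcat_right[OF that z])
            have l0: "strand V i (tconcat V x w) = tconcat V x (strand V 0 w)"
              and l1: "strand V (Suc i) (tconcat V x w) = tconcat V x (strand V 1 w)"
              if "w \<in> tensor_algebra V" for w
              using strand_tconcat_left[OF x that, of 0] strand_tconcat_left[OF x that, of 1] by simp_all
            have b: "strand V 0 (strand V 1 (strand V 0 y)) = strand V 1 (strand V 0 (strand V 1 y))"
              using braided_vector_space_braid[OF V y] y by (simp add: strand_def leg_in_ta[OF homc])
            show ?case
              using y z b by (simp add: l0 l1 r strand_in_ta strand_in_tp)
          qed (use x in \<open>simp_all add: strand_0 strand_add strand_scale strand_in_ta\<close>)
        qed (simp_all add: strand_0 strand_add strand_scale strand_in_ta)
      next
        case False
        then show ?thesis
          using strand_short[OF p, of "Suc i"] strand_short[OF strand_in_tp[OF strand_in_tp[OF p]], of "Suc i"]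
            strand_short[OF strand_in_tp[OF p], of "Suc i"]
          by (simp add: strand_0)
      qed
    qed (simp_all add: strand_0 strand_add strand_scale strand_in_ta)
  qed (simp add: strand_def leg_linear[OF homc])
qed

interpretation braid_family "strand V" by (rule strand_braid_family)

lemma row_0: "row (strand V) p n 0 = 0"
  by (induction n) (simp_all add: strand_0)

lemma row_in_ta: "x \<in> tensor_algebra V \<Longrightarrow> row (strand V) p n x \<in> tensor_algebra V"
  by (induction n) (simp_all add: strand_in_ta)

lemma row_in_tp: "x \<in> tensor_power V k \<Longrightarrow> row (strand V) p n x \<in> tensor_power V k"
  by (induction n) (simp_all add: strand_in_tp)

lemma row_plus: "x \<in> tensor_algebra V \<Longrightarrow> y \<in> tensor_algebra V \<Longrightarrow>
    row (strand V) p n (x + y) = row (strand V) p n x + row (strand V) p n y"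
  and row_scale: "x \<in> tensor_algebra V \<Longrightarrow> row (strand V) p n (tscale a x) = tscale a (row (strand V) p n x)"
  by (induction n) (simp_all add: strand_add strand_scale row_in_ta)

lemma row_tconcat_right:
  assumes "x \<in> tensor_power V k" "p + n < k" "y \<in> tensor_algebra V"
  shows "row (strand V) p n (tconcat V x y) = tconcat V (row (strand V) p n x) y"
  using assms(2) by (induction n) (use assms in \<open>simp_all add: strand_tconcat_right[OF row_in_tp]\<close>)

lemma row_tconcat_left:
  assumes "x \<in> tensor_power V k" "y \<in> tensor_algebra V"
  shows "row (strand V) (k + p) n (tconcat V x y) = tconcat V x (row (strand V) p n y)"
  by (induction n) (simp_all add: strand_tconcat_left[OF assms(1) row_in_ta[OF assms(2)]] add.assoc)

lemma block_0: "block (strand V) p m n 0 = 0"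
  by (induction m arbitrary: p) (simp_all add: row_0)

lemma block_in_ta: "x \<in> tensor_algebra V \<Longrightarrow> block (strand V) p m n x \<in> tensor_algebra V"
  by (induction m arbitrary: p) (simp_all add: row_in_ta)

lemma block_in_tp: "x \<in> tensor_power V k \<Longrightarrow> block (strand V) p m n x \<in> tensor_power V k"
  by (induction m arbitrary: p) (simp_all add: row_in_tp)

lemma block_plus: "x \<in> tensor_algebra V \<Longrightarrow> y \<in> tensor_algebra V \<Longrightarrow>
    block (strand V) p m n (x + y) = block (strand V) p m n x + block (strand V) p m n y"
  and block_scale: "x \<in> tensor_algebra V \<Longrightarrow> block (strand V) p m n (tscale a x) = tscale a (block (strand V) p m n x)"
  by (induction m arbitrary: p) (simp_all add: row_plus row_scale block_in_ta)

lemma block_tconcat_right: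
  assumes "x \<in> tensor_power V k" "p + m + n \<le> k" "y \<in> tensor_algebra V"
  shows "block (strand V) p m n (tconcat V x y) = tconcat V (block (strand V) p m n x) y"
  using assms(2)
  by (induction m arbitrary: p) (use assms in \<open>simp_all add: row_tconcat_right[OF block_in_tp]\<close>)

lemma block_tconcat_left:
  assumes "x \<in> tensor_power V k" "y \<in> tensor_algebra V"
  shows "block (strand V) (k + p) m n (tconcat V x y) = tconcat V x (block (strand V) p m n y)"
  by (induction m arbitrary: p)
    (simp_all add: row_tconcat_left[OF assms(1) block_in_ta[OF assms(2)]] flip: add_Suc_right)

end

section \<open>Reduction of tensor powers of T(V) to tensors over V\<close>

definition tensor_space ::
  "('k::field, 'v::ab_group_add, 'z) vspace_scheme \<Rightarrow> ('k, ('k, 'v) tensor) vspace" where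
  "tensor_space V = \<lparr>carrier = tensor_algebra V, vscale = tscale\<rparr>"

lemma tensor_space_simps [simp]:
  "carrier (tensor_space V) = tensor_algebra V" "vscale (tensor_space V) = tscale"
  by (simp_all add: tensor_space_def)

lemma is_vspace_tensor_space: "is_vspace (tensor_space V)"
  by (simp add: is_vspace_def vector_space_tscale subspace_tensor_algebra)

fun blocks :: "('k::field, 'v::ab_group_add, 'z) vspace_scheme \<Rightarrow> nat list \<Rightarrow> 'v list \<Rightarrow> ('k, 'v) tensor list" where
  "blocks V [] zs = []"
| "blocks V (n # ns) zs = pure V (take n zs) # blocks V ns (drop n zs)"

lemma length_blocks [simp]: "length (blocks V ns zs) = length ns"
  by (induction ns arbitrary: zs) auto

lemma blocks_concat: "blocks V (map length zss) (concat zss) = map (pure V) zss"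
  by (induction zss) auto

lemma blocks_append: "length xs = sum_list ms \<Longrightarrow> blocks V (ms @ ns) (xs @ ys) = blocks V ms xs @ blocks V ns ys"
  by (induction ms arbitrary: xs) auto

lemma set_blocks: "set zs \<subseteq> carrier V \<Longrightarrow> set (blocks V ns zs) \<subseteq> tensor_algebra V"
proof (induction ns arbitrary: zs)
  case (Cons n ns)
  have "set (take n zs) \<subseteq> carrier V" "set (drop n zs) \<subseteq> carrier V"
    using Cons.prems set_take_subset[of n zs] set_drop_subset[of n zs] by blast+
  then show ?case using Cons.IH by simp
qed simp

text \<open>Splits a tensor on \<open>V\<close> with \<open>sum_list ns\<close> factors into a tensor on \<open>T(V)\<close> with one factor
  for each entry of \<open>ns\<close>. The images of these maps span the tensor powers of \<open>T(V)\<close>, and on them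
  all structure maps of \<open>T(V)\<close> become operators on the tensor powers of \<open>V\<close>.\<close>

definition split_tensor ::
  "('k::field, 'v::ab_group_add, 'z) vspace_scheme \<Rightarrow> nat list \<Rightarrow> ('k, 'v) tensor \<Rightarrow> ('k, ('k, 'v) tensor) tensor" where
  "split_tensor V ns = tensor_ext V (\<lambda>zs. if length zs = sum_list ns then pure (tensor_space V) (blocks V ns zs) else 0)"

lemma multilinear_map_split_tensor:
  assumes V: "is_vspace V"
  shows "multilinear_map V (\<lambda>zs. if length zs = sum_list ns then pure (tensor_space V) (blocks V ns zs) else 0)"
proof (induction ns)
  case Nil
  show ?case by (simp add: multilinear_map_def)
next
  case (Cons n ns)
  let ?T = "tensor_space V"
  let ?h = "\<lambda>zs. if length zs = sum_list ns then pure ?T (blocks V ns zs) else 0"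
  let ?g = "\<lambda>zs. if length zs = n then pure ?T [pure V zs] else 0"
  have h: "?h zs \<in> tensor_algebra ?T" if "set zs \<subseteq> carrier V" for zs
    using set_blocks[OF that] by simp
  have g: "?g zs \<in> tensor_algebra ?T" if "set zs \<subseteq> carrier V" for zs
    using that by simp
  have mg: "multilinear_map V ?g"
    unfolding multilinear_map_def
    using pure_add[of ?T "[]" _ _ "[]"] pure_scale[of ?T "[]" _ _ "[]"]
    by (auto simp: pure_add pure_scale)
  show ?case
  proof (rule multilinear_map_cong[OF V multilinear_map_split[OF mg g Cons.IH h V, of n]], goal_cases)
    case (3 vs)
    then have "set (take n vs) \<subseteq> carrier V" using set_take_subset[of n vs] by blast
    with 3 show ?case by auto
  qed
qed

context
  fixes V :: "('k::field, 'v::ab_group_add, 'z) vspace_scheme"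
  assumes V: "is_vspace V"
begin

private abbreviation (input) "TS \<equiv> tensor_space V"

lemma split_tensor_add: "split_tensor V ns (x + y) = split_tensor V ns x + split_tensor V ns y"
  and split_tensor_scale: "split_tensor V ns (tscale a x) = tscale a (split_tensor V ns x)"
  and split_tensor_0: "split_tensor V ns 0 = 0"
  unfolding split_tensor_def
  by (rule tensor_ext_add[OF V multilinear_map_split_tensor[OF V]] tensor_ext_scale[OF V multilinear_map_split_tensor[OF V]]
      tensor_ext_0[OF V multilinear_map_split_tensor[OF V]])+

lemmas split_tensor_linear = split_tensor_add split_tensor_scale split_tensor_0

lemma split_tensor_pure:
  "set zs \<subseteq> carrier V \<Longrightarrow> length zs = sum_list ns \<Longrightarrow> split_tensor V ns (pure V zs) = pure TS (blocks V ns zs)"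
  unfolding split_tensor_def by (subst tensor_ext_pure[OF V multilinear_map_split_tensor[OF V]]) auto

lemma split_tensor_in_tp: "x \<in> tensor_power V (sum_list ns) \<Longrightarrow> split_tensor V ns x \<in> tensor_power TS (length ns)"
  by (induction rule: tensor_power_induct) (simp_all add: split_tensor_linear split_tensor_pure set_blocks)

lemma split_tensor_tconcat:
  assumes "x \<in> tensor_power V (sum_list ms)" "y \<in> tensor_power V (sum_list ns)"
  shows "split_tensor V (ms @ ns) (tconcat V x y) = tconcat TS (split_tensor V ms x) (split_tensor V ns y)"
  using assms(1)
proof induction
  case (pure xs)
  note xs = pure
  from assms(2) show ?case
  proof induction
    case (pure ys)
    then show ?case using xs by (simp add: split_tensor_pure blocks_append)
  qed (use xs in \<open>simp_all add: split_tensor_linear split_tensor_in_tp[THEN tensor_power_in_algebra] split_tensor_pure set_blocks\<close>)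
qed (use assms(2) in \<open>simp_all add: split_tensor_linear\<close>)

text \<open>By multilinearity the entries of a pure tensor over T(V) may be replaced by words one
  after the other. A tensor all of whose entries are words is an image of
  \<open>split_tensor\<close>.\<close>

lemma hom_eq_split:
  assumes F: "hom TS W k q F" and G: "hom TS W k q G"
    and eq: "\<And>ns w. length ns = k \<Longrightarrow> w \<in> tensor_power V (sum_list ns) \<Longrightarrow>
      F (split_tensor V ns w) = G (split_tensor V ns w)"
  shows "eq_on (tensor_power TS k) F G"
proof (rule hom_eqI[OF F G])
  \<comment> \<open>The entries in \<open>zss\<close> are already words and those in
    \<open>xs\<close> are still arbitrary; the induction removes the last entry of \<open>xs\<close>
    and, if it is a word, puts it in front of \<open>zss\<close>.\<close>
  have main: "F (pure TS (xs @ map (pure V) zss)) = G (pure TS (xs @ map (pure V) zss))"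
    if "set xs \<subseteq> tensor_algebra V" "set (concat zss) \<subseteq> carrier V" "length xs + length zss = k" for xs zss
    using that
  proof (induction xs arbitrary: zss rule: rev_induct)
    case Nil
    have len: "sum_list (map length zss) = length (concat zss)" by (simp add: length_concat)
    \<comment> \<open>Now all entries are words, and cutting their concatenation at their lengths
      recovers them.\<close>
    have "pure TS (map (pure V) zss) = split_tensor V (map length zss) (pure V (concat zss))"
      using Nil len by (subst split_tensor_pure) (simp_all only: blocks_concat)
    then show ?case using Nil len eq[of "map length zss" "pure V (concat zss)"] by simp
  next
    case (snoc x xs)
    from snoc.prems have "x \<in> tensor_algebra V" by simp
    then show ?case
    proof induction
      case zero
      have "pure TS (xs @ [0] @ map (pure V) zss) = pure TS (xs @ (tscale 0 0) # map (pure V) zss)" by simp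
      also have "\<dots> = 0" using pure_scale[of TS xs 0 0 "map (pure V) zss"] by simp
      finally show ?case by (simp add: hom_0[OF F] hom_0[OF G])
    next
      case (pure vs)
      then show ?case using snoc.IH[of "vs # zss"] snoc.prems by simp
    next
      case (add x y)
      have m: "pure TS (xs @ z # map (pure V) zss) \<in> tensor_power TS k" if "z \<in> tensor_algebra V" for z
        using snoc.prems that by (intro pure_in_tp) (auto intro!: pure_in_ta)
      from add show ?case
        by (simp add: pure_add hom_add[OF F] hom_add[OF G] m)
    next
      case (scale a x)
      have m: "pure TS (xs @ z # map (pure V) zss) \<in> tensor_power TS k" if "z \<in> tensor_algebra V" for z
        using snoc.prems that by (intro pure_in_tp) (auto intro!: pure_in_ta)
      from scale show ?case
        using pure_scale[of TS xs a x "map (pure V) zss"]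
        by (simp add: hom_scale[OF F] hom_scale[OF G] m)
    qed
  qed
  fix xs assume "set xs \<subseteq> carrier TS" "length xs = k"
  then show "F (pure TS xs) = G (pure TS xs)" using main[of xs "[]"] by simp
qed

end

lemma multilinear_map_unary:
  assumes "\<And>x y. x \<in> carrier V \<Longrightarrow> y \<in> carrier V \<Longrightarrow> g (x + y) = g x + g y"
    and "\<And>a x. x \<in> carrier V \<Longrightarrow> g (vscale V a x) = tscale a (g x)"
  shows "multilinear_map V (\<lambda>vs. if length vs = 1 then g (vs ! 0) else 0)"
  unfolding multilinear_map_def using assms by auto

lemma multilinear_map_binary:
  assumes add: "\<And>x y z. x \<in> carrier V \<Longrightarrow> y \<in> carrier V \<Longrightarrow> z \<in> carrier V \<Longrightarrow> g (x + y) z = g x z + g y z"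
      "\<And>x y z. x \<in> carrier V \<Longrightarrow> y \<in> carrier V \<Longrightarrow> z \<in> carrier V \<Longrightarrow> g z (x + y) = g z x + g z y"
    and scale: "\<And>a x z. x \<in> carrier V \<Longrightarrow> z \<in> carrier V \<Longrightarrow> g (vscale V a x) z = tscale a (g x z)"
      "\<And>a x z. x \<in> carrier V \<Longrightarrow> z \<in> carrier V \<Longrightarrow> g z (vscale V a x) = tscale a (g z x)"
  shows "multilinear_map V (\<lambda>vs. if length vs = 2 then g (vs ! 0) (vs ! 1) else 0)"
proof -
  have c: "(xs = [] \<and> (\<exists>y. ys = [y])) \<or> ((\<exists>y. xs = [y]) \<and> ys = [])" if "length (xs @ v # ys) = 2"
    for xs ys :: "'a list" and v
    using that by (cases xs; cases ys) auto
  show ?thesis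
    unfolding multilinear_map_def
  proof (intro conjI allI impI, goal_cases)
    case (1 xs v w ys)
    then show ?case using c[of xs v ys] add by auto
  next
    case (2 xs a v ys)
    then show ?case using c[of xs v ys] scale by auto
  qed
qed

section \<open>Construction of the braiding on the tensor square of T(V)\<close>

context
  fixes V :: "('k::field, 'v::ab_group_add, 'z) braided_space_scheme"
  assumes V: "braided_vector_space V"
begin

private lemmas is_vs = braided_vector_space_hom(1)[OF V]

interpretation braid_family "strand V" by (rule strand_braid_family[OF V])

private abbreviation (input) "TV \<equiv> tensor_space V"

text \<open>The first cut is after \<open>length ys\<close> factors, because the strands of
  \<open>ys\<close> come first once the block of \<open>xs\<close> has passed them.\<close>

definition block_swap :: "'v list \<Rightarrow> 'v list \<Rightarrow> ('k, ('k, 'v) tensor) tensor" where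
  "block_swap xs ys = split_tensor V [length ys, length xs]
     (block (strand V) 0 (length xs) (length ys) (pure V (xs @ ys)))"

text \<open>Two words cannot be recovered from their concatenation alone, so the map is extended in
  each argument separately. Linearity in \<open>y\<close> comes from the outer extension; linearity
  in \<open>x\<close> needs an induction on \<open>y\<close>.\<close>

definition swap_ext :: "('k, 'v) tensor \<Rightarrow> ('k, 'v) tensor \<Rightarrow> ('k, ('k, 'v) tensor) tensor" where
  "swap_ext x y = tensor_ext V (\<lambda>ys. tensor_ext V (\<lambda>xs. block_swap xs ys) x) y"

lemma block_swap_left: "set ys \<subseteq> carrier V \<Longrightarrow> multilinear_map V (\<lambda>xs. block_swap xs ys)"
  unfolding multilinear_map_def block_swap_def
  by (auto simp: pure_add pure_scale block_plus[OF V] block_scale[OF V] split_tensor_linear[OF is_vs] simp del: block.simps)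

lemma block_swap_right: "set xs \<subseteq> carrier V \<Longrightarrow> multilinear_map V (block_swap xs)"
  unfolding multilinear_map_def block_swap_def append_assoc[symmetric]
  by (auto simp: pure_add[of _ "xs @ _"] pure_scale[of _ "xs @ _"] simp del: append_assoc)
    (auto simp: block_plus[OF V] block_scale[OF V] split_tensor_linear[OF is_vs])

lemma swap_ext_left:
  assumes "x \<in> tensor_algebra V"
  shows "multilinear_map V (\<lambda>ys. tensor_ext V (\<lambda>xs. block_swap xs ys) x)"
  unfolding multilinear_map_def
proof (intro conjI allI impI)
  fix xs v w ys assume s: "set (xs @ v # w # ys) \<subseteq> carrier V"
  then have "set (xs @ v # ys) \<subseteq> carrier V" "set (xs @ w # ys) \<subseteq> carrier V" "set (xs @ (v + w) # ys) \<subseteq> carrier V"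
    by (simp_all add: is_vspace_closed[OF is_vs])
  note m = this[THEN block_swap_left]
  from assms show "tensor_ext V (\<lambda>us. block_swap us (xs @ (v + w) # ys)) x =
      tensor_ext V (\<lambda>us. block_swap us (xs @ v # ys)) x + tensor_ext V (\<lambda>us. block_swap us (xs @ w # ys)) x"
  proof induction
    case (pure us)
    then have "block_swap us (xs @ (v + w) # ys) = block_swap us (xs @ v # ys) + block_swap us (xs @ w # ys)"
      using block_swap_right[of us] s unfolding multilinear_map_def by blast
    then show ?case using pure by (simp add: tensor_ext_pure[OF is_vs] m)
  qed (simp_all add: tensor_ext_0[OF is_vs] tensor_ext_add[OF is_vs] tensor_ext_scale[OF is_vs] m)
next
  fix xs a v ys assume s: "set (xs @ v # ys) \<subseteq> carrier V"
  then have "set (xs @ v # ys) \<subseteq> carrier V" "set (xs @ vscale V a v # ys) \<subseteq> carrier V"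
    by (simp_all add: is_vspace_closed[OF is_vs])
  note m = this[THEN block_swap_left]
  from assms show "tensor_ext V (\<lambda>us. block_swap us (xs @ vscale V a v # ys)) x =
      tscale a (tensor_ext V (\<lambda>us. block_swap us (xs @ v # ys)) x)"
  proof induction
    case (pure us)
    then have "block_swap us (xs @ vscale V a v # ys) = tscale a (block_swap us (xs @ v # ys))"
      using block_swap_right[of us] s unfolding multilinear_map_def by blast
    then show ?case using pure by (simp add: tensor_ext_pure[OF is_vs] m)
  qed (simp_all add: tensor_ext_0[OF is_vs] tensor_ext_add[OF is_vs] tensor_ext_scale[OF is_vs] m mult.commute)
qed

lemma swap_ext_pure:
  assumes "set xs \<subseteq> carrier V" "set ys \<subseteq> carrier V"
  shows "swap_ext (pure V xs) (pure V ys) = block_swap xs ys"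
  unfolding swap_ext_def using assms
  by (simp add: tensor_ext_pure[OF is_vs] swap_ext_left block_swap_left)

lemma swap_ext_linear_right:
  assumes "x \<in> tensor_algebra V"
  shows "swap_ext x (y + z) = swap_ext x y + swap_ext x z" "swap_ext x (tscale a y) = tscale a (swap_ext x y)"
    "swap_ext x 0 = 0"
  unfolding swap_ext_def
  by (simp_all add: tensor_ext_add[OF is_vs] tensor_ext_scale[OF is_vs] tensor_ext_0[OF is_vs] swap_ext_left[OF assms])

lemma swap_ext_linear_left:
  assumes "x \<in> tensor_algebra V" "y \<in> tensor_algebra V" "z \<in> tensor_algebra V"
  shows "swap_ext (x + y) z = swap_ext x z + swap_ext y z" "swap_ext (tscale a x) z = tscale a (swap_ext x z)"
    "swap_ext 0 z = 0"
proof -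
  have "swap_ext (x + y) z = swap_ext x z + swap_ext y z \<and> swap_ext (tscale a x) z = tscale a (swap_ext x z) \<and>
      swap_ext 0 z = 0"
    using assms(3)
  proof induction
    case (pure zs)
    then show ?case unfolding swap_ext_def using assms
      by (simp add: tensor_ext_pure[OF is_vs] swap_ext_left block_swap_left
          tensor_ext_add[OF is_vs] tensor_ext_scale[OF is_vs] tensor_ext_0[OF is_vs])
  qed (use assms in \<open>simp_all add: swap_ext_linear_right mult.commute\<close>)
  then show "swap_ext (x + y) z = swap_ext x z + swap_ext y z" "swap_ext (tscale a x) z = tscale a (swap_ext x z)"
    "swap_ext 0 z = 0" by auto
qed

lemma swap_ext_in_tp:
  assumes "x \<in> tensor_algebra V" "y \<in> tensor_algebra V"
  shows "swap_ext x y \<in> tensor_power TV 2"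
  using assms(1)
proof induction
  case (pure xs)
  from assms(2) show ?case
  proof induction
    case (pure ys)
    have "split_tensor V [length ys, length xs]
     (block (strand V) 0 (length xs) (length ys) (pure V (xs @ ys))) \<in> tensor_power TV (length [length ys, length xs])"
      by (rule split_tensor_in_tp[OF is_vs], rule block_in_tp[OF V])
        (use pure \<open>set xs \<subseteq> _\<close> in auto)
    then show ?case using pure \<open>set xs \<subseteq> _\<close> by (simp add: swap_ext_pure block_swap_def numeral_2_eq_2)
  qed (use pure in \<open>simp_all add: swap_ext_linear_right\<close>)
qed (use assms(2) in \<open>simp_all add: swap_ext_linear_left swap_ext_linear_left[of 0 0]\<close>)

definition tensor_braiding :: "('k, ('k, 'v) tensor) tensor \<Rightarrow> ('k, ('k, 'v) tensor) tensor" where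
  "tensor_braiding = lin_ext TV 2 (\<lambda>ws. swap_ext (ws ! 0) (ws ! 1))"

lemma tensor_braiding_hom: "hom TV TV 2 2 tensor_braiding"
  and tensor_braiding_pure: "x \<in> tensor_algebra V \<Longrightarrow> y \<in> tensor_algebra V \<Longrightarrow>
    tensor_braiding (pure TV [x, y]) = swap_ext x y"
proof -
  have m: "multilinear_map TV (\<lambda>ws. if length ws = 2 then swap_ext (ws ! 0) (ws ! 1) else 0)"
    by (rule multilinear_map_binary)
      (simp_all add: swap_ext_linear_left swap_ext_linear_right)
  have t: "swap_ext (ws ! 0) (ws ! 1) \<in> tensor_power TV 2" if "set ws \<subseteq> carrier TV" "length ws = 2" for ws
    using that nth_mem[of 0 ws] nth_mem[of 1 ws] by (intro swap_ext_in_tp) auto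
  note l = lin_ext_hom[OF is_vspace_tensor_space m t]
  show "hom TV TV 2 2 tensor_braiding" unfolding tensor_braiding_def by (rule l(1))
  show "tensor_braiding (pure TV [x, y]) = swap_ext x y" if "x \<in> tensor_algebra V" "y \<in> tensor_algebra V"
    unfolding tensor_braiding_def using that by (subst l(2)) auto
qed

text \<open>On split tensors the braiding is a block permutation with the two lengths exchanged, so
  its axioms become identities in a \<open>braid_family\<close>.\<close>

lemma tensor_braiding_split:
  assumes "w \<in> tensor_power V (m + n)"
  shows "tensor_braiding (split_tensor V [m, n] w) = split_tensor V [n, m] (block (strand V) 0 m n w)"
proof -
  note tb = hom_add[OF tensor_braiding_hom] hom_scale[OF tensor_braiding_hom] hom_0[OF tensor_braiding_hom]
  have tp: "split_tensor V [m, n] w \<in> tensor_power TV 2" if "w \<in> tensor_power V (m + n)" for w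
    using split_tensor_in_tp[OF is_vs, of w "[m, n]"] that by (simp add: numeral_2_eq_2)
  from assms show ?thesis
  proof induction
    case (pure vs)
    have s: "set (take m vs) \<subseteq> carrier V" "set (drop m vs) \<subseteq> carrier V"
      using pure set_take_subset[of m vs] set_drop_subset[of m vs] by blast+
    have "split_tensor V [m, n] (pure V vs) = pure TV [pure V (take m vs), pure V (drop m vs)]"
      using pure by (simp add: split_tensor_pure[OF is_vs])
    then show ?case using pure s
      by (simp add: tensor_braiding_pure swap_ext_pure block_swap_def)
  qed (simp_all add: split_tensor_linear[OF is_vs] tb tp block_0[OF V] block_plus[OF V] block_scale[OF V])
qed

end

lemma pure_singleton_linear:
  "pure W [x + y] = pure W [x] + pure W [y]" "pure W [vscale W a x] = tscale a (pure W [x])"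
  using pure_add[of W "[]" x y "[]"] pure_scale[of W "[]" a x "[]"] by simp_all

section \<open>Tensor constructions depend on the carrier and the scalars only\<close>

lemma multilinear_form_cong: "vscale V = vscale W \<Longrightarrow> multilinear_form V = multilinear_form W"
  by (auto simp: multilinear_form_def fun_eq_iff)

lemma pure_cong: "vscale V = vscale W \<Longrightarrow> pure V = pure W"
  using multilinear_form_cong[of V W] by (auto simp: pure_def fun_eq_iff)

lemma tconcat_cong: "vscale V = vscale W \<Longrightarrow> tconcat V = tconcat W"
  using multilinear_form_cong[of V W] by (auto simp: tconcat_def fun_eq_iff)

lemma tensor_power_cong: "carrier V = carrier W \<Longrightarrow> vscale V = vscale W \<Longrightarrow> tensor_power V = tensor_power W"
  using pure_cong[of V W] by (auto simp: tensor_power_def fun_eq_iff)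

lemma lin_ext_cong: "carrier V = carrier W \<Longrightarrow> vscale V = vscale W \<Longrightarrow> lin_ext V = lin_ext W"
  by (intro HOL.ext) (simp add: lin_ext_def pure_cong[of V W] tensor_power_cong[of V W])

lemma tensor_map_cong:
  "carrier V = carrier W \<Longrightarrow> vscale V = vscale W \<Longrightarrow> (f \<otimes>\<^bsub>V,p,q\<^esub> g) = (f \<otimes>\<^bsub>W,p,q\<^esub> g)"
  by (simp add: tensor_map_def pure_cong[of V W] lin_ext_cong[of V W] tconcat_cong[of V W])

lemma is_vspace_cong: "carrier V = carrier W \<Longrightarrow> vscale V = vscale W \<Longrightarrow> is_vspace V = is_vspace W"
  by (simp add: is_vspace_def)

lemma linear_map_cong:
  "carrier V = carrier V' \<Longrightarrow> vscale V = vscale V' \<Longrightarrow> carrier W = carrier W' \<Longrightarrow> vscale W = vscale W' \<Longrightarrow>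
   linear_map V W f = linear_map V' W' f"
  by (simp add: linear_map_def)

lemma tensor_square_cong:
  "carrier V = carrier V' \<Longrightarrow> vscale V = vscale V' \<Longrightarrow> vscale W = vscale W' \<Longrightarrow>
   tensor_square V W f = tensor_square V' W' f"
  by (simp add: tensor_square_def pure_cong[of W W'] lin_ext_cong[of V V'])

lemma tensor_alg_with_simps [simp]:
  "carrier (tensor_alg_with V c) = tensor_algebra V" "vscale (tensor_alg_with V c) = tscale"
  "braiding (tensor_alg_with V c) = c" "mult (tensor_alg_with V c) = tconcat V"
  "unit (tensor_alg_with V c) = pure V []"
  by (simp_all add: tensor_alg_with_def)

text \<open>Tensor powers ignore the algebra structure and the braiding, so every candidate braiding
  acts on literally the same spaces.\<close>

lemma tensor_alg_with_tensor_space: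
  "pure (tensor_alg_with V c) = pure (tensor_space V)"
  "tconcat (tensor_alg_with V c) = tconcat (tensor_space V)"
  "tensor_power (tensor_alg_with V c) = tensor_power (tensor_space V)"
  "lin_ext (tensor_alg_with V c) = lin_ext (tensor_space V)"
  "(f \<otimes>\<^bsub>tensor_alg_with V c,p,q\<^esub> g) = (f \<otimes>\<^bsub>tensor_space V,p,q\<^esub> g)"
  "is_vspace (tensor_alg_with V c) = is_vspace (tensor_space V)"
  by (intro pure_cong tconcat_cong tensor_power_cong lin_ext_cong tensor_map_cong is_vspace_cong; simp)+

lemma unital_algebra_tensor_alg_with: "unital_algebra (tensor_alg_with V c)"
  by (simp add: unital_algebra_def tensor_alg_with_tensor_space is_vspace_tensor_space
      linear_map_def linear_on_def tconcat_assoc image_subset_iff)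

section \<open>T(V) as a braided algebra\<close>

context
  fixes V :: "('k::field, 'v::ab_group_add, 'z) braided_space_scheme"
  assumes V: "braided_vector_space V"
begin

private lemmas vsp = braided_vector_space_hom(1)[OF V]

interpretation braid_family "strand V" by (rule strand_braid_family[OF V])

private abbreviation (input) "TT \<equiv> tensor_space V"
private abbreviation (input) "tb \<equiv> tensor_braiding V"
private abbreviation (input) "sp \<equiv> split_tensor V"
private abbreviation (input) "bl \<equiv> block (strand V)"
text \<open>This and \<open>tensor_unit_map\<close> are \<open>mult_map\<close> and
  \<open>unit_map\<close> of \<open>tensor_alg_with V c\<close> for every \<open>c\<close>, written
  without a braiding.\<close>

definition tensor_mult_map :: "('k, ('k, 'v) tensor) tensor \<Rightarrow> ('k, ('k, 'v) tensor) tensor" where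
  "tensor_mult_map = lin_ext TT 2 (\<lambda>vs. pure TT [tconcat V (vs ! 0) (vs ! 1)])"

definition tensor_unit_map :: "('k, ('k, 'v) tensor) tensor \<Rightarrow> ('k, ('k, 'v) tensor) tensor" where
  "tensor_unit_map = lin_ext TT 0 (\<lambda>vs. pure TT [pure V []])"

private lemmas tb_hom = tensor_braiding_hom[OF V]
private lemmas sp_lin = split_tensor_linear[OF vsp]
private lemmas bl_lin = block_0[OF V] block_plus[OF V] block_scale[OF V]

lemma tensor_mult_map_hom: "hom TT TT 2 1 tensor_mult_map"
  and tensor_mult_map_pure: "x \<in> tensor_algebra V \<Longrightarrow> y \<in> tensor_algebra V \<Longrightarrow> tensor_mult_map (pure TT [x, y]) = pure TT [tconcat V x y]"
proof -
  have m: "multilinear_map TT (\<lambda>vs. if length vs = 2 then pure TT [tconcat V (vs ! 0) (vs ! 1)] else 0)"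
    by (rule multilinear_map_binary)
      (use pure_singleton_linear[of TT] in simp_all)
  have t: "pure TT [tconcat V (ws ! 0) (ws ! 1)] \<in> tensor_power TT 1" if "set ws \<subseteq> carrier TT" "length ws = 2" for ws
    using that by (auto simp: numeral_2_eq_2 length_Suc_conv)
  note l = lin_ext_hom[OF is_vspace_tensor_space m t]
  show "hom TT TT 2 1 tensor_mult_map" unfolding tensor_mult_map_def by (rule l(1))
  show "tensor_mult_map (pure TT [x, y]) = pure TT [tconcat V x y]" if "x \<in> tensor_algebra V" "y \<in> tensor_algebra V"
    unfolding tensor_mult_map_def using that by (subst l(2)) auto
qed

lemma tensor_unit_map_hom: "hom TT TT 0 1 tensor_unit_map"
  and tensor_unit_map_pure: "tensor_unit_map (pure TT []) = pure TT [pure V []]"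
proof -
  have m: "multilinear_map TT (\<lambda>vs. if length vs = 0 then pure TT [pure V []] else 0)"
    by (auto simp: multilinear_map_def)
  have t: "pure TT [pure V []] \<in> tensor_power TT 1" by simp
  note l = lin_ext_hom[OF is_vspace_tensor_space m t]
  show "hom TT TT 0 1 tensor_unit_map" unfolding tensor_unit_map_def by (rule l(1))
  show "tensor_unit_map (pure TT []) = pure TT [pure V []]" unfolding tensor_unit_map_def by (subst l(2)) auto
qed

text \<open>Multiplication joins neighbouring words, so the underlying tensor over V stays the same
  and only a cut disappears.\<close>

lemma tensor_mult_map_split:
  assumes "w \<in> tensor_power V (m + n)"
  shows "tensor_mult_map (sp [m, n] w) = sp [m + n] w"
proof -
  note tb = hom_add[OF tensor_mult_map_hom] hom_scale[OF tensor_mult_map_hom] hom_0[OF tensor_mult_map_hom]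
  have tp: "sp [m, n] w \<in> tensor_power TT 2" if "w \<in> tensor_power V (m + n)" for w
    using split_tensor_in_tp[OF vsp, of w "[m, n]"] that by (simp add: numeral_2_eq_2)
  from assms show ?thesis
  proof induction
    case (pure vs)
    have s: "set (take m vs) \<subseteq> carrier V" "set (drop m vs) \<subseteq> carrier V"
      using pure set_take_subset[of m vs] set_drop_subset[of m vs] by blast+
    then show ?case using pure by (simp add: split_tensor_pure[OF vsp] tensor_mult_map_pure)
  qed (simp_all add: sp_lin tb tp)
qed

text \<open>If \<open>f\<close> is the shadow of an operator \<open>F\<close> on tensors over V,
  then \<open>f\<close> tensored with an identity on the right is the shadow of the same
  \<open>F\<close>, since \<open>F\<close> leaves further factors on the right alone.\<close>

lemma tensor_map_split_left:
  assumes f: "hom TT TT (length ms) q f"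
    and ff: "\<And>y. y \<in> tensor_power V (sum_list ms) \<Longrightarrow> f (sp ms y) = sp ms' (F y)"
    and F: "\<And>y. y \<in> tensor_power V (sum_list ms) \<Longrightarrow> F y \<in> tensor_power V (sum_list ms')"
      "F 0 = 0" "\<And>x y. x \<in> tensor_algebra V \<Longrightarrow> y \<in> tensor_algebra V \<Longrightarrow> F (x + y) = F x + F y"
      "\<And>a x. x \<in> tensor_algebra V \<Longrightarrow> F (tscale a x) = tscale a (F x)"
      "\<And>y z. y \<in> tensor_power V (sum_list ms) \<Longrightarrow> z \<in> tensor_power V (sum_list ns) \<Longrightarrow> F (tconcat V y z) = tconcat V (F y) z"
    and w: "w \<in> tensor_power V (sum_list (ms @ ns))" and len: "length ns = r" "length ms = p"
  shows "(f \<otimes>\<^bsub>TT,p,r\<^esub> id) (sp (ms @ ns) w) = sp (ms' @ ns) (F w)"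
proof -
  have h: "hom TT TT (length ms + r) (q + r) (f \<otimes>\<^bsub>TT,length ms,r\<^esub> id)"
    by (rule tensor_map_hom[OF is_vspace_tensor_space f hom_id])
  have tp: "sp (ms @ ns) w \<in> tensor_power TT (length ms + r)" if "w \<in> tensor_power V (sum_list ms + sum_list ns)" for w
    using split_tensor_in_tp[OF vsp, of w "ms @ ns"] that len by simp
  from w have "w \<in> tensor_power V (sum_list ms + sum_list ns)" by simp
  then show ?thesis unfolding len(2)[symmetric]
  proof (induction rule: tensor_power_split_induct)
    case (tconcat y z)
    have t: "(f \<otimes>\<^bsub>TT,length ms,r\<^esub> id) (tconcat TT (sp ms y) (sp ns z)) = tconcat TT (f (sp ms y)) (id (sp ns z))"
      by (rule tensor_map_tconcat[OF is_vspace_tensor_space f hom_id])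
        (use tconcat len split_tensor_in_tp[OF vsp] in auto)
    show ?case unfolding split_tensor_tconcat[OF vsp tconcat] t using tconcat F(1)
      by (simp add: split_tensor_tconcat[OF vsp] ff F(5))
  qed (simp_all add: sp_lin hom_0[OF h] hom_add[OF h] hom_scale[OF h] tp F(2,3,4) del: id_apply)
qed

text \<open>Factors on the left shift positions, so two operators occur: \<open>G\<close> acts on
  the block of \<open>f\<close>, and \<open>F\<close> is its translate acting behind the untouched
  factors. For crossings these are \<open>block\<close> at position 0 and at position
  \<open>l\<close>.\<close>

lemma tensor_map_split_right:
  assumes f: "hom TT TT (length ns) q f"
    and ff: "\<And>y. y \<in> tensor_power V (sum_list ns) \<Longrightarrow> f (sp ns y) = sp ns' (G y)"
    and G: "\<And>y. y \<in> tensor_power V (sum_list ns) \<Longrightarrow> G y \<in> tensor_power V (sum_list ns')"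
    and F:  "F 0 = 0" "\<And>x y. x \<in> tensor_algebra V \<Longrightarrow> y \<in> tensor_algebra V \<Longrightarrow> F (x + y) = F x + F y"
      "\<And>a x. x \<in> tensor_algebra V \<Longrightarrow> F (tscale a x) = tscale a (F x)"
      "\<And>y z. y \<in> tensor_power V (sum_list ms) \<Longrightarrow> z \<in> tensor_power V (sum_list ns) \<Longrightarrow> F (tconcat V y z) = tconcat V y (G z)"
    and w: "w \<in> tensor_power V (sum_list (ms @ ns))" and len: "length ms = r" "length ns = p"
  shows "(id \<otimes>\<^bsub>TT,r,p\<^esub> f) (sp (ms @ ns) w) = sp (ms @ ns') (F w)"
proof -
  have h: "hom TT TT (r + length ns) (r + q) (id \<otimes>\<^bsub>TT,r,length ns\<^esub> f)"
    by (rule tensor_map_hom[OF is_vspace_tensor_space hom_id f])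
  have tp: "sp (ms @ ns) w \<in> tensor_power TT (r + length ns)" if "w \<in> tensor_power V (sum_list ms + sum_list ns)" for w
    using split_tensor_in_tp[OF vsp, of w "ms @ ns"] that len by simp
  from w have "w \<in> tensor_power V (sum_list ms + sum_list ns)" by simp
  then show ?thesis unfolding len(2)[symmetric]
  proof (induction rule: tensor_power_split_induct)
    case (tconcat y z)
    have t: "(id \<otimes>\<^bsub>TT,r,length ns\<^esub> f) (tconcat TT (sp ms y) (sp ns z)) = tconcat TT (id (sp ms y)) (f (sp ns z))"
      by (rule tensor_map_tconcat[OF is_vspace_tensor_space hom_id f])
        (use tconcat len split_tensor_in_tp[OF vsp] in auto)
    show ?case unfolding split_tensor_tconcat[OF vsp tconcat] t using tconcat G
      by (simp add: split_tensor_tconcat[OF vsp] ff F(4))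
  qed (simp_all add: sp_lin hom_0[OF h] hom_add[OF h] hom_scale[OF h] tp F(1,2,3) del: id_apply)
qed

lemma tb_left_split:
  assumes "w \<in> tensor_power V (l + m + n)"
  shows "(tb \<otimes>\<^bsub>TT,2,1\<^esub> id) (sp [l, m, n] w) = sp [m, l, n] (bl 0 l m w)"
proof -
  have "(tb \<otimes>\<^bsub>TT,2,1\<^esub> id) (sp ([l, m] @ [n]) w) = sp ([m, l] @ [n]) (bl 0 l m w)"
    by (rule tensor_map_split_left[of _ 2])
      (use assms tb_hom in \<open>simp_all add: bl_lin tensor_braiding_split[OF V] block_in_tp[OF V] ac_simps
          block_tconcat_right[OF V] numeral_2_eq_2\<close>)
  then show ?thesis by simp
qed

lemma tb_right_split:
  assumes "w \<in> tensor_power V (l + m + n)"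
  shows "(id \<otimes>\<^bsub>TT,1,2\<^esub> tb) (sp [l, m, n] w) = sp [l, n, m] (bl l m n w)"
proof -
  have "(id \<otimes>\<^bsub>TT,1,2\<^esub> tb) (sp ([l] @ [m, n]) w) = sp ([l] @ [n, m]) (bl l m n w)"
    by (rule tensor_map_split_right[of _ 2 _ _ "bl 0 m n"])
      (use assms tb_hom in \<open>simp_all add: bl_lin tensor_braiding_split[OF V] block_in_tp[OF V] ac_simps
          block_tconcat_left[OF V, of _ l _ 0, simplified] numeral_2_eq_2\<close>)
  then show ?thesis by simp
qed

lemma tensor_mult_map_left_split:
  assumes "w \<in> tensor_power V (l + m + n)"
  shows "(tensor_mult_map \<otimes>\<^bsub>TT,2,1\<^esub> id) (sp [l, m, n] w) = sp [l + m, n] w"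
proof -
  have "(tensor_mult_map \<otimes>\<^bsub>TT,2,1\<^esub> id) (sp ([l, m] @ [n]) w) = sp ([l + m] @ [n]) w"
    by (rule tensor_map_split_left[of _ 1])
      (use assms tensor_mult_map_hom in \<open>simp_all add: tensor_mult_map_split numeral_2_eq_2 add.assoc\<close>)
  then show ?thesis by simp
qed

lemma tensor_mult_map_right_split:
  assumes "w \<in> tensor_power V (l + m + n)"
  shows "(id \<otimes>\<^bsub>TT,1,2\<^esub> tensor_mult_map) (sp [l, m, n] w) = sp [l, m + n] w"
proof -
  have "(id \<otimes>\<^bsub>TT,1,2\<^esub> tensor_mult_map) (sp ([l] @ [m, n]) w) = sp ([l] @ [m + n]) w"
    by (rule tensor_map_split_right[of _ 1 _ _ "\<lambda>x. x"])
      (use assms tensor_mult_map_hom in \<open>simp_all add: tensor_mult_map_split numeral_2_eq_2 add.assoc\<close>)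
  then show ?thesis by simp
qed

lemma tensor_unit_map_split_Nil: "tensor_unit_map (sp [] y) = sp [0] y" if "y \<in> tensor_power V 0"
  using that by induction
    (simp_all add: sp_lin hom_0[OF tensor_unit_map_hom] hom_add[OF tensor_unit_map_hom] hom_scale[OF tensor_unit_map_hom]
      split_tensor_in_tp[OF vsp, of _ "[]", simplified] split_tensor_pure[OF vsp] tensor_unit_map_pure)

lemma tensor_unit_map_left_split:
  assumes "w \<in> tensor_power V n"
  shows "(tensor_unit_map \<otimes>\<^bsub>TT,0,1\<^esub> id) (sp [n] w) = sp [0, n] w"
proof -
  have "(tensor_unit_map \<otimes>\<^bsub>TT,0,1\<^esub> id) (sp ([] @ [n]) w) = sp ([0] @ [n]) w"
    by (rule tensor_map_split_left[of _ 1])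
      (use assms tensor_unit_map_hom in \<open>simp_all add: tensor_unit_map_split_Nil\<close>)
  then show ?thesis by simp
qed

lemma tensor_unit_map_right_split:
  assumes "w \<in> tensor_power V n"
  shows "(id \<otimes>\<^bsub>TT,1,0\<^esub> tensor_unit_map) (sp [n] w) = sp [n, 0] w"
proof -
  have "(id \<otimes>\<^bsub>TT,1,0\<^esub> tensor_unit_map) (sp ([n] @ []) w) = sp ([n] @ [0]) w"
    by (rule tensor_map_split_right[of _ 1 _ _ "\<lambda>x. x"])
      (use assms tensor_unit_map_hom in \<open>simp_all add: tensor_unit_map_split_Nil\<close>)
  then show ?thesis by simp
qed

lemma homs:
  "hom TT TT 3 3 (tb \<otimes>\<^bsub>TT,2,1\<^esub> id)" "hom TT TT 3 3 (id \<otimes>\<^bsub>TT,1,2\<^esub> tb)"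
  "hom TT TT 3 2 (tensor_mult_map \<otimes>\<^bsub>TT,2,1\<^esub> id)" "hom TT TT 3 2 (id \<otimes>\<^bsub>TT,1,2\<^esub> tensor_mult_map)"
  "hom TT TT 1 2 (tensor_unit_map \<otimes>\<^bsub>TT,0,1\<^esub> id)" "hom TT TT 1 2 (id \<otimes>\<^bsub>TT,1,0\<^esub> tensor_unit_map)"
  using tensor_map_hom[OF is_vspace_tensor_space tb_hom hom_id[of TT 1]]
    tensor_map_hom[OF is_vspace_tensor_space hom_id[of TT 1] tb_hom]
    tensor_map_hom[OF is_vspace_tensor_space tensor_mult_map_hom hom_id[of TT 1]]
    tensor_map_hom[OF is_vspace_tensor_space hom_id[of TT 1] tensor_mult_map_hom]
    tensor_map_hom[OF is_vspace_tensor_space tensor_unit_map_hom hom_id[of TT 1]]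
    tensor_map_hom[OF is_vspace_tensor_space hom_id[of TT 1] tensor_unit_map_hom]
  by (simp_all add: numeral_2_eq_2 numeral_3_eq_3)

lemma hom_eq_split3:
  assumes "hom TT W 3 q F" "hom TT W 3 q G"
    and "\<And>l m n w. w \<in> tensor_power V (l + m + n) \<Longrightarrow> F (sp [l, m, n] w) = G (sp [l, m, n] w)"
  shows "eq_on (tensor_power TT 3) F G"
proof (rule hom_eq_split[OF vsp assms(1,2)])
  fix ns w assume "length ns = 3" and w: "w \<in> tensor_power V (sum_list ns)"
  then obtain l m n where "ns = [l, m, n]" by (auto simp: numeral_3_eq_3 length_Suc_conv)
  with w assms(3)[of w l m n] show "F (sp ns w) = G (sp ns w)" by (simp add: add.assoc)
qed

lemma hom_eq_split1:
  assumes "hom TT W 1 q F" "hom TT W 1 q G"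
    and "\<And>n w. w \<in> tensor_power V n \<Longrightarrow> F (sp [n] w) = G (sp [n] w)"
  shows "eq_on (tensor_power TT 1) F G"
proof (rule hom_eq_split[OF vsp assms(1,2)])
  fix ns w assume "length ns = 1" and w: "w \<in> tensor_power V (sum_list ns)"
  then obtain n where "ns = [n]" by (auto simp: length_Suc_conv)
  with w assms(3)[of w n] show "F (sp ns w) = G (sp ns w)" by simp
qed

text \<open>For entries that are words of lengths \<open>l\<close>, \<open>m\<close>,
  \<open>n\<close> this is \<open>block_yang_baxter\<close> at position 0.\<close>

lemma tensor_braiding_yang_baxter:
  "eq_on (tensor_power TT 3)
     ((tb \<otimes>\<^bsub>TT,2,1\<^esub> id) \<circ> (id \<otimes>\<^bsub>TT,1,2\<^esub> tb) \<circ> (tb \<otimes>\<^bsub>TT,2,1\<^esub> id))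
     ((id \<otimes>\<^bsub>TT,1,2\<^esub> tb) \<circ> (tb \<otimes>\<^bsub>TT,2,1\<^esub> id) \<circ> (id \<otimes>\<^bsub>TT,1,2\<^esub> tb))"
proof (rule hom_eq_split3)
  fix l m n w assume w: "w \<in> tensor_power V (l + m + n)"
  then have w': "u \<in> tensor_power V k" if "u \<in> tensor_power V (l + m + n)" "k = l + m + n" for u k
    using that by simp
  note b = block_in_tp[OF V]
  show "((tb \<otimes>\<^bsub>TT,2,1\<^esub> id) \<circ> (id \<otimes>\<^bsub>TT,1,2\<^esub> tb) \<circ> (tb \<otimes>\<^bsub>TT,2,1\<^esub> id)) (sp [l, m, n] w) =
     ((id \<otimes>\<^bsub>TT,1,2\<^esub> tb) \<circ> (tb \<otimes>\<^bsub>TT,2,1\<^esub> id) \<circ> (id \<otimes>\<^bsub>TT,1,2\<^esub> tb)) (sp [l, m, n] w)"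
    using w block_yang_baxter[of 0 m n l w]
    by (simp add: tb_left_split tb_right_split w'[OF b] w'[OF b[OF b]] del: One_nat_def)
qed (rule hom_comp homs)+

lemma braided_vector_space_tensor_braiding: "braided_vector_space (tensor_alg_with V tb)"
  unfolding braided_vector_space_def Let_def tensor_alg_with_tensor_space tensor_alg_with_simps
  using is_vspace_tensor_space[of V] tb_hom tensor_braiding_yang_baxter
  by (simp add: hom_def del: One_nat_def)

text \<open>On split tensors multiplication and unit only alter the cuts. The two product axioms
  thus become \<open>block_add_left\<close> and \<open>block_add_right\<close>, and the unit axioms
  say that passing or moving no strands is the identity.\<close>

lemma braided_algebra_tensor_braiding: "braided_algebra (tensor_alg_with V tb)"
  unfolding braided_algebra_def Let_def mult_map_def unit_map_def
    tensor_alg_with_tensor_space tensor_alg_with_simps tensor_mult_map_def[symmetric] tensor_unit_map_def[symmetric]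
proof (intro conjI unital_algebra_tensor_alg_with braided_vector_space_tensor_braiding)
  have w': "u \<in> tensor_power V k" if "u \<in> tensor_power V (l + m + n)" "k = l + m + n" for u k l m n
    using that by simp
  note b = block_in_tp[OF V]
  show "eq_on (tensor_power TT 3) (tb \<circ> (tensor_mult_map \<otimes>\<^bsub>TT,2,1\<^esub> id))
      ((id \<otimes>\<^bsub>TT,1,2\<^esub> tensor_mult_map) \<circ> (tb \<otimes>\<^bsub>TT,2,1\<^esub> id) \<circ> (id \<otimes>\<^bsub>TT,1,2\<^esub> tb))"
  proof (rule hom_eq_split3)
    fix l m n w assume w: "w \<in> tensor_power V (l + m + n)"
    then show "(tb \<circ> (tensor_mult_map \<otimes>\<^bsub>TT,2,1\<^esub> id)) (sp [l, m, n] w) =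
        ((id \<otimes>\<^bsub>TT,1,2\<^esub> tensor_mult_map) \<circ> (tb \<otimes>\<^bsub>TT,2,1\<^esub> id) \<circ> (id \<otimes>\<^bsub>TT,1,2\<^esub> tb)) (sp [l, m, n] w)"
      using w block_add_left[of 0 l m n w]
      by (simp add: tb_left_split tb_right_split tensor_mult_map_left_split tensor_mult_map_right_split tensor_braiding_split[OF V] w'[OF b[OF w]]
        w'[OF b[OF b[OF w]]] del: One_nat_def)
  qed (rule hom_comp homs tb_hom)+
  show "eq_on (tensor_power TT 3) (tb \<circ> (id \<otimes>\<^bsub>TT,1,2\<^esub> tensor_mult_map))
      ((tensor_mult_map \<otimes>\<^bsub>TT,2,1\<^esub> id) \<circ> (id \<otimes>\<^bsub>TT,1,2\<^esub> tb) \<circ> (tb \<otimes>\<^bsub>TT,2,1\<^esub> id))"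
  proof (rule hom_eq_split3)
    fix l m n w assume w: "w \<in> tensor_power V (l + m + n)"
    then show "(tb \<circ> (id \<otimes>\<^bsub>TT,1,2\<^esub> tensor_mult_map)) (sp [l, m, n] w) =
        ((tensor_mult_map \<otimes>\<^bsub>TT,2,1\<^esub> id) \<circ> (id \<otimes>\<^bsub>TT,1,2\<^esub> tb) \<circ> (tb \<otimes>\<^bsub>TT,2,1\<^esub> id)) (sp [l, m, n] w)"
      using w block_add_right[of 0 l m n w]
      by (simp add: tb_left_split tb_right_split tensor_mult_map_left_split tensor_mult_map_right_split tensor_braiding_split[OF V] w'[OF b[OF w]]
        w'[OF b[OF b[OF w]]] add.assoc del: One_nat_def)
  qed (rule hom_comp homs tb_hom)+
  show "eq_on (tensor_power TT 1) (tb \<circ> (tensor_unit_map \<otimes>\<^bsub>TT,0,1\<^esub> id)) (id \<otimes>\<^bsub>TT,1,0\<^esub> tensor_unit_map)"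
  proof (rule hom_eq_split1)
    fix n w assume w: "w \<in> tensor_power V n"
    then show "(tb \<circ> (tensor_unit_map \<otimes>\<^bsub>TT,0,1\<^esub> id)) (sp [n] w) = (id \<otimes>\<^bsub>TT,1,0\<^esub> tensor_unit_map) (sp [n] w)"
      by (simp add: tensor_unit_map_left_split tensor_unit_map_right_split tensor_braiding_split[OF V] del: One_nat_def)
  qed (rule hom_comp homs tb_hom)+
  show "eq_on (tensor_power TT 1) (tb \<circ> (id \<otimes>\<^bsub>TT,1,0\<^esub> tensor_unit_map)) (tensor_unit_map \<otimes>\<^bsub>TT,0,1\<^esub> id)"
  proof (rule hom_eq_split1)
    fix n w assume w: "w \<in> tensor_power V n"
    then show "(tb \<circ> (id \<otimes>\<^bsub>TT,1,0\<^esub> tensor_unit_map)) (sp [n] w) = (tensor_unit_map \<otimes>\<^bsub>TT,0,1\<^esub> id) (sp [n] w)"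
      by (simp add: tensor_unit_map_left_split tensor_unit_map_right_split tensor_braiding_split[OF V] block_0_right del: One_nat_def)
  qed (rule hom_comp homs tb_hom)+
qed

lemma tensor_square_split:
  assumes "w \<in> tensor_power V 2"
  shows "tensor_square V (tensor_alg_with V c) (\<lambda>v. pure V [v]) w = sp [1, 1] w"
proof -
  let ?g = "\<lambda>vs. pure TT (map (\<lambda>v. pure V [v]) vs)"
  have m: "multilinear_map V (\<lambda>vs. if length vs = 2 then ?g vs else 0)"
    unfolding multilinear_map_def using pure_singleton_linear[of V] pure_add[of TT] pure_scale[of TT] by auto
  have t: "?g vs \<in> tensor_power TT 2" if "set vs \<subseteq> carrier V" "length vs = 2" for vs
    using that by (intro pure_in_tp) auto
  note l = lin_ext_hom[OF vsp m t]
  have eq: "tensor_square V (tensor_alg_with V c) (\<lambda>v. pure V [v]) = lin_ext V 2 ?g"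
    by (simp add: tensor_square_def tensor_alg_with_tensor_space)
  note h = l(1)
  from assms show ?thesis unfolding eq
  proof induction
    case (pure vs)
    then obtain v w where vs: "vs = [v, w]" by (auto simp: numeral_2_eq_2 length_Suc_conv)
    show ?case using pure by (simp add: l(2) split_tensor_pure[OF vsp] vs)
  qed (simp_all add: hom_0[OF h] hom_add[OF h] hom_scale[OF h] sp_lin)
qed

lemma braided_map_tensor_braiding: "braided_map V (tensor_alg_with V tb) (\<lambda>v. pure V [v])"
  unfolding braided_map_def
proof
  show "linear_map V (tensor_alg_with V tb) (\<lambda>v. pure V [v])"
    using pure_singleton_linear[of V] by (auto simp: linear_map_def linear_on_def)
  \<comment> \<open>Two single letters are exchanged by one crossing, which is the given
    braiding.\<close>
  have b: "bl 0 1 1 w = braiding V w" if "w \<in> tensor_power V 2" for w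
    using that leg_0_eq[OF braided_vector_space_hom[OF V] that] by (simp add: strand_def)
  show "eq_on (tensor_power V 2)
     (braiding (tensor_alg_with V tb) \<circ> tensor_square V (tensor_alg_with V tb) (\<lambda>v. pure V [v]))
     (tensor_square V (tensor_alg_with V tb) (\<lambda>v. pure V [v]) \<circ> braiding V)"
    unfolding eq_on_def
  proof
    fix w assume w: "w \<in> tensor_power V 2"
    then have "braiding V w \<in> tensor_power V 2" by (rule hom_in[OF braided_vector_space_hom(2)[OF V]])
    then show "(braiding (tensor_alg_with V tb) \<circ> tensor_square V (tensor_alg_with V tb) (\<lambda>v. pure V [v])) w =
      (tensor_square V (tensor_alg_with V tb) (\<lambda>v. pure V [v]) \<circ> braiding V) w"
      using w tensor_braiding_split[OF V, of w 1 1] b[OF w] by (simp add: tensor_square_split numeral_2_eq_2)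
  qed
qed

text \<open>The block braiding is the witness that the choice in \<open>braided_tensor_alg\<close>
  is not vacuous. The later arguments rely on these two properties of the chosen braiding
  alone.\<close>

lemma braided_tensor_alg_braided:
  "braided_algebra (braided_tensor_alg V)" "braided_map V (braided_tensor_alg V) (\<lambda>v. pure V [v])"
proof -
  let ?P = "\<lambda>c. braided_algebra (tensor_alg_with V c) \<and> braided_map V (tensor_alg_with V c) (\<lambda>v. pure V [v])"
  have "?P (SOME c. ?P c)"
    by (rule someI[of ?P, OF conjI[OF braided_algebra_tensor_braiding braided_map_tensor_braiding]])
  then show "braided_algebra (braided_tensor_alg V)" "braided_map V (braided_tensor_alg V) (\<lambda>v. pure V [v])"
    unfolding braided_tensor_alg_def by auto
qed

end

context
  fixes A :: "('k::field, 'v::ab_group_add, 'z) braided_alg_scheme"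
  assumes A: "braided_algebra A"
begin

section \<open>The multiplication of the braided tensor square\<close>

lemma braided_algebra_space: "braided_vector_space A" and braided_algebra_unital: "unital_algebra A"
  using A by (auto simp: braided_algebra_def)

lemmas braided_algebra_vspace = braided_vector_space_hom(1)[OF braided_algebra_space]
lemmas braided_algebra_braiding_hom = braided_vector_space_hom(2)[OF braided_algebra_space]

lemma unit_in [simp]: "unit A \<in> carrier A"
  using braided_algebra_unital by (simp add: unital_algebra_def)

lemma mult_in [simp]: "x \<in> carrier A \<Longrightarrow> y \<in> carrier A \<Longrightarrow> mult A x y \<in> carrier A"
  using braided_algebra_unital unfolding unital_algebra_def linear_map_def by blast

lemma mult_linear:
  "x \<in> carrier A \<Longrightarrow> y \<in> carrier A \<Longrightarrow> z \<in> carrier A \<Longrightarrow> mult A (x + y) z = mult A x z + mult A y z"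
  "x \<in> carrier A \<Longrightarrow> y \<in> carrier A \<Longrightarrow> z \<in> carrier A \<Longrightarrow> mult A z (x + y) = mult A z x + mult A z y"
  "x \<in> carrier A \<Longrightarrow> z \<in> carrier A \<Longrightarrow> mult A (vscale A a x) z = vscale A a (mult A x z)"
  "x \<in> carrier A \<Longrightarrow> z \<in> carrier A \<Longrightarrow> mult A z (vscale A a x) = vscale A a (mult A z x)"
  using braided_algebra_unital unfolding unital_algebra_def linear_map_def linear_on_def by blast+

lemma mult_unit [simp]: "x \<in> carrier A \<Longrightarrow> mult A (unit A) x = x" "x \<in> carrier A \<Longrightarrow> mult A x (unit A) = x"
  using braided_algebra_unital by (simp_all add: unital_algebra_def)

lemma mult_assoc: "x \<in> carrier A \<Longrightarrow> y \<in> carrier A \<Longrightarrow> z \<in> carrier A \<Longrightarrow>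
    mult A (mult A x y) z = mult A x (mult A y z)"
  using braided_algebra_unital by (simp add: unital_algebra_def)

lemma mult_map_hom: "hom A A 2 1 (mult_map A)"
  and mult_map_pure: "x \<in> carrier A \<Longrightarrow> y \<in> carrier A \<Longrightarrow> mult_map A (pure A [x, y]) = pure A [mult A x y]"
proof -
  have m: "multilinear_map A (\<lambda>vs. if length vs = 2 then pure A [mult A (vs ! 0) (vs ! 1)] else 0)"
    by (rule multilinear_map_binary)
      (simp_all add: mult_linear pure_singleton_linear)
  have t: "pure A [mult A (ws ! 0) (ws ! 1)] \<in> tensor_power A 1" if "set ws \<subseteq> carrier A" "length ws = 2" for ws
    using that by (auto simp: numeral_2_eq_2 length_Suc_conv)
  note l = lin_ext_hom[OF braided_algebra_vspace m t]
  show "hom A A 2 1 (mult_map A)" unfolding mult_map_def by (rule l(1))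
  show "mult_map A (pure A [x, y]) = pure A [mult A x y]" if "x \<in> carrier A" "y \<in> carrier A"
    unfolding mult_map_def using that by (subst l(2)) auto
qed

lemma unit_map_hom: "hom A A 0 1 (unit_map A)"
  and unit_map_pure: "unit_map A (pure A []) = pure A [unit A]"
proof -
  have m: "multilinear_map A (\<lambda>vs. if length vs = 0 then pure A [unit A] else 0)"
    by (auto simp: multilinear_map_def)
  have t: "pure A [unit A] \<in> tensor_power A 1" by simp
  note l = lin_ext_hom[OF braided_algebra_vspace m t]
  show "hom A A 0 1 (unit_map A)" unfolding unit_map_def by (rule l(1))
  show "unit_map A (pure A []) = pure A [unit A]" unfolding unit_map_def by (subst l(2)) auto
qed

private abbreviation (input) "mm i \<equiv> leg A i 2 (mult_map A)"
private abbreviation (input) "cc i \<equiv> leg A i 2 (braiding A)"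

lemma mm_in: "x \<in> tensor_power A n \<Longrightarrow> n = i + 2 + r \<Longrightarrow> k = i + 1 + r \<Longrightarrow> mm i x \<in> tensor_power A k"
  by (rule leg_in_tp'[OF braided_algebra_vspace mult_map_hom])

lemma cc_in: "x \<in> tensor_power A n \<Longrightarrow> n = i + 2 + r \<Longrightarrow> cc i x \<in> tensor_power A n"
  by (rule leg_in_tp'[OF braided_algebra_vspace braided_algebra_braiding_hom])

lemmas mm_linear = leg_linear[OF braided_algebra_vspace mult_map_hom]
lemmas cc_linear = leg_linear[OF braided_algebra_vspace braided_algebra_braiding_hom]
lemmas mm_ta = leg_in_ta[OF braided_algebra_vspace mult_map_hom]
lemmas cc_ta = leg_in_ta[OF braided_algebra_vspace braided_algebra_braiding_hom]

lemma leg_numerals: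
  "y \<in> tensor_power A 3 \<Longrightarrow> (mult_map A \<otimes>\<^bsub>A,2,1\<^esub> id) y = mm 0 y"
  "y \<in> tensor_power A 3 \<Longrightarrow> (id \<otimes>\<^bsub>A,1,2\<^esub> mult_map A) y = mm 1 y"
  "y \<in> tensor_power A 3 \<Longrightarrow> (braiding A \<otimes>\<^bsub>A,2,1\<^esub> id) y = cc 0 y"
  "y \<in> tensor_power A 3 \<Longrightarrow> (id \<otimes>\<^bsub>A,1,2\<^esub> braiding A) y = cc 1 y"
  using tensor_map_id_right[OF braided_algebra_vspace braided_algebra_braiding_hom, of y 1] tensor_map_id_left[OF braided_algebra_vspace braided_algebra_braiding_hom, of y 1]
    tensor_map_id_right[OF braided_algebra_vspace mult_map_hom, of y 1] tensor_map_id_left[OF braided_algebra_vspace mult_map_hom, of y 1]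
  by (simp_all add: numeral_3_eq_3)

lemma braiding_mult_base:
  assumes "y \<in> tensor_power A 3"
  shows "braiding A (mm 0 y) = mm 1 (cc 0 (cc 1 y))" "braiding A (mm 1 y) = mm 0 (cc 1 (cc 0 y))"
proof -
  note c1 = cc_in[OF assms, of 1 0, simplified] cc_in[OF assms, of 0 1, simplified]
  note c2 = cc_in[OF c1(1), of 0 1, simplified] cc_in[OF c1(2), of 1 0, simplified]
  have "(braiding A \<circ> (mult_map A \<otimes>\<^bsub>A,2,1\<^esub> id)) y =
      ((id \<otimes>\<^bsub>A,1,2\<^esub> mult_map A) \<circ> (braiding A \<otimes>\<^bsub>A,2,1\<^esub> id) \<circ> (id \<otimes>\<^bsub>A,1,2\<^esub> braiding A)) y"
    "(braiding A \<circ> (id \<otimes>\<^bsub>A,1,2\<^esub> mult_map A)) y =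
      ((mult_map A \<otimes>\<^bsub>A,2,1\<^esub> id) \<circ> (id \<otimes>\<^bsub>A,1,2\<^esub> braiding A) \<circ> (braiding A \<otimes>\<^bsub>A,2,1\<^esub> id)) y"
    using A assms unfolding braided_algebra_def Let_def eq_on_def by blast+
  then show "braiding A (mm 0 y) = mm 1 (cc 0 (cc 1 y))" "braiding A (mm 1 y) = mm 0 (cc 1 (cc 0 y))"
    using assms c1 c2 by (simp_all add: leg_numerals del: One_nat_def) (simp_all add: leg_numerals[simplified])
qed

lemma braiding_unit:
  assumes "x \<in> carrier A"
  shows "braiding A (pure A [unit A, x]) = pure A [x, unit A]" "braiding A (pure A [x, unit A]) = pure A [unit A, x]"
proof -
  have x: "pure A [x] \<in> tensor_power A 1" using assms by simp
  have "(unit_map A \<otimes>\<^bsub>A,0,1\<^esub> id) (tconcat A (pure A []) (pure A [x])) = tconcat A (unit_map A (pure A [])) (id (pure A [x]))"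
    by (rule tensor_map_tconcat[OF braided_algebra_vspace unit_map_hom hom_id _ x]) simp
  then have 1: "(unit_map A \<otimes>\<^bsub>A,0,1\<^esub> id) (pure A [x]) = pure A [unit A, x]" by (simp add: unit_map_pure)
  have "(id \<otimes>\<^bsub>A,1,0\<^esub> unit_map A) (tconcat A (pure A [x]) (pure A [])) = tconcat A (id (pure A [x])) (unit_map A (pure A []))"
    by (rule tensor_map_tconcat[OF braided_algebra_vspace hom_id unit_map_hom x]) simp
  then have 2: "(id \<otimes>\<^bsub>A,1,0\<^esub> unit_map A) (pure A [x]) = pure A [x, unit A]" by (simp add: unit_map_pure)
  have "(braiding A \<circ> (unit_map A \<otimes>\<^bsub>A,0,1\<^esub> id)) (pure A [x]) = (id \<otimes>\<^bsub>A,1,0\<^esub> unit_map A) (pure A [x])"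
    "(braiding A \<circ> (id \<otimes>\<^bsub>A,1,0\<^esub> unit_map A)) (pure A [x]) = (unit_map A \<otimes>\<^bsub>A,0,1\<^esub> id) (pure A [x])"
    using A x unfolding braided_algebra_def Let_def eq_on_def by blast+
  then show "braiding A (pure A [unit A, x]) = pure A [x, unit A]" "braiding A (pure A [x, unit A]) = pure A [unit A, x]"
    unfolding o_apply 1 2 by auto
qed

lemma mult_assoc_base:
  assumes "y \<in> tensor_power A 3"
  shows "mult_map A (mm 0 y) = mult_map A (mm 1 y)"
proof -
  have in2: "mm 0 x \<in> tensor_power A 2" "mm 1 x \<in> tensor_power A 2" if "x \<in> tensor_power A 3" for x
    by (rule mm_in[OF that, of 0 1] mm_in[OF that, of 1 0]; simp)+
  from assms show ?thesis
  proof induction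
    case (pure vs)
    then obtain a b d where vs: "vs = [a, b, d]" by (auto simp: numeral_3_eq_3 length_Suc_conv)
    show ?case using pure leg_pure[OF braided_algebra_vspace mult_map_hom, of "[]" "[a, b]" "[d]" 0]
        leg_pure[OF braided_algebra_vspace mult_map_hom, of "[a]" "[b, d]" "[]" 1]
      by (simp add: vs mult_map_pure mult_assoc)
  next
    case (add x y)
    then show ?case
      by (simp add: mm_linear hom_add[OF mult_map_hom] in2 del: One_nat_def)
  next
    case (scale a x)
    then show ?case
      by (simp add: mm_linear hom_scale[OF mult_map_hom] in2 del: One_nat_def)
  qed (simp add: mm_linear)
qed

text \<open>The two product axioms and associativity are equations on three factors; they persist
  when identities are added on both sides.\<close>

lemma legs_at:
  assumes "x \<in> tensor_power A n" "n = i + 3 + r"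
  shows "cc i (mm i x) = mm (Suc i) (cc i (cc (Suc i) x))"
    and "cc i (mm (Suc i) x) = mm i (cc (Suc i) (cc i x))"
    and "mm i (mm i x) = mm i (mm (Suc i) x)"
proof -
  define P where "P x \<longleftrightarrow> cc i (mm i x) = mm (Suc i) (cc i (cc (Suc i) x)) \<and>
    cc i (mm (Suc i) x) = mm i (cc (Suc i) (cc i x)) \<and> mm i (mm i x) = mm i (mm (Suc i) x)" for x
  from assms have "x \<in> tensor_power A (i + (3 + r))" by (simp add: add.assoc)
  then have "P x"
  proof (induction rule: tensor_power_split_induct)
    case (tconcat x y)
    note x = tconcat(1)
    from tconcat(2) show ?case
    proof (induction rule: tensor_power_split_induct)
      case (tconcat y z)
      note y = tconcat(1) and z = tensor_power_in_algebra[OF tconcat(2)]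
      have l: "mm i (tconcat A x w) = tconcat A x (mm 0 w)" "mm (Suc i) (tconcat A x w) = tconcat A x (mm 1 w)"
        "cc i (tconcat A x w) = tconcat A x (cc 0 w)" "cc (Suc i) (tconcat A x w) = tconcat A x (cc 1 w)"
        if "w \<in> tensor_algebra A" for w
        using leg_tconcat_left[OF braided_algebra_vspace mult_map_hom x that, of 0] leg_tconcat_left[OF braided_algebra_vspace mult_map_hom x that, of 1]
          leg_tconcat_left[OF braided_algebra_vspace braided_algebra_braiding_hom x that, of 0] leg_tconcat_left[OF braided_algebra_vspace braided_algebra_braiding_hom x that, of 1] by simp_all
      have m: "mm j (tconcat A w z) = tconcat A (mm j w) z"
        if "w \<in> tensor_power A k" "j + 2 \<le> k" for k j w
        by (rule leg_tconcat_right[OF braided_algebra_vspace mult_map_hom that z])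
      have c: "cc j (tconcat A w z) = tconcat A (cc j w) z"
        if "w \<in> tensor_power A k" "j + 2 \<le> k" for k j w
        by (rule leg_tconcat_right[OF braided_algebra_vspace braided_algebra_braiding_hom that z])
      have y1: "mm 0 y \<in> tensor_power A 2" "mm 1 y \<in> tensor_power A 2"
        "cc 0 y \<in> tensor_power A 3" "cc 1 y \<in> tensor_power A 3"
        using mm_in[OF y, of 0 1] mm_in[OF y, of 1 0] cc_in[OF y, of 0 1] cc_in[OF y, of 1 0]
        by (simp_all add: numeral_2_eq_2)
      have y2: "cc 0 (cc 1 y) \<in> tensor_power A 3" "cc 1 (cc 0 y) \<in> tensor_power A 3"
        using cc_in[OF y1(3), of 1 0] cc_in[OF y1(4), of 0 1] by simp_all
      note e = leg_0_eq[OF braided_algebra_vspace mult_map_hom] leg_0_eq[OF braided_algebra_vspace braided_algebra_braiding_hom]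
      note r = m[OF y] m[OF y1(1)] m[OF y1(2)] m[OF y1(3)] m[OF y1(4)] m[OF y2(1)] m[OF y2(2)]
        c[OF y] c[OF y1(1)] c[OF y1(2)] c[OF y1(3)] c[OF y1(4)]
      have "cc 0 (mm 0 y) = mm 1 (cc 0 (cc 1 y))" "cc 0 (mm 1 y) = mm 0 (cc 1 (cc 0 y))"
        "mm 0 (mm 0 y) = mm 0 (mm 1 y)"
        using braiding_mult_base[OF y] mult_assoc_base[OF y] y1 by (simp_all add: e)
      then show ?case
        using y z by (simp add: l r tensor_power_in_algebra[OF y] mm_ta cc_ta P_def del: One_nat_def)
    qed (use x in \<open>simp_all add: mm_linear cc_linear P_def\<close>)
  qed (simp_all add: mm_linear cc_linear P_def)
  then show "cc i (mm i x) = mm (Suc i) (cc i (cc (Suc i) x))"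
    and "cc i (mm (Suc i) x) = mm i (cc (Suc i) (cc i x))"
    and "mm i (mm i x) = mm i (mm (Suc i) x)" by (auto simp: P_def)
qed

lemma legs_near:
  assumes x: "x \<in> tensor_power A n" and n: "i + 3 \<le> n" and j: "j = Suc i"
  shows "cc i (mm i x) = mm j (cc i (cc j x))"
    and "cc i (mm j x) = mm i (cc j (cc i x))"
    and "mm i (mm i x) = mm i (mm j x)"
  using legs_at[OF x, of i "n - i - 3"] n unfolding j by auto

text \<open>A multiplication merges two factors, so operators to its right have index
  \<open>k\<close> before it and \<open>k - 1 = j\<close> after it; a braiding preserves the number
  of factors and causes no shift.\<close>

lemma legs_far:
  assumes "x \<in> tensor_power A n" and "i < j" and k: "k = Suc j" and "k + 2 \<le> n"
  shows "mm j (mm i x) = mm i (mm k x)" "cc j (mm i x) = mm i (cc k x)"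
    "mm k (cc i x) = cc i (mm k x)" "cc k (cc i x) = cc i (cc k x)"
proof -
  obtain d where "j = Suc i + d" using assms(2) by (auto dest: less_imp_Suc_add)
  then show "mm j (mm i x) = mm i (mm k x)" "cc j (mm i x) = mm i (cc k x)"
    "mm k (cc i x) = cc i (mm k x)" "cc k (cc i x) = cc i (cc k x)"
    using leg_commute[OF braided_algebra_vspace mult_map_hom mult_map_hom assms(1), of i d]
      leg_commute[OF braided_algebra_vspace mult_map_hom braided_algebra_braiding_hom assms(1), of i d]
      leg_commute[OF braided_algebra_vspace braided_algebra_braiding_hom mult_map_hom assms(1), of i d]
      leg_commute[OF braided_algebra_vspace braided_algebra_braiding_hom braided_algebra_braiding_hom assms(1), of i d] assms(4) by (simp_all add: k)
qed

lemma mult_leg0: "x \<in> carrier A \<Longrightarrow> y \<in> carrier A \<Longrightarrow> z \<in> carrier A \<Longrightarrow>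
    mm 0 (pure A [x, y, z]) = pure A [mult A x y, z]"
  using leg_pure[OF braided_algebra_vspace mult_map_hom, of "[]" "[x, y]" "[z]" 0] by (simp add: mult_map_pure)

lemma mult_leg1: "x \<in> carrier A \<Longrightarrow> y \<in> carrier A \<Longrightarrow> z \<in> carrier A \<Longrightarrow>
    mm 1 (pure A [x, y, z]) = pure A [x, mult A y z]"
  using leg_pure[OF braided_algebra_vspace mult_map_hom, of "[x]" "[y, z]" "[]" 1] by (simp add: mult_map_pure)

lemma braiding_leg0:
  assumes "t \<in> tensor_power A 2" "z \<in> carrier A"
  shows "cc 0 (tconcat A t (pure A [z])) = tconcat A (braiding A t) (pure A [z])"
  using leg_tconcat_right[OF braided_algebra_vspace braided_algebra_braiding_hom assms(1), of 0 "pure A [z]"] assms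
  by (simp add: leg_0_eq[OF braided_algebra_vspace braided_algebra_braiding_hom])

lemma braiding_leg1:
  assumes "t \<in> tensor_power A 2" "z \<in> carrier A"
  shows "cc 1 (tconcat A (pure A [z]) t) = tconcat A (pure A [z]) (braiding A t)"
  using leg_tconcat_left[OF braided_algebra_vspace braided_algebra_braiding_hom, of "pure A [z]" 1 t 0] assms
  by (simp add: leg_0_eq[OF braided_algebra_vspace braided_algebra_braiding_hom])

text \<open>The second multiplication sits at position 1, not 2, because the first one has merged
  two factors.\<close>

lemma braided_square_mult_legs:
  assumes "x \<in> tensor_power A 2" "y \<in> tensor_power A 2"
  shows "braided_square_mult A x y = mm 1 (mm 0 (cc 1 (tconcat A x y)))"
proof -
  let ?d = "braiding A \<otimes>\<^bsub>A,2,1\<^esub> id"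
  have d: "hom A A 3 3 ?d"
    using tensor_map_hom[OF braided_algebra_vspace braided_algebra_braiding_hom hom_id[of A 1]] by simp
  have 1: "(id \<otimes>\<^bsub>A,1,3\<^esub> ?d) w = cc 1 w" if "w \<in> tensor_power A (1 + 3)" for w
  proof -
    note h = tensor_map_hom[OF braided_algebra_vspace hom_id[of A 1] d]
    from that show ?thesis
    proof (induction rule: tensor_power_split_induct)
      case (tconcat y z)
      have t: "(id \<otimes>\<^bsub>A,1,3\<^esub> ?d) (tconcat A y z) = tconcat A (id y) (?d z)"
        by (rule tensor_map_tconcat[OF braided_algebra_vspace hom_id d tconcat])
      show ?case
        unfolding t leg_numerals(3)[OF tconcat(2)]
        using leg_tconcat_left[OF braided_algebra_vspace braided_algebra_braiding_hom, of y 1 z 0] tconcat by simp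
    qed (simp_all add: cc_linear hom_0[OF h] hom_add[OF h] hom_scale[OF h] del: id_apply One_nat_def)
  qed
  have 2: "tconcat A x y \<in> tensor_power A (1 + 3)" by (rule tconcat_in_tp'[OF assms]) simp
  have 3: "cc 1 (tconcat A x y) \<in> tensor_power A (2 + 2)"
    using cc_in[OF 2, of 1 1] by simp
  show ?thesis
    unfolding braided_square_mult_def o_apply 1[OF 2]
    by (rule tensor_map_legs[OF braided_algebra_vspace mult_map_hom mult_map_hom 3])
qed

lemma braided_square_mult_in:
  assumes "x \<in> tensor_power A 2" "y \<in> tensor_power A 2"
  shows "braided_square_mult A x y \<in> tensor_power A 2"
proof -
  have 1: "tconcat A x y \<in> tensor_power A 4" by (rule tconcat_in_tp'[OF assms]) simp
  note 2 = cc_in[OF 1, of 1 1, simplified]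
  note 3 = mm_in[OF 2, of 0 2 3, simplified]
  show ?thesis unfolding braided_square_mult_legs[OF assms] using mm_in[OF 3, of 1 0 2] by simp
qed

lemma braided_square_mult_linear:
  "x \<in> tensor_power A 2 \<Longrightarrow> y \<in> tensor_power A 2 \<Longrightarrow> z \<in> tensor_power A 2 \<Longrightarrow>
    braided_square_mult A (x + y) z = braided_square_mult A x z + braided_square_mult A y z"
  "x \<in> tensor_power A 2 \<Longrightarrow> y \<in> tensor_power A 2 \<Longrightarrow> z \<in> tensor_power A 2 \<Longrightarrow>
    braided_square_mult A z (x + y) = braided_square_mult A z x + braided_square_mult A z y"
  "x \<in> tensor_power A 2 \<Longrightarrow> z \<in> tensor_power A 2 \<Longrightarrow>
    braided_square_mult A (tscale a x) z = tscale a (braided_square_mult A x z)"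
  "x \<in> tensor_power A 2 \<Longrightarrow> z \<in> tensor_power A 2 \<Longrightarrow>
    braided_square_mult A z (tscale a x) = tscale a (braided_square_mult A z x)"
  "z \<in> tensor_power A 2 \<Longrightarrow> braided_square_mult A 0 z = 0"
  "z \<in> tensor_power A 2 \<Longrightarrow> braided_square_mult A z 0 = 0"
  by (simp_all add: braided_square_mult_legs mm_linear cc_linear)

text \<open>Both bracketings equal one braid on the six factors followed by two triple products, one
  in each half; associativity in \<open>A\<close> then compares them.\<close>

lemma braided_square_mult_assoc:
  assumes x: "x \<in> tensor_power A 2" and y: "y \<in> tensor_power A 2" and z: "z \<in> tensor_power A 2"
  shows "braided_square_mult A (braided_square_mult A x y) z = braided_square_mult A x (braided_square_mult A y z)"
proof -
  define w where "w = tconcat A x (tconcat A y z)"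
  note s = braided_square_mult_legs
  have xy: "tconcat A x y \<in> tensor_power A 4" "tconcat A y z \<in> tensor_power A 4"
    using tconcat_in_tp'[OF x y, of 4] tconcat_in_tp'[OF y z, of 4] by simp_all
  have w: "w \<in> tensor_power A 6" unfolding w_def by (rule tconcat_in_tp'[OF x xy(2)]) simp
  have w': "w = tconcat A (tconcat A x y) z"
    using x y z by (simp add: w_def tconcat_assoc)
  note xy1 = cc_in[OF xy(1), of 1 1, simplified]
  note xy2 = mm_in[OF xy1, of 0 2 3, simplified]
  have "braided_square_mult A (braided_square_mult A x y) z = mm 1 (mm 0 (cc 1 (tconcat A (braided_square_mult A x y) z)))"
    by (rule s[OF braided_square_mult_in[OF x y] z])
  also have "tconcat A (braided_square_mult A x y) z = mm 1 (mm 0 (cc 1 w))"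
    unfolding w' s[OF x y] using leg_tconcat_right[OF braided_algebra_vspace mult_map_hom xy2, of 1] z
      leg_tconcat_right[OF braided_algebra_vspace mult_map_hom xy1, of 0] leg_tconcat_right[OF braided_algebra_vspace braided_algebra_braiding_hom xy(1), of 1]
    by simp
  finally have L: "braided_square_mult A (braided_square_mult A x y) z = mm 1 (mm 0 (cc 1 (mm 1 (mm 0 (cc 1 w)))))" .
  have "braided_square_mult A x (braided_square_mult A y z) = mm 1 (mm 0 (cc 1 (tconcat A x (braided_square_mult A y z))))"
    by (rule s[OF x braided_square_mult_in[OF y z]])
  also have "tconcat A x (braided_square_mult A y z) = mm 3 (mm 2 (cc 3 w))"
    unfolding w_def s[OF y z] using tensor_power_in_algebra[OF xy(2)]
      leg_tconcat_left[OF braided_algebra_vspace mult_map_hom x, of _ 1] leg_tconcat_left[OF braided_algebra_vspace mult_map_hom x, of _ 0]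
      leg_tconcat_left[OF braided_algebra_vspace braided_algebra_braiding_hom x, of _ 1] by (simp add: mm_ta cc_ta)
  finally have R: "braided_square_mult A x (braided_square_mult A y z) = mm 1 (mm 0 (cc 1 (mm 3 (mm 2 (cc 3 w)))))" .
  \<comment> \<open>In \<open>v\<close> the three first legs of \<open>x\<close>, \<open>y\<close>,
    \<open>z\<close> have been moved in front of the three second legs, so only the two triple
    products remain.\<close>
  define v where "v = cc 2 (cc 3 (cc 1 w))"
  have w1: "cc 1 w \<in> tensor_power A 6" "cc 3 w \<in> tensor_power A 6"
    by (rule cc_in[OF w, of _ 3] cc_in[OF w, of _ 1]; simp)+
  have w2: "cc 3 (cc 1 w) \<in> tensor_power A 6" by (rule cc_in[OF w1(1), of _ 1]) simp
  have v: "v \<in> tensor_power A 6" unfolding v_def by (rule cc_in[OF w2, of _ 2]) simp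
  have w3: "mm 0 (cc 1 w) \<in> tensor_power A 5" by (rule mm_in[OF w1(1), of _ 4]) simp_all
  have w4: "mm 2 (cc 3 w) \<in> tensor_power A 5" by (rule mm_in[OF w1(2), of _ 2]) simp_all
  have v1: "mm 3 v \<in> tensor_power A 5" by (rule mm_in[OF v, of _ 1]) simp_all
  have v2: "mm 4 v \<in> tensor_power A 5" by (rule mm_in[OF v, of _ 0]) simp_all
  \<comment> \<open>The triple product of the first three factors commutes with the product of the
    last two, whose position drops from 3 to 1 after the two mergers.\<close>
  have outer: "mm 1 (mm 0 (mm 0 u)) = mm 0 (mm 0 (mm 3 u))" if u: "u \<in> tensor_power A 5" for u
  proof -
    have u1: "mm 0 u \<in> tensor_power A 4" by (rule mm_in[OF u, of _ 3]) simp_all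
    have "mm 1 (mm 0 (mm 0 u)) = mm 0 (mm 2 (mm 0 u))" by (rule legs_far(1)[OF u1]) simp_all
    also have "mm 2 (mm 0 u) = mm 0 (mm 3 u)" by (rule legs_far(1)[OF u]) simp_all
    finally show ?thesis .
  qed
  \<comment> \<open>Crossing the product of the second legs of \<open>x\<close> and \<open>y\<close>
    past the first leg of \<open>z\<close> amounts to crossing each of them, which brings the inner
    expression to multiplications of \<open>v\<close>.\<close>
  have "cc 1 (mm 1 (mm 0 (cc 1 w))) = mm 2 (cc 1 (cc 2 (mm 0 (cc 1 w))))"
    by (rule legs_near(1)[OF w3]) simp_all
  also have "cc 2 (mm 0 (cc 1 w)) = mm 0 (cc 3 (cc 1 w))"
    by (rule legs_far(2)[OF w1(1)]) simp_all
  also have "cc 1 (mm 0 (cc 3 (cc 1 w))) = mm 0 v"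
    unfolding v_def by (rule legs_far(2)[OF w2]) simp_all
  also have "mm 2 (mm 0 v) = mm 0 (mm 3 v)"
    by (rule legs_far(1)[OF v]) simp_all
  finally have "mm 1 (mm 0 (cc 1 (mm 1 (mm 0 (cc 1 w))))) = mm 0 (mm 0 (mm 3 (mm 3 v)))"
    using outer[OF v1] by simp
  \<comment> \<open>Associativity for the second legs.\<close>
  also have "mm 3 (mm 3 v) = mm 3 (mm 4 v)"
    by (rule legs_near(3)[OF v]) simp_all
  also have "mm 0 (mm 0 (mm 3 (mm 4 v))) = mm 1 (mm 0 (mm 0 (mm 4 v)))"
    by (rule outer[OF v2, symmetric])
  \<comment> \<open>Associativity for the first legs.\<close>
  also have "mm 0 (mm 0 (mm 4 v)) = mm 0 (mm 1 (mm 4 v))"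
    by (rule legs_near(3)[OF v2]) simp_all
  also have "mm 1 (mm 4 v) = mm 3 (mm 1 v)"
    by (rule legs_far(1)[OF v, symmetric]) simp_all
  \<comment> \<open>Now the right bracketing is reassembled: the second leg of \<open>x\<close>
    crosses the product of the first legs of \<open>y\<close> and \<open>z\<close> by crossing each
    of them.\<close>
  also have "mm 1 v = cc 1 (mm 2 (cc 3 w))"
  proof -
    have "cc 3 (cc 1 w) = cc 1 (cc 3 w)" by (rule legs_far(4)[OF w, of _ 2]) simp_all
    then show ?thesis unfolding v_def by (simp only:) (rule legs_near(2)[OF w1(2), symmetric]; simp)
  qed
  also have "mm 3 (cc 1 (mm 2 (cc 3 w))) = cc 1 (mm 3 (mm 2 (cc 3 w)))"
    by (rule legs_far(3)[OF w4, of _ 2]) simp_all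
  finally show ?thesis unfolding L R .
qed

text \<open>The braiding of the two inner entries is in general a sum of pure tensors. The case of
  one pure tensor covers products with the unit, where an inner entry is 1.\<close>

lemma braided_square_mult_pure:
  assumes "a \<in> carrier A" "b \<in> carrier A" "d \<in> carrier A" "e \<in> carrier A"
    and c: "braiding A (pure A [b, d]) = pure A [d', b']" and "b' \<in> carrier A" "d' \<in> carrier A"
  shows "braided_square_mult A (pure A [a, b]) (pure A [d, e]) = pure A [mult A a d', mult A b' e]"
proof -
  have "cc 1 (pure A [a, b, d, e]) = pure A [a, d', b', e]"
    using leg_pure[OF braided_algebra_vspace braided_algebra_braiding_hom, of "[a]" "[b, d]" "[e]" 1] assms by simp
  moreover have "mm 0 (pure A [a, d', b', e]) = pure A [mult A a d', b', e]"
    using leg_pure[OF braided_algebra_vspace mult_map_hom, of "[]" "[a, d']" "[b', e]" 0] assms by (simp add: mult_map_pure)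
  moreover have "mm 1 (pure A [mult A a d', b', e]) = pure A [mult A a d', mult A b' e]"
    using leg_pure[OF braided_algebra_vspace mult_map_hom, of "[mult A a d']" "[b', e]" "[]" 1] assms by (simp add: mult_map_pure)
  ultimately show ?thesis using assms by (simp add: braided_square_mult_legs)
qed

lemma braided_square_mult_unit:
  assumes "x \<in> tensor_power A 2"
  shows "braided_square_mult A (pure A [unit A, unit A]) x = x" "braided_square_mult A x (pure A [unit A, unit A]) = x"
proof -
  have "braided_square_mult A (pure A [unit A, unit A]) x = x \<and> braided_square_mult A x (pure A [unit A, unit A]) = x"
    using assms
  proof induction
    case (pure vs)
    then obtain v w where vs: "vs = [v, w]" by (auto simp: numeral_2_eq_2 length_Suc_conv)
    show ?case using pure
      by (simp add: vs braided_square_mult_pure[OF _ _ _ _ braiding_unit(1)] braided_square_mult_pure[OF _ _ _ _ braiding_unit(2)])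
  qed (simp_all add: braided_square_mult_linear)
  then show "braided_square_mult A (pure A [unit A, unit A]) x = x" "braided_square_mult A x (pure A [unit A, unit A]) = x"
    by auto
qed

end

section \<open>Comultiplication and counit of the tensor algebra\<close>

lemma braided_tensor_alg_simps [simp]:
  "carrier (braided_tensor_alg V) = tensor_algebra V" "vscale (braided_tensor_alg V) = tscale"
  "mult (braided_tensor_alg V) = tconcat V" "unit (braided_tensor_alg V) = pure V []"
  by (simp_all add: braided_tensor_alg_def)

context
  fixes V :: "('k::field, 'v::ab_group_add, 'z) braided_space_scheme"
  assumes V: "braided_vector_space V"
begin

private abbreviation (input) "BT \<equiv> braided_tensor_alg V"

lemmas braided_tensor_alg_algebra = braided_tensor_alg_braided(1)[OF V]
private lemmas bvsp = braided_vector_space_hom(1)[OF V]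

private abbreviation (input) "bsm \<equiv> braided_square_mult BT"

definition primitive_letter :: "'v \<Rightarrow> ('k, ('k, 'v) tensor) tensor" where
  "primitive_letter v = pure BT [pure V [v], pure V []] + pure BT [pure V [], pure V [v]]"

definition primitive_word :: "'v list \<Rightarrow> ('k, ('k, 'v) tensor) tensor" where
  "primitive_word vs = foldr (\<lambda>v. bsm (primitive_letter v))
     vs (pure BT [pure V [], pure V []])"

lemma primitive_letter_in:
  "v \<in> carrier V \<Longrightarrow> primitive_letter v \<in> tensor_power BT 2"
  by (simp add: primitive_letter_def)

lemma primitive_word_in: "set vs \<subseteq> carrier V \<Longrightarrow> primitive_word vs \<in> tensor_power BT 2"
  by (induction vs) (simp_all add: primitive_word_def braided_square_mult_in[OF braided_tensor_alg_algebra] primitive_letter_in)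

lemma primitive_word_Cons:
  "primitive_word (v # vs) = bsm (primitive_letter v) (primitive_word vs)"
  by (simp add: primitive_word_def)

lemma primitive_letter_linear:
  "primitive_letter (v + w) = primitive_letter v + primitive_letter w"
  "primitive_letter (vscale V a v) = tscale a (primitive_letter v)"
  using pure_add[of BT "[]" _ _ "[_]"] pure_add[of BT "[_]" _ _ "[]"]
    pure_scale[of BT "[]" _ _ "[_]"] pure_scale[of BT "[_]" _ _ "[]"]
  by (simp_all add: pure_singleton_linear primitive_letter_def algebra_simps)

lemma multilinear_map_primitive_word: "multilinear_map V primitive_word"
  unfolding multilinear_map_def
proof (intro conjI allI impI)
  fix xs v w ys assume "set (xs @ v # w # ys) \<subseteq> carrier V"
  then show "primitive_word (xs @ (v + w) # ys) = primitive_word (xs @ v # ys) + primitive_word (xs @ w # ys)"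
    by (induction xs)
      (simp_all add: primitive_word_Cons primitive_letter_linear(1) primitive_word_in primitive_letter_in braided_square_mult_linear[OF braided_tensor_alg_algebra])
next
  fix xs a v ys assume "set (xs @ v # ys) \<subseteq> carrier V"
  then show "primitive_word (xs @ vscale V a v # ys) = tscale a (primitive_word (xs @ v # ys))"
    by (induction xs)
      (simp_all add: primitive_word_Cons primitive_letter_linear(2) primitive_word_in primitive_letter_in braided_square_mult_linear[OF braided_tensor_alg_algebra])
qed

text \<open>\<open>primitive_word\<close> is a product bracketed to the right, so its compatibility
  with concatenation is where associativity of the braided square enters.\<close>

lemma primitive_word_append:
  assumes "set xs \<subseteq> carrier V" "set ys \<subseteq> carrier V"
  shows "primitive_word (xs @ ys) = bsm (primitive_word xs) (primitive_word ys)"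
  using assms(1)
proof (induction xs)
  case Nil
  then show ?case
    using braided_square_mult_unit[OF braided_tensor_alg_algebra primitive_word_in[OF assms(2)]] by (simp add: primitive_word_def)
next
  case (Cons v xs)
  then show ?case using assms(2)
    by (simp add: primitive_word_Cons braided_square_mult_assoc[OF braided_tensor_alg_algebra] primitive_word_in primitive_letter_in)
qed

lemma comult_exists:
  "\<exists>D. D ` carrier BT \<subseteq> tensor_power BT 2 \<and>
        linear_on (carrier BT) tscale tscale D \<and>
        (\<forall>x\<in>carrier BT. \<forall>y\<in>carrier BT. D (mult BT x y) = braided_square_mult BT (D x) (D y)) \<and>
        D (unit BT) = pure BT [unit BT, unit BT] \<and>
        (\<forall>v\<in>carrier V. D (pure V [v]) = pure BT [pure V [v], unit BT] + pure BT [unit BT, pure V [v]])"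
proof (intro exI conjI)
  let ?D = "tensor_ext V primitive_word"
  note p = tensor_ext_pure[OF bvsp multilinear_map_primitive_word]
  note l = tensor_ext_0[OF bvsp multilinear_map_primitive_word] tensor_ext_add[OF bvsp multilinear_map_primitive_word]
    tensor_ext_scale[OF bvsp multilinear_map_primitive_word]
  have D: "?D x \<in> tensor_power BT 2" if "x \<in> tensor_algebra V" for x
    using that by induction (simp_all add: p l primitive_word_in)
  then show "?D ` carrier BT \<subseteq> tensor_power BT 2" by auto
  show "linear_on (carrier BT) tscale tscale ?D" by (simp add: linear_on_def l)
  show "?D (unit BT) = pure BT [unit BT, unit BT]" by (simp add: p primitive_word_def)
  show "\<forall>v\<in>carrier V. ?D (pure V [v]) = pure BT [pure V [v], unit BT] + pure BT [unit BT, pure V [v]]"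
    using braided_square_mult_unit(2)[OF braided_tensor_alg_algebra primitive_letter_in] by (simp add: p primitive_word_def primitive_letter_def)
  show "\<forall>x\<in>carrier BT. \<forall>y\<in>carrier BT. ?D (mult BT x y) = braided_square_mult BT (?D x) (?D y)"
  proof (intro ballI)
    fix x y assume "x \<in> carrier BT" and y: "y \<in> carrier BT"
    from this(1) have "x \<in> tensor_algebra V" by simp
    then show "?D (mult BT x y) = braided_square_mult BT (?D x) (?D y)"
    proof induction
      case (pure xs)
      from y have "y \<in> tensor_algebra V" by simp
      then show ?case
        by induction (use pure in \<open>simp_all add: p l D braided_square_mult_linear[OF braided_tensor_alg_algebra] primitive_word_in primitive_word_append\<close>)
    qed (use y in \<open>simp_all add: p l D braided_square_mult_linear[OF braided_tensor_alg_algebra]\<close>)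
  qed
qed

lemma
  shows tensor_comult_in: "x \<in> tensor_algebra V \<Longrightarrow> tensor_comult V x \<in> tensor_power BT 2"
    and tensor_comult_linear: "linear_on (tensor_algebra V) tscale tscale (tensor_comult V)"
    and tensor_comult_mult: "x \<in> tensor_algebra V \<Longrightarrow> y \<in> tensor_algebra V \<Longrightarrow>
      tensor_comult V (tconcat V x y) = bsm (tensor_comult V x) (tensor_comult V y)"
    and tensor_comult_unit: "tensor_comult V (pure V []) = pure BT [pure V [], pure V []]"
    and tensor_comult_letter: "v \<in> carrier V \<Longrightarrow>
      tensor_comult V (pure V [v]) = pure BT [pure V [v], pure V []] + pure BT [pure V [], pure V [v]]"
proof -
  note * = someI_ex[OF comult_exists, folded tensor_comult_def[of V, unfolded Let_def], simplified]
  show "x \<in> tensor_algebra V \<Longrightarrow> tensor_comult V x \<in> tensor_power BT 2"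
    "linear_on (tensor_algebra V) tscale tscale (tensor_comult V)"
    "x \<in> tensor_algebra V \<Longrightarrow> y \<in> tensor_algebra V \<Longrightarrow>
      tensor_comult V (tconcat V x y) = bsm (tensor_comult V x) (tensor_comult V y)"
    "tensor_comult V (pure V []) = pure BT [pure V [], pure V []]"
    "v \<in> carrier V \<Longrightarrow>
      tensor_comult V (pure V [v]) = pure BT [pure V [v], pure V []] + pure BT [pure V [], pure V [v]]"
    using * by auto
qed

lemma counit_exists:
  "\<exists>e. linear_on (carrier BT) tscale (*) e \<and>
        (\<forall>x\<in>carrier BT. \<forall>y\<in>carrier BT. e (mult BT x y) = e x * e y) \<and>
        e (unit BT) = 1 \<and>
        (\<forall>v\<in>carrier V. e (pure V [v]) = 0)"
proof (intro exI conjI)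
  \<comment> \<open>The counit takes the component of degree 0. As tensors are functionals on forms,
    this is evaluation at the form that is 1 on the empty word and 0 on all others.\<close>
  let ?b = "\<lambda>vs. if vs = [] then 1 else 0"
  let ?e = "\<lambda>x :: ('k, 'v) tensor. x ?b"
  have b: "multilinear_form V ?b" by (simp add: multilinear_form_def)
  have l: "?e (x + y) = ?e x + ?e y" "?e (tscale a x) = a * ?e x" "?e 0 = 0" for x y a
    by (simp_all add: plus_fun_apply tscale_def zero_fun_apply)
  have p: "?e (pure V vs) = ?b vs" for vs by (simp add: pure_def b)
  show "linear_on (carrier BT) tscale (*) ?e" by (simp add: linear_on_def l)
  show "?e (unit BT) = 1" "\<forall>v\<in>carrier V. ?e (pure V [v]) = 0" by (simp_all add: p)
  show "\<forall>x\<in>carrier BT. \<forall>y\<in>carrier BT. ?e (mult BT x y) = ?e x * ?e y"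
  proof (intro ballI)
    fix x y assume "x \<in> carrier BT" and y: "y \<in> carrier BT"
    from this(1) have "x \<in> tensor_algebra V" by simp
    then show "?e (mult BT x y) = ?e x * ?e y"
    proof induction
      case (pure xs)
      from y have "y \<in> tensor_algebra V" by simp
      then show ?case
        by induction (use pure in \<open>simp_all add: p l algebra_simps\<close>)
    qed (use y in \<open>simp_all add: p l algebra_simps\<close>)
  qed
qed

lemma
  shows tensor_counit_linear: "linear_on (tensor_algebra V) tscale (*) (tensor_counit V)"
    and tensor_counit_mult: "x \<in> tensor_algebra V \<Longrightarrow> y \<in> tensor_algebra V \<Longrightarrow>
      tensor_counit V (tconcat V x y) = tensor_counit V x * tensor_counit V y"
    and tensor_counit_unit: "tensor_counit V (pure V []) = 1"
    and tensor_counit_letter: "v \<in> carrier V \<Longrightarrow> tensor_counit V (pure V [v]) = 0"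
proof -
  note * = someI_ex[OF counit_exists, folded tensor_counit_def[of V, unfolded Let_def], simplified]
  show "linear_on (tensor_algebra V) tscale (*) (tensor_counit V)"
    "x \<in> tensor_algebra V \<Longrightarrow> y \<in> tensor_algebra V \<Longrightarrow>
      tensor_counit V (tconcat V x y) = tensor_counit V x * tensor_counit V y"
    "tensor_counit V (pure V []) = 1" "v \<in> carrier V \<Longrightarrow> tensor_counit V (pure V [v]) = 0"
    using * by auto
qed

end

section \<open>Tensor powers of linear maps\<close>

text \<open>Extend \<open>x - y\<close> to a basis of the ambient space; the coordinate along it is
  a linear form that separates \<open>x\<close> from \<open>y\<close>. This allows equations between
  vectors to be proved between tensors of degree one.\<close>

lemma singleton_inject:
  assumes V: "is_vspace V" and eq: "pure V [x] = pure V [y]"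
  shows "x = y"
proof (rule ccontr)
  assume "x \<noteq> y"
  interpret vector_space "vscale V" using V by (simp add: is_vspace_def)
  let ?d = "x - y"
  let ?B = "extend_basis {?d}"
  have d: "independent {?d}" using \<open>x \<noteq> y\<close> by simp
  note B = independent_extend_basis[OF d] span_extend_basis[OF d]
  have dB: "?d \<in> ?B" using extend_basis_superset[OF d] by simp
  define f where "f v = representation ?B v ?d" for v
  have f: "f (v + w) = f v + f w" "f (vscale V a v) = a * f v" for v w a
    using B by (simp_all add: f_def representation_add representation_scale)
  \<comment> \<open>A linear form becomes a family of multilinear forms by taking the value 0 on
    words of length other than 1.\<close>
  define g where "g vs = (case vs of [v] \<Rightarrow> f v | _ \<Rightarrow> 0)" for vs
  have g: "multilinear_form V g"
    unfolding multilinear_form_def g_def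
  proof (intro conjI allI)
    fix xs ys :: "'b list" and v w a
    show "(case xs @ (v + w) # ys of [v] \<Rightarrow> f v | _ \<Rightarrow> 0) =
        (case xs @ v # ys of [v] \<Rightarrow> f v | _ \<Rightarrow> 0) + (case xs @ w # ys of [v] \<Rightarrow> f v | _ \<Rightarrow> 0)"
      "(case xs @ vscale V a v # ys of [v] \<Rightarrow> f v | _ \<Rightarrow> 0) = a * (case xs @ v # ys of [v] \<Rightarrow> f v | _ \<Rightarrow> 0)"
      by (cases xs; cases "tl xs"; cases ys; simp add: f)+
  qed
  have "f x = f y" using fun_cong[OF eq, of g] by (simp add: pure_def g g_def)
  moreover have "f x = f ?d + f y" using f(1)[of ?d y] by simp
  moreover have "f ?d = 1" using representation_basis[OF B(1) dB] by (simp add: f_def)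
  ultimately show False by simp
qed

text \<open>All tensor powers of \<open>f\<close> at once, so that one map is compatible with
  products and with legs of every arity; in degree 2 it is \<open>tensor_square\<close>.\<close>

definition tensor_powers_map ::
  "('k::field, 'v::ab_group_add, 'y) vspace_scheme \<Rightarrow> ('k, 'w::ab_group_add, 'z) vspace_scheme \<Rightarrow> ('v \<Rightarrow> 'w)
     \<Rightarrow> ('k, 'v) tensor \<Rightarrow> ('k, 'w) tensor" where
  "tensor_powers_map A B f = tensor_ext A (\<lambda>vs. pure B (map f vs))"

lemma multilinear_map_map:
  assumes "linear_map A B f" "is_vspace A"
  shows "multilinear_map A (\<lambda>vs. pure B (map f vs))"
  using assms unfolding multilinear_map_def linear_map_def linear_on_def
  by (auto simp: pure_add pure_scale)

context
  fixes A :: "('k::field, 'v::ab_group_add, 'y) vspace_scheme"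
    and B :: "('k, 'w::ab_group_add, 'z) vspace_scheme"
    and f :: "'v \<Rightarrow> 'w"
  assumes f: "linear_map A B f" and A: "is_vspace A" and B: "is_vspace B"
begin

private abbreviation (input) "F \<equiv> tensor_powers_map A B f"

lemma linear_map_in: "x \<in> carrier A \<Longrightarrow> f x \<in> carrier B"
  using f by (auto simp: linear_map_def)

lemma linear_map_set: "set vs \<subseteq> carrier A \<Longrightarrow> set (map f vs) \<subseteq> carrier B"
  using linear_map_in by auto

lemma tensor_powers_map_pure: "set vs \<subseteq> carrier A \<Longrightarrow> F (pure A vs) = pure B (map f vs)"
  unfolding tensor_powers_map_def by (rule tensor_ext_pure[OF A multilinear_map_map[OF f A]])

lemma tensor_powers_map_linear: "F (x + y) = F x + F y" "F (tscale a x) = tscale a (F x)" "F 0 = 0"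
  unfolding tensor_powers_map_def
  by (rule tensor_ext_add[OF A multilinear_map_map[OF f A]] tensor_ext_scale[OF A multilinear_map_map[OF f A]]
      tensor_ext_0[OF A multilinear_map_map[OF f A]])+

lemma tensor_powers_map_in: "x \<in> tensor_power A n \<Longrightarrow> F x \<in> tensor_power B n"
  by (induction rule: tensor_power_induct) (use linear_map_set in \<open>simp_all add: tensor_powers_map_linear tensor_powers_map_pure\<close>)

lemma tensor_powers_map_in_ta: "x \<in> tensor_algebra A \<Longrightarrow> F x \<in> tensor_algebra B"
  by (induction rule: tensor_algebra_induct) (use linear_map_set in \<open>simp_all add: tensor_powers_map_linear tensor_powers_map_pure\<close>)

lemma tensor_powers_map_hom: "hom A B n n F"
  by (rule homI) (use linear_map_set in \<open>simp_all add: tensor_powers_map_linear tensor_powers_map_pure\<close>)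

lemma tensor_powers_map_tconcat:
  assumes "x \<in> tensor_algebra A" "y \<in> tensor_algebra A"
  shows "F (tconcat A x y) = tconcat B (F x) (F y)"
  using assms(1)
proof induction
  case (pure xs)
  from assms(2) show ?case
    by induction (use pure linear_map_set in \<open>simp_all add: tensor_powers_map_linear tensor_powers_map_pure tensor_powers_map_in_ta\<close>)
qed (use assms(2) in \<open>simp_all add: tensor_powers_map_linear\<close>)

text \<open>Compatibility has to be known only on the \<open>p\<close> factors that are acted upon,
  because \<open>tensor_powers_map\<close> is multiplicative for \<open>tconcat\<close>.\<close>

lemma tensor_powers_map_leg:
  assumes g: "hom A A p q g" and h: "hom B B p q h"
    and eq: "\<And>x. x \<in> tensor_power A p \<Longrightarrow> F (g x) = h (F x)"
    and x: "x \<in> tensor_power A n" "i + p \<le> n"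
  shows "F (leg A i p g x) = leg B i p h (F x)"
proof -
  note l = leg_linear[OF A g] leg_linear[OF B h] tensor_powers_map_linear
  from x have "x \<in> tensor_power A (i + (p + (n - i - p)))" by simp
  then show ?thesis
  proof (induction rule: tensor_power_split_induct)
    case (tconcat x y)
    note x = tconcat(1)
    from tconcat(2) show ?case
    proof (induction rule: tensor_power_split_induct)
      case (tconcat y z)
      have "leg A i p g (tconcat A x (tconcat A y z)) = tconcat A x (tconcat A (g y) z)"
        by (rule leg_tconcat[OF A g x tconcat(1)]) (use tconcat in simp)
      moreover have "leg B i p h (tconcat B (F x) (tconcat B (F y) (F z))) = tconcat B (F x) (tconcat B (h (F y)) (F z))"
        by (rule leg_tconcat[OF B h]) (use x tconcat in \<open>auto intro: tensor_powers_map_in tensor_powers_map_in_ta\<close>)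
      ultimately show ?case
        using x tconcat hom_in[OF g tconcat(1), THEN tensor_power_in_algebra]
        by (simp add: tensor_powers_map_tconcat eq tensor_power_in_algebra[OF x] tensor_power_in_algebra[OF tconcat(1)] tensor_power_in_algebra[OF tconcat(2)])
    qed (use x in \<open>simp_all add: l\<close>)
  qed (simp_all add: l)
qed

text \<open>The separate target \<open>B'\<close> serves the infinitesimal part, whose pure tensors
  are those of the bialgebra because the scalars are shared.\<close>

lemma tensor_square_powers_map:
  assumes "x \<in> tensor_power A 2" "vscale B' = vscale B"
  shows "tensor_square A B' f x = F x"
proof -
  have m: "multilinear_map A (\<lambda>vs. if length vs = 2 then pure B (map f vs) else 0)"
    using multilinear_map_map[OF f A] unfolding multilinear_map_def by auto
  have t: "pure B (map f vs) \<in> tensor_power B 2" if "set vs \<subseteq> carrier A" "length vs = 2" for vs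
    using that linear_map_set by (intro pure_in_tp) auto
  note l = lin_ext_hom[OF A m t]
  have "tensor_square A B' f = lin_ext A 2 (\<lambda>vs. pure B (map f vs))"
    by (simp add: tensor_square_def pure_cong[OF assms(2)])
  moreover have "eq_on (tensor_power A 2) (lin_ext A 2 (\<lambda>vs. pure B (map f vs))) F"
    by (rule hom_eqI[OF l(1) tensor_powers_map_hom]) (simp_all add: l(2) tensor_powers_map_pure)
  ultimately show ?thesis using assms(1) by (simp add: eq_on_def)
qed

end

lemma algebra_map_mult_map:
  assumes A: "braided_algebra A" and B: "braided_algebra B" and f: "algebra_map A B f"
    and x: "x \<in> tensor_power A 2"
  shows "tensor_powers_map A B f (mult_map A x) = mult_map B (tensor_powers_map A B f x)"
proof -
  have l: "linear_map A B f" and m: "\<And>x y. x \<in> carrier A \<Longrightarrow> y \<in> carrier A \<Longrightarrow> f (mult A x y) = mult B (f x) (f y)"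
    using f by (auto simp: algebra_map_def)
  note pm = tensor_powers_map_hom[OF l braided_algebra_vspace[OF A] braided_algebra_vspace[OF B]]
  have "eq_on (tensor_power A 2) (tensor_powers_map A B f \<circ> mult_map A) (mult_map B \<circ> tensor_powers_map A B f)"
  proof (rule hom_eqI[OF hom_comp[OF mult_map_hom[OF A] pm] hom_comp[OF pm mult_map_hom[OF B]]])
    fix vs assume vs: "set vs \<subseteq> carrier A" "length vs = 2"
    then obtain a b where "vs = [a, b]" by (auto simp: numeral_2_eq_2 length_Suc_conv)
    with vs show "(tensor_powers_map A B f \<circ> mult_map A) (pure A vs) = (mult_map B \<circ> tensor_powers_map A B f) (pure A vs)"
      using linear_map_in[OF l braided_algebra_vspace[OF A] braided_algebra_vspace[OF B]]
      by (simp add: mult_map_pure[OF A] mult_map_pure[OF B] tensor_powers_map_pure[OF l braided_algebra_vspace[OF A] braided_algebra_vspace[OF B]] m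
          mult_in[OF A])
  qed
  with x show ?thesis by (simp add: eq_on_def)
qed

text \<open>The product of the braided square is composed of one braiding leg and two multiplication
  legs, and the map passes through each of them.\<close>

lemma braided_square_mult_map:
  assumes A: "braided_algebra A" and B: "braided_algebra B" and f: "algebra_map A B f"
    and br: "\<And>x. x \<in> tensor_power A 2 \<Longrightarrow>
      tensor_powers_map A B f (braiding A x) = braiding B (tensor_powers_map A B f x)"
    and x: "x \<in> tensor_power A 2" and y: "y \<in> tensor_power A 2"
  shows "tensor_powers_map A B f (braided_square_mult A x y) =
    braided_square_mult B (tensor_powers_map A B f x) (tensor_powers_map A B f y)"
proof -
  let ?F = "tensor_powers_map A B f"
  have l: "linear_map A B f" using f by (auto simp: algebra_map_def)
  note vs = braided_algebra_vspace[OF A] braided_algebra_vspace[OF B]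
  note leg_m = tensor_powers_map_leg[OF l vs mult_map_hom[OF A] mult_map_hom[OF B] algebra_map_mult_map[OF A B f]]
  note leg_c = tensor_powers_map_leg[OF l vs braided_algebra_braiding_hom[OF A] braided_algebra_braiding_hom[OF B] br]
  have 1: "tconcat A x y \<in> tensor_power A 4" by (rule tconcat_in_tp'[OF x y]) simp
  have 2: "leg A 1 2 (braiding A) (tconcat A x y) \<in> tensor_power A 4" by (rule cc_in[OF A 1, of _ 1]) simp
  have 3: "leg A 0 2 (mult_map A) (leg A 1 2 (braiding A) (tconcat A x y)) \<in> tensor_power A 3"
    by (rule mm_in[OF A 2, of _ 2]) simp_all
  have "?F (leg A 1 2 (mult_map A) (leg A 0 2 (mult_map A) (leg A 1 2 (braiding A) (tconcat A x y)))) =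
      leg B 1 2 (mult_map B) (?F (leg A 0 2 (mult_map A) (leg A 1 2 (braiding A) (tconcat A x y))))"
    by (rule leg_m[OF _ 3]) simp_all
  also have "?F (leg A 0 2 (mult_map A) (leg A 1 2 (braiding A) (tconcat A x y))) =
      leg B 0 2 (mult_map B) (?F (leg A 1 2 (braiding A) (tconcat A x y)))"
    by (rule leg_m[OF _ 2]) simp_all
  also have "?F (leg A 1 2 (braiding A) (tconcat A x y)) = leg B 1 2 (braiding B) (?F (tconcat A x y))"
    by (rule leg_c[OF _ 1]) simp_all
  also have "?F (tconcat A x y) = tconcat B (?F x) (?F y)"
    by (rule tensor_powers_map_tconcat[OF l vs]) (use x y in auto)
  finally show ?thesis
    using x y tensor_powers_map_in[OF l vs]
    by (simp add: braided_square_mult_legs[OF A] braided_square_mult_legs[OF B])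
qed

text \<open>Ensures that an extension with values \<open>pure B [b]\<close> on words has values of
  this form everywhere, so that an element of \<open>B\<close> can be read off.\<close>

lemma subspace_singletons: "is_vspace V \<Longrightarrow> module.subspace tscale {pure V [v] |v. v \<in> carrier V}"
proof -
  assume V: "is_vspace V"
  interpret module tscale by (rule module_tscale)
  show ?thesis
  proof (rule subspaceI)
    have "vscale V 0 0 = 0"
      using V module.scale_zero_left[of "vscale V"] by (simp add: is_vspace_def module_iff_vector_space)
    then have "pure V [0] = 0" using pure_scale[of V "[]" 0 0 "[]"] by simp
    then show "0 \<in> {pure V [v] |v. v \<in> carrier V}" using is_vspace_closed(3)[OF V] by force
  next
    fix x y assume "x \<in> {pure V [v] |v. v \<in> carrier V}" "y \<in> {pure V [v] |v. v \<in> carrier V}"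
    then obtain v w where "x + y = pure V [v + w]" "v \<in> carrier V" "w \<in> carrier V"
      using pure_add[of V "[]" _ _ "[]"] by auto
    then show "x + y \<in> {pure V [v] |v. v \<in> carrier V}"
      using is_vspace_closed(1)[OF V] by blast
  next
    fix a x assume "x \<in> {pure V [v] |v. v \<in> carrier V}"
    then obtain v where "tscale a x = pure V [vscale V a v]" "v \<in> carrier V"
      using pure_scale[of V "[]" a _ "[]"] by auto
    then show "tscale a x \<in> {pure V [v] |v. v \<in> carrier V}"
      using is_vspace_closed(2)[OF V] by blast
  qed
qed

section \<open>Comultiplication and counit of a braided bialgebra\<close>

context
  fixes B :: "('k::field, 'b::ab_group_add) braided_bialg"
  assumes B: "braided_bialgebra B"
begin

lemma bialgebra_algebra: "braided_algebra B" and bialgebra_coalgebra: "coalgebra B"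
  using B by (auto simp: braided_bialgebra_def braided_coalgebra_def)

lemmas bialgebra_vspace = braided_algebra_vspace[OF bialgebra_algebra]

lemma comult_in: "x \<in> carrier B \<Longrightarrow> comult B x \<in> tensor_power B 2"
  and comult_linear: "linear_on (carrier B) (vscale B) tscale (comult B)"
  and counit_linear: "linear_on (carrier B) (vscale B) (*) (counit B)"
  using bialgebra_coalgebra by (auto simp: coalgebra_def)

lemma comult_map_hom: "hom B B 1 2 (comult_map B)"
  and comult_map_pure: "x \<in> carrier B \<Longrightarrow> comult_map B (pure B [x]) = comult B x"
proof -
  have m: "multilinear_map B (\<lambda>vs. if length vs = 1 then comult B (vs ! 0) else 0)"
    by (rule multilinear_map_unary) (use comult_linear in \<open>auto simp: linear_on_def\<close>)
  have t: "comult B (ws ! 0) \<in> tensor_power B 2" if "set ws \<subseteq> carrier B" "length ws = 1" for ws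
    using that by (auto simp: length_Suc_conv comult_in)
  note l = lin_ext_hom[OF bialgebra_vspace m t]
  show "hom B B 1 2 (comult_map B)" unfolding comult_map_def by (rule l(1))
  show "comult_map B (pure B [x]) = comult B x" if "x \<in> carrier B"
    unfolding comult_map_def using that by (subst l(2)) auto
qed

lemma counit_map_hom: "hom B B 1 0 (counit_map B)"
  and counit_map_pure: "x \<in> carrier B \<Longrightarrow> counit_map B (pure B [x]) = tscale (counit B x) (pure B [])"
proof -
  have tl: "tscale (a + b) x = tscale a x + tscale b x" for a b and x :: "('k, 'b) tensor"
    by (simp add: tscale_def fun_eq_iff plus_fun_apply algebra_simps)
  have m: "multilinear_map B (\<lambda>vs. if length vs = 1 then tscale (counit B (vs ! 0)) (pure B []) else 0)"
    by (rule multilinear_map_unary) (use counit_linear in \<open>auto simp: linear_on_def tl\<close>)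
  have t: "tscale (counit B (ws ! 0)) (pure B []) \<in> tensor_power B 0" if "set ws \<subseteq> carrier B" "length ws = 1" for ws
    by simp
  note l = lin_ext_hom[OF bialgebra_vspace m t]
  show "hom B B 1 0 (counit_map B)" unfolding counit_map_def by (rule l(1))
  show "counit_map B (pure B [x]) = tscale (counit B x) (pure B [])" if "x \<in> carrier B"
    unfolding counit_map_def using that by (subst l(2)) auto
qed

lemma comult_mult:
  assumes "x \<in> carrier B" "y \<in> carrier B"
  shows "comult B (mult B x y) = braided_square_mult B (comult B x) (comult B y)"
proof -
  let ?D = "comult_map B"
  have xy: "pure B [x] \<in> tensor_power B 1" "pure B [y] \<in> tensor_power B 1" "pure B [x, y] \<in> tensor_power B 2"
    using assms by auto
  have "(?D \<circ> mult_map B) (pure B [x, y]) =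
      ((mult_map B \<otimes>\<^bsub>B,2,2\<^esub> mult_map B) \<circ> (id \<otimes>\<^bsub>B,1,3\<^esub> (braiding B \<otimes>\<^bsub>B,2,1\<^esub> id)) \<circ> (?D \<otimes>\<^bsub>B,1,1\<^esub> ?D)) (pure B [x, y])"
    using B xy(3) unfolding braided_bialgebra_def Let_def eq_on_def by blast
  moreover have "(?D \<otimes>\<^bsub>B,1,1\<^esub> ?D) (tconcat B (pure B [x]) (pure B [y])) = tconcat B (?D (pure B [x])) (?D (pure B [y]))"
    by (rule tensor_map_tconcat[OF bialgebra_vspace comult_map_hom comult_map_hom xy(1,2)])
  then have "(?D \<otimes>\<^bsub>B,1,1\<^esub> ?D) (pure B [x, y]) = tconcat B (comult B x) (comult B y)"
    using assms by (simp add: comult_map_pure)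
  ultimately show ?thesis
    using assms unfolding braided_square_mult_def o_apply
    by (simp add: comult_map_pure mult_map_pure[OF bialgebra_algebra] mult_in[OF bialgebra_algebra])
qed

text \<open>Applying the counit to the first leg of \<open>x \<otimes> 1 + 1 \<otimes> x\<close>
  gives \<open>x = \<epsilon>(x) 1 + x\<close>, so \<open>\<epsilon>(x) 1 = 0\<close>. Applying the
  counit again yields the claim, as its value at 1 is 1.\<close>

lemma counit_primitive:
  assumes x: "x \<in> primitives B"
  shows "counit B x = 0"
proof -
  let ?D = "comult_map B" and ?e = "counit_map B" and ?u = "unit B"
  have xc: "x \<in> carrier B" and D: "comult B x = pure B [x, ?u] + pure B [?u, x]"
    using x by (auto simp: primitives_def)
  note u = unit_in[OF bialgebra_algebra]
  have cu: "counit B ?u = 1" using B by (simp add: braided_bialgebra_def)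
  have p: "pure B [y] \<in> tensor_power B 1" if "y \<in> carrier B" for y using that by simp
  note h = tensor_map_hom[OF bialgebra_vspace counit_map_hom hom_id[of B 1]]
  have e: "(?e \<otimes>\<^bsub>B,1,1\<^esub> id) (pure B [y, z]) = tscale (counit B y) (pure B [z])"
    if "y \<in> carrier B" "z \<in> carrier B" for y z
  proof -
    have "(?e \<otimes>\<^bsub>B,1,1\<^esub> id) (tconcat B (pure B [y]) (pure B [z])) = tconcat B (?e (pure B [y])) (id (pure B [z]))"
      by (rule tensor_map_tconcat[OF bialgebra_vspace counit_map_hom hom_id p p]) (use that in auto)
    then show ?thesis using that by (simp add: counit_map_pure)
  qed
  have "((?e \<otimes>\<^bsub>B,1,1\<^esub> id) \<circ> ?D) (pure B [x]) = id (pure B [x])"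
    using bialgebra_coalgebra p[OF xc] unfolding coalgebra_def Let_def eq_on_def by blast
  then have "(?e \<otimes>\<^bsub>B,1,1\<^esub> id) (pure B [x, ?u] + pure B [?u, x]) = pure B [x]"
    using xc by (simp add: comult_map_pure D)
  moreover have "(?e \<otimes>\<^bsub>B,1,1\<^esub> id) (pure B [x, ?u] + pure B [?u, x]) =
      (?e \<otimes>\<^bsub>B,1,1\<^esub> id) (pure B [x, ?u]) + (?e \<otimes>\<^bsub>B,1,1\<^esub> id) (pure B [?u, x])"
    by (rule hom_add[OF h]) (use xc u in auto)
  ultimately have "tscale (counit B x) (pure B [?u]) = 0"
    using xc u by (simp add: e cu del: One_nat_def)
  then have "pure B [vscale B (counit B x) ?u] = pure B [vscale B 0 ?u]"
    using pure_scale[of B "[]" _ ?u "[]"] by simp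
  then have "vscale B (counit B x) ?u = vscale B 0 ?u" by (rule singleton_inject[OF bialgebra_vspace])
  then have "counit B (vscale B (counit B x) ?u) = counit B (vscale B 0 ?u)" by simp
  then show ?thesis using counit_linear u cu by (simp add: linear_on_def)
qed

end

section \<open>Maps out of the braided tensor algebra\<close>

context
  fixes V :: "('k::field, 'v::ab_group_add) braided_space"
    and B :: "('k, 'b::ab_group_add) braided_bialg"
  assumes V: "braided_vector_space V" and B: "braided_bialgebra B"
begin

private abbreviation (input) "T \<equiv> braided_tensor_alg V"
private abbreviation (input) "TA \<equiv> braided_tensor_algebra V"

lemma braided_tensor_algebra_simps:
  "carrier TA = tensor_algebra V" "vscale TA = tscale" "braiding TA = braiding T"
  "mult TA = tconcat V" "unit TA = pure V []" "comult TA = tensor_comult V" "counit TA = tensor_counit V"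
  by (simp_all add: braided_tensor_algebra_def braided_alg.defs braided_tensor_alg_def tensor_alg_with_def)

private lemmas Tvs = braided_algebra_vspace[OF braided_tensor_alg_algebra[OF V]]
private lemmas Balg = bialgebra_algebra[OF B]
private lemmas Bvs = bialgebra_vspace[OF B]
private lemmas Vvs = braided_vector_space_hom(1)[OF V]

lemma tensor_power_TA: "tensor_power TA = tensor_power T"
  by (rule tensor_power_cong) (simp_all add: braided_tensor_algebra_simps)

lemma letter_linear_map: "linear_map V T (\<lambda>v. pure V [v])"
  using braided_tensor_alg_braided(2)[OF V] by (simp add: braided_map_def)

private abbreviation (input) "I \<equiv> tensor_powers_map V T (\<lambda>v. pure V [v])"

private lemmas I_props = letter_linear_map Vvs Tvs

lemma I_braiding:
  assumes "w \<in> tensor_power V 2"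
  shows "braiding T (I w) = I (braiding V w)"
proof -
  have "braiding T (tensor_square V T (\<lambda>v. pure V [v]) w) = tensor_square V T (\<lambda>v. pure V [v]) (braiding V w)"
    using braided_tensor_alg_braided(2)[OF V] assms unfolding braided_map_def eq_on_def by simp
  then show ?thesis
    using assms hom_in[OF braided_vector_space_hom(2)[OF V] assms]
    by (simp add: tensor_square_powers_map[OF I_props])
qed

lemma tensor_powers_map_comp_letters:
  assumes "linear_map T B \<phi>" and "w \<in> tensor_power V n"
  shows "tensor_powers_map T B \<phi> (I w) = tensor_powers_map V B (\<lambda>v. \<phi> (pure V [v])) w"
proof -
  have g: "linear_map V B (\<lambda>v. \<phi> (pure V [v]))"
    using assms(1) letter_linear_map unfolding linear_map_def linear_on_def image_subset_iff
    by (simp add: pure_singleton_linear)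
  from assms(2) show ?thesis
  proof induction
    case (pure vs)
    then have "set (map (\<lambda>v. pure V [v]) vs) \<subseteq> carrier T" by auto
    with pure show ?case
      by (simp add: tensor_powers_map_pure[OF I_props] tensor_powers_map_pure[OF assms(1) Tvs Bvs]
          tensor_powers_map_pure[OF g Vvs Bvs] comp_def)
  qed (simp_all add: tensor_powers_map_linear[OF I_props] tensor_powers_map_linear[OF assms(1) Tvs Bvs]
      tensor_powers_map_linear[OF g Vvs Bvs])
qed

text \<open>For a linear map the tensor square agrees with \<open>tensor_powers_map\<close> in
  degree 2, which has the better calculus; for a map that is not linear both sides are
  false.\<close>

lemma bialgebra_map_iff:
  "braided_bialgebra_map TA B \<phi> \<longleftrightarrow> algebra_map T B \<phi> \<and>
    (\<forall>x\<in>tensor_algebra V. comult B (\<phi> x) = tensor_powers_map T B \<phi> (tensor_comult V x)) \<and>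
    (\<forall>x\<in>tensor_algebra V. counit B (\<phi> x) = tensor_counit V x) \<and>
    (\<forall>x\<in>tensor_power T 2. braiding B (tensor_powers_map T B \<phi> x) = tensor_powers_map T B \<phi> (braiding T x))"
proof -
  have l: "linear_map TA B \<phi> = linear_map T B \<phi>"
    by (rule linear_map_cong) (simp_all add: braided_tensor_algebra_simps)
  have s: "tensor_square TA B \<phi> = tensor_square T B \<phi>"
    by (rule tensor_square_cong) (simp_all add: braided_tensor_algebra_simps)
  have a: "algebra_map TA B \<phi> = algebra_map T B \<phi>"
    by (simp add: algebra_map_def l braided_tensor_algebra_simps)
  show ?thesis
  proof (cases "linear_map T B \<phi>")
    case True
    note sq = tensor_square_powers_map[OF True Tvs Bvs _ refl]
    show ?thesis
      using True tensor_comult_in[OF V] hom_in[OF braided_algebra_braiding_hom[OF braided_tensor_alg_algebra[OF V]]]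
      by (auto simp: braided_bialgebra_map_def coalgebra_map_def braided_map_def eq_on_def l s a
          braided_tensor_algebra_simps tensor_power_TA sq)
  next
    case False
    then show ?thesis by (simp add: braided_bialgebra_map_def coalgebra_map_def l algebra_map_def)
  qed
qed

lemma pure_infinitesimal_part: "vscale (infinitesimal_part B) = vscale B" "braiding (infinitesimal_part B) = braiding B"
  "carrier (infinitesimal_part B) = primitives B"
  by (simp_all add: infinitesimal_part_def)

lemma primitives_subset: "primitives B \<subseteq> carrier B"
  by (auto simp: primitives_def)

text \<open>The infinitesimal part has the scalars and the braiding of \<open>B\<close>, so only the
  range condition distinguishes its maps from braided maps into \<open>B\<close>.\<close>

lemma braided_map_infinitesimal_iff:
  "braided_map V (infinitesimal_part B) \<gamma> \<longleftrightarrow>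
    linear_map V B \<gamma> \<and> \<gamma> ` carrier V \<subseteq> primitives B \<and>
    (\<forall>w\<in>tensor_power V 2. braiding B (tensor_powers_map V B \<gamma> w) = tensor_powers_map V B \<gamma> (braiding V w))"
proof -
  have l: "linear_map V (infinitesimal_part B) \<gamma> \<longleftrightarrow> linear_map V B \<gamma> \<and> \<gamma> ` carrier V \<subseteq> primitives B"
    using primitives_subset by (auto simp: linear_map_def pure_infinitesimal_part)
  show ?thesis
  proof (cases "linear_map V B \<gamma>")
    case True
    note sq = tensor_square_powers_map[OF True Vvs Bvs _ pure_infinitesimal_part(1)]
    show ?thesis
      using True hom_in[OF braided_vector_space_hom(2)[OF V]]
      by (auto simp: braided_map_def l eq_on_def pure_infinitesimal_part sq)
  next
    case False
    then show ?thesis by (simp add: braided_map_def l)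
  qed
qed

section \<open>From a surjective bialgebra map to its restriction to letters\<close>

lemma bialgebra_map_restricts:
  assumes \<phi>: "braided_bialgebra_map TA B \<phi>" and surj: "\<phi> ` carrier TA = carrier B"
  shows "is_Vc_bialgebra V B (\<lambda>v. \<phi> (pure V [v]))"
  unfolding is_Vc_bialgebra_def
proof (intro conjI B)
  let ?\<gamma> = "\<lambda>v. \<phi> (pure V [v])"
  note p = \<phi>[unfolded bialgebra_map_iff]
  have l: "linear_map T B \<phi>" using p by (simp add: algebra_map_def)
  have m: "\<phi> (tconcat V x y) = mult B (\<phi> x) (\<phi> y)" if "x \<in> tensor_algebra V" "y \<in> tensor_algebra V" for x y
    using p that by (simp add: algebra_map_def)
  have u: "\<phi> (pure V []) = unit B" using p by (simp add: algebra_map_def)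
  have g: "linear_map V B ?\<gamma>"
    using l unfolding linear_map_def linear_on_def image_subset_iff
    by (simp add: pure_singleton_linear)
  show "braided_map V (infinitesimal_part B) ?\<gamma>"
    unfolding braided_map_infinitesimal_iff
  proof (intro conjI g ballI)
    show "?\<gamma> ` carrier V \<subseteq> primitives B"
    proof
      fix b assume "b \<in> ?\<gamma> ` carrier V"
      then obtain v where v: "v \<in> carrier V" "b = ?\<gamma> v" by auto
      have "comult B (?\<gamma> v) = tensor_powers_map T B \<phi> (tensor_comult V (pure V [v]))"
        using p v by simp
      also have "\<dots> = pure B [?\<gamma> v, unit B] + pure B [unit B, ?\<gamma> v]"
        using v by (simp add: tensor_comult_letter[OF V] tensor_powers_map_linear[OF l Tvs Bvs]
            tensor_powers_map_pure[OF l Tvs Bvs] u)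
      finally show "b \<in> primitives B"
        using v g by (auto simp: primitives_def linear_map_def)
    qed
  next
    fix w assume w: "w \<in> tensor_power V 2"
    note cw = hom_in[OF braided_vector_space_hom(2)[OF V] w]
    have "I w \<in> tensor_power T 2" by (rule tensor_powers_map_in[OF I_props w])
    then have "braiding B (tensor_powers_map T B \<phi> (I w)) = tensor_powers_map T B \<phi> (braiding T (I w))"
      using p by blast
    then show "braiding B (tensor_powers_map V B ?\<gamma> w) = tensor_powers_map V B ?\<gamma> (braiding V w)"
      by (simp add: tensor_powers_map_comp_letters[OF l w] tensor_powers_map_comp_letters[OF l cw] I_braiding[OF w])
  qed
  show "generates (?\<gamma> ` carrier V) B"
    unfolding generates_def
  proof (intro conjI allI impI)
    show "?\<gamma> ` carrier V \<subseteq> carrier B" using g by (simp add: linear_map_def)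
    fix S assume S: "subalgebra S B \<and> ?\<gamma> ` carrier V \<subseteq> S"
    have mod: "module (vscale B)" using Bvs by (simp add: is_vspace_def module_iff_vector_space)
    have sub: "module.subspace (vscale B) S" using S by (simp add: subalgebra_def)
    \<comment> \<open>A subalgebra containing the images of letters contains those of words, hence
      by linearity the image of T(V), which is all of \<open>B\<close>.\<close>
    have "\<phi> x \<in> S" if "x \<in> tensor_algebra V" for x
      using that
    proof induction
      case zero
      have "\<phi> 0 = vscale B 0 (\<phi> 0)"
        using l unfolding linear_map_def linear_on_def by simp (metis tensor_algebra_0 tscale_simps(2))
      then show ?case using module.subspace_0[OF mod sub] module.scale_zero_left[OF mod] by simp
    next
      case (pure vs)
      then show ?case
      proof (induction vs)
        case Nil
        then show ?case using S u by (simp add: subalgebra_def)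
      next
        case (Cons v vs)
        then have "\<phi> (pure V (v # vs)) = mult B (\<phi> (pure V [v])) (\<phi> (pure V vs))"
          using m[of "pure V [v]" "pure V vs"] by simp
        then show ?case using Cons S by (auto simp: subalgebra_def)
      qed
    next
      case (add x y)
      then show ?case
        using l module.subspace_add[OF mod sub] by (simp add: linear_map_def linear_on_def)
    next
      case (scale a x)
      then show ?case
        using l module.subspace_scale[OF mod sub] by (simp add: linear_map_def linear_on_def)
    qed
    then have "carrier B \<subseteq> S" unfolding surj[symmetric] by (auto simp: braided_tensor_algebra_simps)
    then show "S = carrier B" using S by (auto simp: subalgebra_def)
  qed
qed

section \<open>The bialgebra map induced by a map on letters\<close>

context
  fixes \<gamma> :: "'v \<Rightarrow> 'b"
  assumes \<gamma>: "is_Vc_bialgebra V B \<gamma>"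
begin

lemma gamma_linear: "linear_map V B \<gamma>"
  and gamma_primitive: "v \<in> carrier V \<Longrightarrow> \<gamma> v \<in> primitives B"
  and gamma_braiding: "w \<in> tensor_power V 2 \<Longrightarrow>
    braiding B (tensor_powers_map V B \<gamma> w) = tensor_powers_map V B \<gamma> (braiding V w)"
  and gamma_generates: "generates (\<gamma> ` carrier V) B"
  using \<gamma> by (auto simp: is_Vc_bialgebra_def braided_map_infinitesimal_iff)

lemma gamma_in: "v \<in> carrier V \<Longrightarrow> \<gamma> v \<in> carrier B"
  using gamma_linear by (auto simp: linear_map_def)

definition word_value :: "'v list \<Rightarrow> 'b" where
  "word_value vs = foldr (\<lambda>v. mult B (\<gamma> v)) vs (unit B)"

lemma word_value_in: "set vs \<subseteq> carrier V \<Longrightarrow> word_value vs \<in> carrier B"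
  by (induction vs) (simp_all add: word_value_def unit_in[OF Balg] mult_in[OF Balg] gamma_in)

lemma word_value_Cons: "word_value (v # vs) = mult B (\<gamma> v) (word_value vs)"
  by (simp add: word_value_def)

lemma word_value_append:
  "set xs \<subseteq> carrier V \<Longrightarrow> set ys \<subseteq> carrier V \<Longrightarrow> word_value (xs @ ys) = mult B (word_value xs) (word_value ys)"
proof (induction xs)
  case Nil
  then show ?case by (simp add: word_value_def mult_unit[OF Balg] word_value_in[unfolded word_value_def])
next
  case (Cons v xs)
  then show ?case by (simp add: word_value_Cons mult_assoc[OF Balg] gamma_in word_value_in)
qed

lemma word_value_multilinear:
  "set (xs @ v # w # ys) \<subseteq> carrier V \<Longrightarrow>
    word_value (xs @ (v + w) # ys) = word_value (xs @ v # ys) + word_value (xs @ w # ys)"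
  "set (xs @ v # ys) \<subseteq> carrier V \<Longrightarrow>
    word_value (xs @ vscale V a v # ys) = vscale B a (word_value (xs @ v # ys))"
  using gamma_linear
  by (induction xs)
    (simp_all add: word_value_Cons mult_linear[OF Balg] gamma_in word_value_in linear_map_def linear_on_def)

lemma multilinear_map_word_value: "multilinear_map V (\<lambda>vs. pure B [word_value vs])"
  unfolding multilinear_map_def
  by (auto simp: word_value_multilinear pure_singleton_linear)

text \<open>\<open>tensor_ext\<close> produces tensors, so the linear extension of
  \<open>word_value\<close> is formed in degree one over \<open>B\<close> and pulled back along
  \<open>b \<mapsto> pure B [b]\<close>. On T(V) the choice exists by
  \<open>subspace_singletons\<close> and is unique by \<open>singleton_inject\<close>.\<close>

definition induced :: "('k, 'v) tensor \<Rightarrow> 'b" where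
  "induced x = (SOME b. b \<in> carrier B \<and> pure B [b] = tensor_ext V (\<lambda>vs. pure B [word_value vs]) x)"

lemma induced_in: "x \<in> tensor_algebra V \<Longrightarrow> induced x \<in> carrier B"
  and pure_induced: "x \<in> tensor_algebra V \<Longrightarrow> pure B [induced x] = tensor_ext V (\<lambda>vs. pure B [word_value vs]) x"
proof -
  assume x: "x \<in> tensor_algebra V"
  have "tensor_ext V (\<lambda>vs. pure B [word_value vs]) x \<in> {pure B [b] |b. b \<in> carrier B}"
    by (rule tensor_ext_in_subspace[OF Vvs multilinear_map_word_value subspace_singletons[OF Bvs] x])
      (use word_value_in in blast)
  then have "\<exists>b. b \<in> carrier B \<and> pure B [b] = tensor_ext V (\<lambda>vs. pure B [word_value vs]) x" by force
  from someI_ex[OF this]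
  show "induced x \<in> carrier B" "pure B [induced x] = tensor_ext V (\<lambda>vs. pure B [word_value vs]) x"
    unfolding induced_def by auto
qed

lemma induced_pure: "set vs \<subseteq> carrier V \<Longrightarrow> induced (pure V vs) = word_value vs"
  by (rule singleton_inject[OF Bvs]) (simp add: pure_induced tensor_ext_pure[OF Vvs multilinear_map_word_value])

lemma induced_add: "x \<in> tensor_algebra V \<Longrightarrow> y \<in> tensor_algebra V \<Longrightarrow> induced (x + y) = induced x + induced y"
  by (rule singleton_inject[OF Bvs])
    (simp add: pure_induced tensor_ext_add[OF Vvs multilinear_map_word_value] pure_singleton_linear)

lemma induced_scale: "x \<in> tensor_algebra V \<Longrightarrow> induced (tscale a x) = vscale B a (induced x)"
  by (rule singleton_inject[OF Bvs])
    (simp add: pure_induced tensor_ext_scale[OF Vvs multilinear_map_word_value] pure_singleton_linear)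

lemma scale_zero: "vscale B 0 x = 0"
  using Bvs module.scale_zero_left[of "vscale B"] by (simp add: is_vspace_def module_iff_vector_space)

lemma induced_0: "induced 0 = 0"
  using induced_scale[of 0 0] by (simp add: scale_zero)

private lemmas induced_linear = induced_add induced_scale induced_0

lemma mult_zero: "x \<in> carrier B \<Longrightarrow> mult B 0 x = 0" "x \<in> carrier B \<Longrightarrow> mult B x 0 = 0"
  using mult_linear(3,4)[OF Balg, of x x 0] by (simp_all add: scale_zero)

lemma induced_mult:
  assumes "x \<in> tensor_algebra V" "y \<in> tensor_algebra V"
  shows "induced (tconcat V x y) = mult B (induced x) (induced y)"
  using assms(1)
proof induction
  case (pure xs)
  from assms(2) show ?case
    by induction (use pure in \<open>simp_all add: induced_linear induced_pure word_value_append word_value_in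
      mult_linear[OF Balg] induced_in mult_zero\<close>)
qed (use assms(2) in \<open>simp_all add: induced_linear mult_linear[OF Balg] induced_in mult_zero\<close>)

lemma induced_letter: "v \<in> carrier V \<Longrightarrow> induced (pure V [v]) = \<gamma> v"
  by (simp add: induced_pure word_value_def mult_unit[OF Balg] gamma_in)

lemma induced_unit: "induced (pure V []) = unit B"
  by (simp add: induced_pure word_value_def)

lemma algebra_map_induced: "algebra_map T B induced" and linear_map_induced: "linear_map T B induced"
  by (auto simp: algebra_map_def linear_map_def linear_on_def braided_tensor_alg_algebra[OF V] V
      induced_linear induced_in induced_mult induced_unit)

private abbreviation (input) "P \<equiv> tensor_powers_map T B induced"

private lemmas P_props = linear_map_induced Tvs Bvs
private lemmas P_pure = tensor_powers_map_pure[OF P_props]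
private lemmas P_linear = tensor_powers_map_linear[OF P_props]
private lemmas P_in = tensor_powers_map_in[OF P_props]
private lemmas P_tconcat = tensor_powers_map_tconcat[OF P_props]

private lemmas P_mult_leg = tensor_powers_map_leg[OF P_props mult_map_hom[OF braided_tensor_alg_algebra[OF V]] mult_map_hom[OF Balg]
    algebra_map_mult_map[OF braided_tensor_alg_algebra[OF V] Balg algebra_map_induced]]

private lemmas T_alg = braided_tensor_alg_algebra[OF V]

private abbreviation (input) "mT i \<equiv> leg T i 2 (mult_map T)"
private abbreviation (input) "cT i \<equiv> leg T i 2 (braiding T)"
private abbreviation (input) "mB i \<equiv> leg B i 2 (mult_map B)"
private abbreviation (input) "cB i \<equiv> leg B i 2 (braiding B)"

private lemmas hT = braided_algebra_braiding_hom[OF T_alg]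
private lemmas hB = braided_algebra_braiding_hom[OF Balg]
private lemmas braiding_linear = hom_add[OF hT] hom_scale[OF hT] hom_0[OF hT] hom_add[OF hB] hom_scale[OF hB] hom_0[OF hB]
private lemmas legs_linear = leg_linear[OF Tvs hT] leg_linear[OF Bvs hB]
  leg_linear[OF Tvs mult_map_hom[OF T_alg]] leg_linear[OF Bvs mult_map_hom[OF Balg]]

lemma pair_linear:
  "pure T [x, y + z] = pure T [x, y] + pure T [x, z]" "pure T [x, tscale a y] = tscale a (pure T [x, y])"
  "pure T [x, 0] = 0"
  using pure_add[of T "[x]" y z "[]"] pure_scale[of T "[x]" a y "[]"] pure_scale[of T "[x]" 0 0 "[]"]
  by simp_all

text \<open>Peeling off the first letter \<open>w\<close> of the word keeps the induction inside letters: the braiding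
  maps \<open>v \<otimes> w\<close> to \<open>V \<otimes> V\<close>, so the crossing with the remaining word again starts from a letter.\<close>

lemma braiding_compat_letter_word:
  "v \<in> carrier V \<Longrightarrow> set ys \<subseteq> carrier V \<Longrightarrow>
    P (braiding T (pure T [pure V [v], pure V ys])) = braiding B (pure B [\<gamma> v, induced (pure V ys)])"
proof (induction ys arbitrary: v)
  case Nil
  then show ?case
    using braiding_unit(2)[OF T_alg, of "pure V [v]"] braiding_unit(2)[OF Balg gamma_in[of v]]
    by (simp add: P_pure induced_unit induced_letter)
next
  case (Cons w ys)
  let ?y = "pure V ys"
  have car: "v \<in> carrier V" "w \<in> carrier V" "?y \<in> tensor_algebra V" "pure V [v] \<in> tensor_algebra V" "pure V [w] \<in> tensor_algebra V"
    using Cons.prems by auto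
  have y3: "pure T [pure V [v], pure V [w], ?y] \<in> tensor_power T 3" using car by simp
  have vw: "pure V [v, w] \<in> tensor_power V 2" using car by simp
  note cvw = hom_in[OF braided_vector_space_hom(2)[OF V] vw]
  have Ivw: "I (pure V [v, w]) = pure T [pure V [v], pure V [w]]"
    using car by (simp add: tensor_powers_map_pure[OF I_props])
  \<comment> \<open>The braiding of \<open>v\<close> and \<open>w\<close> is a sum of products of
    two letters, so the remaining crossing is treated for every \<open>u\<close> of degree 2. The
    induction hypothesis is applied to the second letter of a summand, hence \<open>v\<close> is
    arbitrary in the induction.\<close>
  have key: "P (mT 0 (cT 1 (tconcat T (I u) (pure T [?y])))) =
      mB 0 (cB 1 (tconcat B (tensor_powers_map V B \<gamma> u) (pure B [induced ?y])))"
    if "u \<in> tensor_power V 2" for u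
    using that
  proof induction
    case (pure us)
    then obtain a b where us: "us = [a, b]" and ab: "a \<in> carrier V" "b \<in> carrier V"
      by (auto simp: numeral_2_eq_2 length_Suc_conv)
    have t: "pure T [pure V [b], ?y] \<in> tensor_power T 2" using ab car by simp
    note ct = hom_in[OF hT t]
    have s: "pure B [\<gamma> b, induced ?y] \<in> tensor_power B 2" using ab car by (simp add: gamma_in induced_in)
    have pa: "pure T [pure V [a]] \<in> tensor_power T 1" using ab by simp
    have e1: "cT 1 (pure T [pure V [a], pure V [b], ?y]) = tconcat T (pure T [pure V [a]]) (braiding T (pure T [pure V [b], ?y]))"
      using braiding_leg1[OF T_alg t, of "pure V [a]"] ab by simp
    have e2: "cB 1 (pure B [\<gamma> a, \<gamma> b, induced ?y]) = tconcat B (pure B [\<gamma> a]) (braiding B (pure B [\<gamma> b, induced ?y]))"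
      using braiding_leg1[OF Balg s, of "\<gamma> a"] ab by (simp add: gamma_in)
    have t3: "tconcat T (pure T [pure V [a]]) (braiding T (pure T [pure V [b], ?y])) \<in> tensor_power T 3"
      by (rule tconcat_in_tp'[OF pa ct]) simp
    have "P (mT 0 (cT 1 (pure T [pure V [a], pure V [b], ?y]))) =
        mB 0 (P (tconcat T (pure T [pure V [a]]) (braiding T (pure T [pure V [b], ?y]))))"
      unfolding e1 by (rule P_mult_leg[OF _ t3]) simp_all
    also have "\<dots> = mB 0 (tconcat B (pure B [\<gamma> a]) (braiding B (pure B [\<gamma> b, induced ?y])))"
      using pa ct ab Cons.IH[OF ab(2)] Cons.prems
      by (simp add: P_tconcat P_pure tensor_power_in_algebra[OF pa] tensor_power_in_algebra[OF ct] induced_letter)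
    finally show ?case
      using ab e2 by (simp add: us tensor_powers_map_pure[OF I_props] tensor_powers_map_pure[OF gamma_linear Vvs Bvs])
  qed (use car in \<open>simp_all add: tensor_powers_map_linear[OF I_props] tensor_powers_map_linear[OF gamma_linear Vvs Bvs] P_linear legs_linear\<close>)
  \<comment> \<open>To cross the word, \<open>v\<close> crosses \<open>w\<close>, then what arises
    crosses \<open>ys\<close>, then one multiplies. The same three operations are afterwards
    collected again in \<open>B\<close>.\<close>
  have "braiding T (pure T [pure V [v], pure V (w # ys)]) = braiding T (mT 1 (pure T [pure V [v], pure V [w], ?y]))"
    using mult_leg1[OF T_alg, of "pure V [v]" "pure V [w]" ?y] car by simp
  also have "\<dots> = mT 0 (cT 1 (cT 0 (pure T [pure V [v], pure V [w], ?y])))"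
    by (rule braiding_mult_base(2)[OF T_alg y3])
  also have "cT 0 (pure T [pure V [v], pure V [w], ?y]) = tconcat T (I (braiding V (pure V [v, w]))) (pure T [?y])"
    using braiding_leg0[OF T_alg, of "pure T [pure V [v], pure V [w]]" ?y] car I_braiding[OF vw]
    by (simp add: Ivw)
  finally have e: "braiding T (pure T [pure V [v], pure V (w # ys)]) =
      mT 0 (cT 1 (tconcat T (I (braiding V (pure V [v, w]))) (pure T [?y])))" .
  have "P (braiding T (pure T [pure V [v], pure V (w # ys)])) = mB 0 (cB 1 (tconcat B (tensor_powers_map V B \<gamma> (braiding V (pure V [v, w]))) (pure B [induced ?y])))"
    unfolding e by (rule key[OF cvw])
  also have "tensor_powers_map V B \<gamma> (braiding V (pure V [v, w])) = braiding B (pure B [\<gamma> v, \<gamma> w])"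
    using gamma_braiding[OF vw] car by (simp add: tensor_powers_map_pure[OF gamma_linear Vvs Bvs])
  also have "tconcat B (braiding B (pure B [\<gamma> v, \<gamma> w])) (pure B [induced ?y]) = cB 0 (pure B [\<gamma> v, \<gamma> w, induced ?y])"
    using braiding_leg0[OF Balg, of "pure B [\<gamma> v, \<gamma> w]" "induced ?y"] car by (simp add: gamma_in induced_in)
  also have "mB 0 (cB 1 (cB 0 (pure B [\<gamma> v, \<gamma> w, induced ?y]))) = braiding B (mB 1 (pure B [\<gamma> v, \<gamma> w, induced ?y]))"
    by (rule braiding_mult_base(2)[OF Balg, symmetric]) (use car in \<open>simp add: gamma_in induced_in\<close>)
  also have "mB 1 (pure B [\<gamma> v, \<gamma> w, induced ?y]) = pure B [\<gamma> v, induced (pure V (w # ys))]"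
    using mult_leg1[OF Balg, of "\<gamma> v" "\<gamma> w" "induced ?y"] car Cons.prems
    by (simp add: gamma_in induced_in induced_pure word_value_Cons)
  finally show ?case .
qed

lemma braiding_compat_letter:
  assumes v: "v \<in> carrier V" and "y \<in> tensor_algebra V"
  shows "P (braiding T (pure T [pure V [v], y])) = braiding B (P (pure T [pure V [v], y]))"
  using assms(2)
proof induction
  case zero
  then show ?case by (simp add: pair_linear braiding_linear P_linear)
next
  case (pure ys)
  then show ?case
    using braiding_compat_letter_word[OF v pure] v
    by (simp add: P_pure induced_letter)
next
  case (add y z)
  have t: "pure T [pure V [v], x] \<in> tensor_power T 2" if "x \<in> tensor_algebra V" for x
    using that v by simp
  show ?case using add t[OF add(1)] t[OF add(2)] P_in[OF t[OF add(1)]] P_in[OF t[OF add(2)]]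
    by (simp add: pair_linear braiding_linear P_linear)
next
  case (scale a y)
  have t: "pure T [pure V [v], x] \<in> tensor_power T 2" if "x \<in> tensor_algebra V" for x
    using that v by simp
  show ?case using scale t[OF scale(1)] P_in[OF t[OF scale(1)]]
    by (simp add: pair_linear braiding_linear P_linear)
qed

text \<open>The induction is on the left word, with any tensor on the right: after the tail of the
  word has crossed \<open>y\<close>, its first letter meets an arbitrary element of T(V), which is
  the case settled by \<open>braiding_compat_letter\<close>.\<close>

lemma braiding_compat_word:
  assumes "set xs \<subseteq> carrier V" and y: "y \<in> tensor_algebra V"
  shows "P (braiding T (pure T [pure V xs, y])) = braiding B (P (pure T [pure V xs, y]))"
  using assms(1)
proof (induction xs)
  case Nil
  then show ?case
    using braiding_unit(1)[OF T_alg, of y] braiding_unit(1)[OF Balg induced_in[OF y]] y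
    by (simp add: P_pure induced_unit)
next
  case (Cons v xs)
  let ?x = "pure V xs"
  have car: "v \<in> carrier V" "?x \<in> tensor_algebra V" "pure V [v] \<in> tensor_algebra V"
    using Cons.prems by auto
  have y3: "pure T [pure V [v], ?x, y] \<in> tensor_power T 3" using car y by simp
  have xy: "pure T [?x, y] \<in> tensor_power T 2" using car y by simp
  note cxy = hom_in[OF hT xy]
  have xyB: "pure B [induced ?x, induced y] \<in> tensor_power B 2" using car y by (simp add: induced_in)
  have pv: "pure T [pure V [v]] \<in> tensor_power T 1" using car by simp
  \<comment> \<open>The braiding of the tail with \<open>y\<close> need not be pure, so the crossing
    of the first letter is treated for all \<open>t\<close> of degree 2.\<close>
  have key: "P (cT 0 (tconcat T (pure T [pure V [v]]) t)) = cB 0 (tconcat B (pure B [\<gamma> v]) (P t))"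
    if "t \<in> tensor_power T 2" for t
    using that
  proof induction
    case (pure ts)
    then obtain a b where ts: "ts = [a, b]" and ab: "a \<in> tensor_algebra V" "b \<in> tensor_algebra V"
      by (auto simp: numeral_2_eq_2 length_Suc_conv)
    have t: "pure T [pure V [v], a] \<in> tensor_power T 2" using ab car by simp
    have s: "pure B [\<gamma> v, induced a] \<in> tensor_power B 2" using ab car by (simp add: gamma_in induced_in)
    have "cT 0 (pure T [pure V [v], a, b]) = tconcat T (braiding T (pure T [pure V [v], a])) (pure T [b])"
      using braiding_leg0[OF T_alg t, of b] ab by simp
    moreover have "cB 0 (pure B [\<gamma> v, induced a, induced b]) = tconcat B (braiding B (pure B [\<gamma> v, induced a])) (pure B [induced b])"
      using braiding_leg0[OF Balg s, of "induced b"] ab by (simp add: induced_in)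
    ultimately show ?case
      using ab car braiding_compat_letter[OF car(1) ab(1)] tensor_power_in_algebra[OF hom_in[OF hT t]]
      by (simp add: ts P_pure P_tconcat induced_letter)
  qed (use pv gamma_in[OF car(1)] P_in in \<open>simp_all add: P_linear legs_linear tensor_power_in_algebra[OF pv] tensor_power_in_algebra[OF P_in]\<close>)
  have t3: "cT 0 (tconcat T (pure T [pure V [v]]) (braiding T (pure T [?x, y]))) \<in> tensor_power T 3"
    by (rule cc_in[OF T_alg tconcat_in_tp'[OF pv cxy], of _ _ 1]) simp_all
  have "braiding T (pure T [pure V (v # xs), y]) = braiding T (mT 0 (pure T [pure V [v], ?x, y]))"
    using mult_leg0[OF T_alg, of "pure V [v]" ?x y] car y by simp
  also have "\<dots> = mT 1 (cT 0 (cT 1 (pure T [pure V [v], ?x, y])))"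
    by (rule braiding_mult_base(1)[OF T_alg y3])
  also have "cT 1 (pure T [pure V [v], ?x, y]) = tconcat T (pure T [pure V [v]]) (braiding T (pure T [?x, y]))"
    using braiding_leg1[OF T_alg xy, of "pure V [v]"] car by simp
  finally have e: "braiding T (pure T [pure V (v # xs), y]) =
      mT 1 (cT 0 (tconcat T (pure T [pure V [v]]) (braiding T (pure T [?x, y]))))" .
  have "P (braiding T (pure T [pure V (v # xs), y])) = mB 1 (P (cT 0 (tconcat T (pure T [pure V [v]]) (braiding T (pure T [?x, y])))))"
    unfolding e by (rule P_mult_leg[OF _ t3]) simp_all
  also have "P (cT 0 (tconcat T (pure T [pure V [v]]) (braiding T (pure T [?x, y])))) =
      cB 0 (tconcat B (pure B [\<gamma> v]) (P (braiding T (pure T [?x, y]))))"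
    by (rule key[OF cxy])
  also have "P (braiding T (pure T [?x, y])) = braiding B (pure B [induced ?x, induced y])"
    using Cons car y by (simp add: P_pure)
  also have "tconcat B (pure B [\<gamma> v]) (braiding B (pure B [induced ?x, induced y])) = cB 1 (pure B [\<gamma> v, induced ?x, induced y])"
    using braiding_leg1[OF Balg xyB, of "\<gamma> v"] car by (simp add: gamma_in)
  also have "mB 1 (cB 0 (cB 1 (pure B [\<gamma> v, induced ?x, induced y]))) = braiding B (mB 0 (pure B [\<gamma> v, induced ?x, induced y]))"
    by (rule braiding_mult_base(1)[OF Balg, symmetric]) (use car y in \<open>simp add: gamma_in induced_in\<close>)
  also have "mB 0 (pure B [\<gamma> v, induced ?x, induced y]) = pure B [induced (pure V (v # xs)), induced y]"
    using mult_leg0[OF Balg, of "\<gamma> v" "induced ?x" "induced y"] car y Cons.prems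
    by (simp add: gamma_in induced_in induced_pure word_value_Cons)
  finally show ?case using Cons.prems y by (simp add: P_pure)
qed

lemma pair_linear_left:
  "pure T [y + z, x] = pure T [y, x] + pure T [z, x]" "pure T [tscale a y, x] = tscale a (pure T [y, x])"
  "pure T [0, x] = 0"
  using pure_add[of T "[]" y z "[x]"] pure_scale[of T "[]" a y "[x]"] pure_scale[of T "[]" 0 0 "[x]"]
  by simp_all

lemma braiding_compat:
  assumes "w \<in> tensor_power T 2"
  shows "P (braiding T w) = braiding B (P w)"
  using assms
proof induction
  case (pure ts)
  then obtain x y where ts: "ts = [x, y]" and x: "x \<in> tensor_algebra V" and y: "y \<in> tensor_algebra V"
    by (auto simp: numeral_2_eq_2 length_Suc_conv)
  have t: "pure T [x, y] \<in> tensor_power T 2" if "x \<in> tensor_algebra V" for x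
    using that y by simp
  from x show ?case unfolding ts
  proof induction
    case zero
    then show ?case by (simp add: pair_linear_left braiding_linear P_linear)
  next
    case (pure xs)
    then show ?case using braiding_compat_word[OF _ y] by simp
  next
    case (add x z)
    then show ?case using t[OF add(1)] t[OF add(2)] P_in[OF t[OF add(1)]] P_in[OF t[OF add(2)]]
      by (simp add: pair_linear_left braiding_linear P_linear)
  next
    case (scale a x)
    then show ?case using t[OF scale(1)] P_in[OF t[OF scale(1)]]
      by (simp add: pair_linear_left braiding_linear P_linear)
  qed
qed (simp_all add: braiding_linear P_linear P_in)

text \<open>Both sides are multiplicative, the right one because \<open>P\<close> respects the
  braided square products; an induction over the letters of a word then leaves the values on single
  letters.\<close>

lemma comult_compat:
  assumes "x \<in> tensor_algebra V"
  shows "comult B (induced x) = P (tensor_comult V x)"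
proof -
  have l: "tensor_comult V (x + y) = tensor_comult V x + tensor_comult V y"
    "tensor_comult V (tscale a x) = tscale a (tensor_comult V x)"
    if "x \<in> tensor_algebra V" "y \<in> tensor_algebra V" for x y a
    using tensor_comult_linear[OF V] that by (auto simp: linear_on_def)
  have lB: "comult B (b + d) = comult B b + comult B d" "comult B (vscale B a b) = tscale a (comult B b)"
    if "b \<in> carrier B" "d \<in> carrier B" for b d a
    using comult_linear[OF B] that by (auto simp: linear_on_def)
  have z: "0 \<in> carrier B" by (rule is_vspace_closed(3)[OF Bvs])
  from assms show ?thesis
  proof induction
    case zero
    have "comult B 0 = 0" using lB(2)[OF z z, of 0] by (simp add: scale_zero)
    moreover have "tensor_comult V 0 = 0" using l(2)[OF tensor_algebra_0 tensor_algebra_0, of 0] by simp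
    ultimately show ?case by (simp add: induced_0 P_linear)
  next
    case (pure vs)
    then show ?case
    proof (induction vs)
      case Nil
      then show ?case using B
        by (simp add: induced_unit tensor_comult_unit[OF V] P_pure braided_bialgebra_def)
    next
      case (Cons v vs)
      let ?x = "pure V vs"
      have car: "v \<in> carrier V" "?x \<in> tensor_algebra V" "pure V [v] \<in> tensor_algebra V"
        using Cons.prems by auto
      have "comult B (induced (pure V (v # vs))) = comult B (mult B (\<gamma> v) (induced ?x))"
        using Cons.prems by (simp add: induced_pure word_value_Cons)
      also have "\<dots> = braided_square_mult B (comult B (\<gamma> v)) (comult B (induced ?x))"
        by (rule comult_mult[OF B]) (use car in \<open>simp_all add: gamma_in induced_in\<close>)
      \<comment> \<open>Primitivity of the value of \<open>\<gamma>\<close> matches the prescribed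
        comultiplication of a letter.\<close>
      also have "comult B (\<gamma> v) = P (tensor_comult V (pure V [v]))"
        using car gamma_primitive[OF car(1)]
        by (simp add: primitives_def tensor_comult_letter[OF V] P_linear P_pure
            induced_letter induced_unit)
      also have "comult B (induced ?x) = P (tensor_comult V ?x)" using Cons by simp
      also have "braided_square_mult B (P (tensor_comult V (pure V [v]))) (P (tensor_comult V ?x)) =
          P (braided_square_mult T (tensor_comult V (pure V [v])) (tensor_comult V ?x))"
        by (rule braided_square_mult_map[OF T_alg Balg algebra_map_induced braiding_compat, symmetric])
          (use car in \<open>simp_all add: tensor_comult_in[OF V]\<close>)
      also have "braided_square_mult T (tensor_comult V (pure V [v])) (tensor_comult V ?x) = tensor_comult V (pure V (v # vs))"
        using tensor_comult_mult[OF V car(3,2)] by simp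
      finally show ?case .
    qed
  qed (simp_all add: induced_linear lB l induced_in P_linear lB(2)[OF _ z] l(2)[OF _ tensor_algebra_0])
qed

lemma counit_compat:
  assumes "x \<in> tensor_algebra V"
  shows "counit B (induced x) = tensor_counit V x"
proof -
  have l: "tensor_counit V (x + y) = tensor_counit V x + tensor_counit V y"
    "tensor_counit V (tscale a x) = a * tensor_counit V x"
    if "x \<in> tensor_algebra V" "y \<in> tensor_algebra V" for x y a
    using tensor_counit_linear[OF V] that by (auto simp: linear_on_def)
  have lB: "counit B (b + d) = counit B b + counit B d" "counit B (vscale B a b) = a * counit B b"
    if "b \<in> carrier B" "d \<in> carrier B" for b d a
    using counit_linear[OF B] that by (auto simp: linear_on_def)
  have z: "0 \<in> carrier B" by (rule is_vspace_closed(3)[OF Bvs])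
  from assms show ?thesis
  proof induction
    case zero
    have "counit B 0 = 0" using lB(2)[OF z z, of 0] by (simp add: scale_zero)
    moreover have "tensor_counit V 0 = 0" using l(2)[OF tensor_algebra_0 tensor_algebra_0, of 0] by simp
    ultimately show ?case by (simp add: induced_0)
  next
    case (pure vs)
    then show ?case
    proof (induction vs)
      case Nil
      then show ?case using B by (simp add: induced_unit tensor_counit_unit[OF V] braided_bialgebra_def)
    next
      case (Cons v vs)
      then have "counit B (mult B (\<gamma> v) (word_value vs)) = counit B (\<gamma> v) * counit B (word_value vs)"
        using B by (simp add: braided_bialgebra_def gamma_in word_value_in)
      \<comment> \<open>On a nonempty word both counits vanish: the one of T(V) on the first letter,
        the one of \<open>B\<close> on its primitive value.\<close>
      moreover have "tensor_counit V (pure V (v # vs)) = 0"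
        using tensor_counit_mult[OF V, of "pure V [v]" "pure V vs"] tensor_counit_letter[OF V, of v] Cons.prems by simp
      ultimately show ?case
        using Cons.prems counit_primitive[OF B gamma_primitive[of v]] by (simp add: induced_pure word_value_Cons)
    qed
  qed (simp_all add: induced_linear lB l induced_in lB(2)[OF _ z] l(2)[OF _ tensor_algebra_0])
qed

text \<open>The image is a subalgebra and contains the values of \<open>\<gamma>\<close>, which
  generate \<open>B\<close>.\<close>

lemma induced_surj: "induced ` tensor_algebra V = carrier B"
proof -
  have mod: "module (vscale B)" using Bvs by (simp add: is_vspace_def module_iff_vector_space)
  let ?S = "induced ` tensor_algebra V"
  have "module.subspace (vscale B) ?S"
  proof (rule module.subspaceI[OF mod])
    show "0 \<in> ?S" using induced_0 by (metis image_eqI tensor_algebra_0)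
    show "x + y \<in> ?S" if "x \<in> ?S" "y \<in> ?S" for x y
      using that by (auto simp flip: induced_add)
    show "vscale B a x \<in> ?S" if "x \<in> ?S" for a x
      using that by (auto simp flip: induced_scale)
  qed
  moreover have "unit B \<in> ?S" using induced_unit by (metis image_eqI pure_in_ta empty_set empty_subsetI)
  ultimately have "subalgebra ?S B"
    by (auto simp: subalgebra_def induced_in simp flip: induced_mult)
  moreover have "\<gamma> ` carrier V \<subseteq> ?S"
    by (auto simp flip: induced_letter)
  ultimately show ?thesis using gamma_generates unfolding generates_def by blast
qed

lemma induced_bialgebra_map:
  "braided_bialgebra_map TA B induced" "induced ` carrier TA = carrier B"
  using algebra_map_induced comult_compat counit_compat braiding_compat induced_surj
  by (simp_all add: bialgebra_map_iff braided_tensor_algebra_simps)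

end

end

theorem lemma4p10:
  fixes V :: "('k::field, 'v::ab_group_add) braided_space"
    and B :: "('k, 'b::ab_group_add) braided_bialg"
  assumes "braided_vector_space V" and "braided_bialgebra B"
  shows "(\<exists>\<gamma>. is_Vc_bialgebra V B \<gamma>) \<longleftrightarrow>
    (\<exists>\<phi>. braided_bialgebra_map (braided_tensor_algebra V) B \<phi> \<and>
       \<phi> ` carrier (braided_tensor_algebra V) = carrier B)"
proof
  assume "\<exists>\<gamma>. is_Vc_bialgebra V B \<gamma>"
  then obtain \<gamma> where "is_Vc_bialgebra V B \<gamma>" ..
  from induced_bialgebra_map[OF assms this]
  show "\<exists>\<phi>. braided_bialgebra_map (braided_tensor_algebra V) B \<phi> \<and>
       \<phi> ` carrier (braided_tensor_algebra V) = carrier B" by blast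
next
  assume "\<exists>\<phi>. braided_bialgebra_map (braided_tensor_algebra V) B \<phi> \<and>
       \<phi> ` carrier (braided_tensor_algebra V) = carrier B"
  then show "\<exists>\<gamma>. is_Vc_bialgebra V B \<gamma>"
    using bialgebra_map_restricts[OF assms] by blast
qed

end
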